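(* Let $Z$ be a fat point scheme in $\mathbb{P}^1\times\mathbb{P}^1$ with Hilbert function $H_Z$. The following are equivalent: (i) $Z$ is arithmetically Cohen–Macaulay; (ii) $\Delta H_Z$ is the Hilbert function of a bigraded artinian quotient of $\mathbf{k}[x_1,y_1]$ (bigraded by $\deg x_1=(1,0)$, $\deg y_1=(0,1)$); (iii) $\alpha_Z^*=\beta_Z$; (iv) the set $\mathcal{S}_Z$ is totally ordered under the componentwise order on $\mathbb{N}^t$.
   Context: $\mathbf{k}$ algebraically closed, $R=\mathbf{k}[x_0,x_1,y_0,y_1]$ bigraded with $\deg x_i=(1,0)$, $\deg y_i=(0,1)$; a point $[a_0:a_1]\times[b_0:b_1]$ has ideal $(a_1x_0-a_0x_1,b_1y_0-b_0y_1)$; a fat point scheme $Z$ (distinct points $P_k$ with positive multiplicities $m_k$) has ideal $I_Z=\bigcap\wp_{P_k}^{m_k}$, Hilbert function $H_Z(i,j)=\dim_{\mathbf{k}}(R/I_Z)_{(i,j)}$, and is ACM if $R/I_Z$ is Cohen–Macaulay. $\Delta H_Z(i,j)=H_Z(i,j)-H_Z(i-1,j)-H_Z(i,j-1)+H_Z(i-1,j-1)$ with $H_Z=0$ outside $\mathbb{N}^2$. With $\pi_1(\mathrm{Supp}\,Z)=\{R_1,\dots,R_r\}$, $\pi_2(\mathrm{Supp}\,Z)=\{Q_1,\dots,Q_t\}$ and $m_{ij}$ the multiplicity of $R_i\times Q_j$ ($0$ if absent), $(n)_+=\max\{0,n\}$: $l_i=\max_j m_{ij}$, $a_{i,k}=\sum_j(m_{ij}-k)_+$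 ($0\le k\le l_i-1$), $\alpha_Z$ = all $a_{i,k}$ in non-increasing order; $l'_j=\max_i m_{ij}$, $b_{j,k}=\sum_i(m_{ij}-k)_+$ ($0\le k\le l'_j-1$), $\beta_Z$ = all $b_{j,k}$ in non-increasing order. The conjugate of a partition $\lambda$ is $\lambda^*$ with $\lambda^*_i=\#\{j:\lambda_j\ge i\}$, $i=1,\dots,\lambda_1$. With $t_{ij}(h)=(m_{ij}-h)_+$, $\mathcal{S}_Z=\{(t_{i1}(h),\dots,t_{it}(h)) : 1\le i\le r,\ h\in\mathbb{N}\}\subseteq\mathbb{N}^t$. *)

theory Defs
  imports Main "HOL-Library.Poly_Mapping" "HOL-Library.Multiset" "HOL-Library.Extended_Nat"
    "HOL-Computational_Algebra.Polynomial"
begin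

type_synonym ('v, 'k) mpoly = "('v \<Rightarrow>\<^sub>0 nat) \<Rightarrow>\<^sub>0 'k"

definition mconst :: "'k::comm_ring_1 \<Rightarrow> ('v, 'k) mpoly" where
  "mconst c = Poly_Mapping.single 0 c"

definition mvar :: "'v \<Rightarrow> ('v, 'k::comm_ring_1) mpoly" where
  "mvar v = Poly_Mapping.single (Poly_Mapping.single v 1) 1"

definition mscale :: "'k::field \<Rightarrow> ('v, 'k) mpoly \<Rightarrow> ('v, 'k) mpoly" where
  "mscale c p = mconst c * p"

definition kdim :: "('v, 'k::field) mpoly set \<Rightarrow> nat" where
  "kdim V = vector_space.dim mscale V"

definition is_ideal :: "'a::comm_ring_1 set \<Rightarrow> bool" where
  "is_ideal I \<longleftrightarrow> 0 \<in> I \<and> (\<forall>a\<in>I. \<forall>b\<in>I. a + b \<in> I) \<and> (\<forall>r. \<forall>a\<in>I. r * a \<in> I)"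

definition ideal_gen :: "'a::comm_ring_1 set \<Rightarrow> 'a set" where
  "ideal_gen S = \<Inter> {I. is_ideal I \<and> S \<subseteq> I}"

definition ideal_prod :: "'a::comm_ring_1 set \<Rightarrow> 'a set \<Rightarrow> 'a set" where
  "ideal_prod I J = ideal_gen {a * b |a b. a \<in> I \<and> b \<in> J}"

fun ideal_pow :: "'a::comm_ring_1 set \<Rightarrow> nat \<Rightarrow> 'a set" where
  "ideal_pow I 0 = UNIV"
| "ideal_pow I (Suc n) = ideal_prod I (ideal_pow I n)"

definition prime_ideal :: "'a::comm_ring_1 set \<Rightarrow> bool" where
  "prime_ideal P \<longleftrightarrow> is_ideal P \<and> P \<noteq> UNIV \<and> (\<forall>a b. a * b \<in> P \<longrightarrow> a \<in> P \<or> b \<in> P)"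

definition krull_dim_quot :: "'a::comm_ring_1 set \<Rightarrow> enat" where
  "krull_dim_quot I = Sup {enat n |n. \<exists>C :: nat \<Rightarrow> 'a set.
      (\<forall>i\<le>n. prime_ideal (C i) \<and> I \<subseteq> C i) \<and> (\<forall>i<n. C i \<subset> C (Suc i))}"

definition regular_seq :: "'a::comm_ring_1 set \<Rightarrow> 'a list \<Rightarrow> bool" where
  "regular_seq I fs \<longleftrightarrow>
     (\<forall>i<length fs. \<forall>g. fs ! i * g \<in> ideal_gen (I \<union> set (take i fs))
                         \<longrightarrow> g \<in> ideal_gen (I \<union> set (take i fs)))
     \<and> ideal_gen (I \<union> set fs) \<noteq> UNIV"

definition irrelevant_ideal :: "('v, 'k::comm_ring_1) mpoly set" where
  "irrelevant_ideal = ideal_gen (range mvar)"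

definition depth_quot :: "('v, 'k::comm_ring_1) mpoly set \<Rightarrow> enat" where
  "depth_quot I = Sup {enat (length fs) |fs. set fs \<subseteq> irrelevant_ideal \<and> regular_seq I fs}"

(* R/I Cohen-Macaulay (graded setting: depth of the homogeneous maximal ideal = dimension) *)
definition cohen_macaulay_quot :: "('v, 'k::comm_ring_1) mpoly set \<Rightarrow> bool" where
  "cohen_macaulay_quot I \<longleftrightarrow> depth_quot I = krull_dim_quot I"

(* R/I artinian: descending chain condition on ideals of R/I (= ideals of R containing I) *)
definition artinian_quot :: "'a::comm_ring_1 set \<Rightarrow> bool" where
  "artinian_quot I \<longleftrightarrow> (\<forall>C :: nat \<Rightarrow> 'a set.
      (\<forall>i. is_ideal (C i) \<and> I \<subseteq> C i \<and> C (Suc i) \<subseteq> C i) \<longrightarrow> (\<exists>n. \<forall>k\<ge>n. C k = C n))"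

definition mdeg :: "('v \<Rightarrow> nat \<times> nat) \<Rightarrow> ('v \<Rightarrow>\<^sub>0 nat) \<Rightarrow> nat \<times> nat" where
  "mdeg dg m = ((\<Sum>v\<in>Poly_Mapping.keys m. Poly_Mapping.lookup m v * fst (dg v)), (\<Sum>v\<in>Poly_Mapping.keys m. Poly_Mapping.lookup m v * snd (dg v)))"

definition bicomp :: "('v \<Rightarrow> nat \<times> nat) \<Rightarrow> nat \<times> nat \<Rightarrow> ('v, 'k::zero) mpoly set" where
  "bicomp dg d = {p. \<forall>m\<in>Poly_Mapping.keys p. mdeg dg m = d}"

definition bihom_ideal :: "('v \<Rightarrow> nat \<times> nat) \<Rightarrow> ('v, 'k::comm_ring_1) mpoly set \<Rightarrow> bool" where
  "bihom_ideal dg I \<longleftrightarrow> is_ideal I \<and> I = ideal_gen (I \<inter> (\<Union>d. bicomp dg d))"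

definition hilb :: "('v \<Rightarrow> nat \<times> nat) \<Rightarrow> ('v, 'k::field) mpoly set \<Rightarrow> nat \<times> nat \<Rightarrow> nat" where
  "hilb dg I d = kdim (bicomp dg d :: (_, 'k) mpoly set) - kdim (I \<inter> bicomp dg d)"

datatype var4 = X0 | X1 | Y0 | Y1

fun dg4 :: "var4 \<Rightarrow> nat \<times> nat" where
  "dg4 X0 = (1, 0)" | "dg4 X1 = (1, 0)" | "dg4 Y0 = (0, 1)" | "dg4 Y1 = (0, 1)"

datatype var2 = VX1 | VY1

fun dg2 :: "var2 \<Rightarrow> nat \<times> nat" where
  "dg2 VX1 = (1, 0)" | "dg2 VY1 = (0, 1)"

(* P^1 over 'k: None = [0:1], Some a = [1:a]; every point has exactly one such representative *)
fun p1coords :: "'k::comm_ring_1 option \<Rightarrow> 'k \<times> 'k" where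
  "p1coords None = (0, 1)"
| "p1coords (Some a) = (1, a)"

definition point_ideal :: "'k::comm_ring_1 option \<times> 'k option \<Rightarrow> (var4, 'k) mpoly set" where
  "point_ideal P = (let (a0, a1) = p1coords (fst P); (b0, b1) = p1coords (snd P) in
     ideal_gen {mconst a1 * mvar X0 - mconst a0 * mvar X1, mconst b1 * mvar Y0 - mconst b0 * mvar Y1})"

(* A fat point scheme is given by a multiplicity function mu on P^1 x P^1 with
   finite nonempty support {P. mu P > 0}. *)
definition supp :: "('p \<Rightarrow> nat) \<Rightarrow> 'p set" where
  "supp mu = {P. 0 < mu P}"

definition fat_ideal :: "('k::comm_ring_1 option \<times> 'k option \<Rightarrow> nat) \<Rightarrow> (var4, 'k) mpoly set" where
  "fat_ideal mu = \<Inter> {ideal_pow (point_ideal P) (mu P) |P. P \<in> supp mu}"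

definition HZ :: "('k::field option \<times> 'k option \<Rightarrow> nat) \<Rightarrow> int \<Rightarrow> int \<Rightarrow> int" where
  "HZ mu i j = (if i < 0 \<or> j < 0 then 0 else int (hilb dg4 (fat_ideal mu) (nat i, nat j)))"

definition DeltaHZ :: "('k::field option \<times> 'k option \<Rightarrow> nat) \<Rightarrow> int \<Rightarrow> int \<Rightarrow> int" where
  "DeltaHZ mu i j = HZ mu i j - HZ mu (i - 1) j - HZ mu i (j - 1) + HZ mu (i - 1) (j - 1)"

(* combinatorial invariants; m_ij = mu (R_i, Q_j) (0 if absent); nat subtraction = (.)_+ *)
definition pi1 :: "('a \<times> 'b \<Rightarrow> nat) \<Rightarrow> 'a set" where "pi1 mu = fst ` supp mu"
definition pi2 :: "('a \<times> 'b \<Rightarrow> nat) \<Rightarrow> 'b set" where "pi2 mu = snd ` supp mu"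

definition alphaZ :: "('a \<times> 'b \<Rightarrow> nat) \<Rightarrow> nat list" where
  "alphaZ mu = rev (sorted_list_of_multiset
     (\<Sum>R\<in>pi1 mu. mset (map (\<lambda>k. \<Sum>Q\<in>pi2 mu. mu (R, Q) - k)
                          [0..<Max ((\<lambda>Q. mu (R, Q)) ` pi2 mu)])))"

definition betaZ :: "('a \<times> 'b \<Rightarrow> nat) \<Rightarrow> nat list" where
  "betaZ mu = rev (sorted_list_of_multiset
     (\<Sum>Q\<in>pi2 mu. mset (map (\<lambda>k. \<Sum>R\<in>pi1 mu. mu (R, Q) - k)
                          [0..<Max ((\<lambda>R. mu (R, Q)) ` pi1 mu)])))"

definition conj_part :: "nat list \<Rightarrow> nat list" where
  "conj_part lam = (if lam = [] then []
      else map (\<lambda>i. length (filter (\<lambda>x. i \<le> x) lam)) [1..<hd lam + 1])"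

(* S_Z: tuples (t_{i1}(h), ..., t_{it}(h)) as functions on pi2 *)
definition SZ :: "('a \<times> 'b \<Rightarrow> nat) \<Rightarrow> ('b \<Rightarrow> nat) set" where
  "SZ mu = {(\<lambda>Q. mu (R, Q) - h) |R h. R \<in> pi1 mu}"

definition compwise_le :: "'b set \<Rightarrow> ('b \<Rightarrow> nat) \<Rightarrow> ('b \<Rightarrow> nat) \<Rightarrow> bool" where
  "compwise_le B u v \<longleftrightarrow> (\<forall>Q\<in>B. u Q \<le> v Q)"

end

theory Submission
  imports Defs "HOL-Library.Product_Plus"
begin

text \<open>
  Let \<open>L\<close> and \<open>M\<close> be linear forms of bidegrees \<open>(1,0)\<close> and \<open>(0,1)\<close> that vanish at no point of \<open>Z\<close>,
  and let \<open>I\<close> be the ideal of \<open>Z\<close>. A regular element lowers the growth order of the Hilbert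
  function of an affine quotient, so \<open>R/I\<close> has dimension 2 and depth at most 2; a socle argument
  shows that the depth is 2 if and only if \<open>M\<close> is regular modulo \<open>I + (L)\<close>.

  Multiplication by the form \<open>l\<close> of a ruling line relates \<open>Z\<close> to the scheme with all multiplicities
  on that line lowered by one, since \<open>I : l\<close> is its ideal. If \<open>\<S>\<^sub>Z\<close> is totally ordered and the
  line carries the largest multiplicities, \<open>I + (l)\<close> is a complete intersection, and the
  Cohen--Macaulay property follows by induction. For an arbitrary line the same sequence
  computes \<open>H\<^sub>Z(i,j)\<close> for \<open>i\<close> or \<open>j\<close> large in terms of \<open>\<alpha>\<^sub>Z\<close> and \<open>\<beta>\<^sub>Z\<close>.

  In the Cohen--Macaulay case \<open>\<Delta>H\<^sub>Z\<close> is the Hilbert function of \<open>R/(I, L, M)\<close>. A bigraded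
  artinian Hilbert function in two variables is the indicator function of a Young diagram, whose
  row and column lengths are read off from the limits of \<open>H\<^sub>Z\<close>; hence \<open>\<alpha>\<^sub>Z\<^sup>* = \<beta>\<^sub>Z\<close>. Finally
  \<open>\<alpha>\<^sub>Z\<close> and \<open>\<beta>\<^sub>Z\<close> are the row and column sums of the zero-one matrix with entry 1 at
  \<open>((R,k),(Q,h))\<close> when \<open>k + h < m\<^sub>R\<^sub>Q\<close>, and conjugate row and column sums force its rows to be nested.
\<close>

text \<open>Krull dimension and depth range over all primes and all elements, not only bihomogeneous
  ones. The growth argument therefore filters by total degree, and the Cohen--Macaulay property has
  to be carried from an unknown regular sequence \<open>f\<close>, \<open>g\<close> to the fixed
  forms L and M. This works because I + (L, M) contains every form of large degree: if M h lies in I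
  + (L), then so do all high-degree monomial multiples of h, and the absence of a socle brings the
  degree down to h itself. The forms exist since an algebraically closed field is infinite, so each
  factor has a point outside the projection of the support. The conditions are proved in the cycle
  (i), (ii), (iii), (iv), (i). Passing from (ii) to (iii) cannot use a regular sequence; there the
  partial sums of \<open>DeltaHZ\<close> telescope to first differences of the Hilbert function,
  whose limits are known for every Z. A flag \<open>b\<close> treats both rulings at once.
  Multiplicity functions are total, with value 0 off the support, and the index k of the parts runs
  below a common bound \<open>N\<close>, because zero parts are never counted.\<close>

section \<open>Dimensions of finite-dimensional subspaces\<close>

locale subspace_dim = vector_space
begin

definition fd :: "'b set \<Rightarrow> bool" where
  "fd V \<longleftrightarrow> (\<exists>B. finite B \<and> V \<subseteq> span B)"

text \<open>Dimension of the image of \<open>V\<close> modulo \<open>J\<close>. With the ambient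
  \<open>V\<close> as an argument, the same lemmas serve one bidegree and one step of a
  filtration.\<close>

definition cod :: "'b set \<Rightarrow> 'b set \<Rightarrow> nat" where
  "cod J V = dim V - dim (J \<inter> V)"

definition ssum :: "'b set \<Rightarrow> 'b set \<Rightarrow> 'b set" where
  "ssum U W = {u + w |u w. u \<in> U \<and> w \<in> W}"

lemma fd_subset: "fd V \<Longrightarrow> U \<subseteq> V \<Longrightarrow> fd U"
  unfolding fd_def by blast

lemma fd_sums: "fd U \<Longrightarrow> fd W \<Longrightarrow> fd (ssum U W)"
proof -
  assume "fd U" "fd W"
  then obtain A B where "finite A" "U \<subseteq> span A" "finite B" "W \<subseteq> span B"
    unfolding fd_def by blast
  moreover have "span A \<subseteq> span (A \<union> B)" "span B \<subseteq> span (A \<union> B)"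
    by (simp_all add: span_mono)
  ultimately show ?thesis unfolding fd_def ssum_def
    by (intro exI[of _ "A \<union> B"]) (auto intro!: span_add)
qed

lemma fd_independent_finite:
  assumes "fd V" "B \<subseteq> V" "independent B"
  shows "finite B"
  using assms independent_span_bound[of _ B] unfolding fd_def by blast

lemma basis_extend:
  assumes "fd V" "B \<subseteq> V" "independent B"
  obtains C where "B \<subseteq> C" "C \<subseteq> V" "independent C" "V \<subseteq> span C" "finite C" "card C = dim V"
proof -
  obtain C where C: "B \<subseteq> C" "C \<subseteq> V" "independent C" "V \<subseteq> span C"
    using maximal_independent_subset_extend[OF assms(2,3)] by blast
  then show ?thesis
    using that fd_independent_finite[OF assms(1) C(2,3)] basis_card_eq_dim[OF C(2,4,3)] by blast
qed

lemma dim_le_fd: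
  assumes "fd V" "U \<subseteq> V"
  shows "dim U \<le> dim V"
proof -
  obtain B where B: "B \<subseteq> V" "independent B" "V \<subseteq> span B" "finite B" "card B = dim V"
    using basis_extend[OF assms(1), of "{}"] by (auto simp: independent_empty)
  then show ?thesis using dim_le_card[of U B] assms by auto
qed

lemma subspace_eq_if_dim_le:
  assumes "fd V" "subspace U" "U \<subseteq> V" "dim V \<le> dim U"
  shows "U = V"
proof -
  have fU: "fd U" using assms fd_subset by blast
  obtain B where B: "B \<subseteq> U" "independent B" "U \<subseteq> span B" "finite B" "card B = dim U"
    using basis_extend[OF fU, of "{}"] by (auto simp: independent_empty)
  obtain C where C: "B \<subseteq> C" "C \<subseteq> V" "independent C" "V \<subseteq> span C" "finite C" "card C = dim V"
    using basis_extend[OF assms(1) _ B(2)] B(1) assms(3) by blast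
  have "B = C" using B(4,5) C(1,5,6) assms(4) by (metis card_seteq)
  then have "V \<subseteq> U" using C(4) B(1) span_minimal[OF B(1) assms(2)] by blast
  then show ?thesis using assms(3) by blast
qed

lemma dim_sums_inter:
  assumes fU: "fd U" and fW: "fd W" and sU: "subspace U" and sW: "subspace W"
  shows "dim (ssum U W) + dim (U \<inter> W) = dim U + dim W"
proof -
  have sUW: "subspace (U \<inter> W)" using sU sW by (rule subspace_inter)
  obtain B where B: "B \<subseteq> U \<inter> W" "independent B" "U \<inter> W \<subseteq> span B" "finite B" "card B = dim (U \<inter> W)"
    using basis_extend[OF fd_subset[OF fU Int_lower1], of "{}"] by (metis empty_subsetI independent_empty)
  obtain C where C: "B \<subseteq> C" "C \<subseteq> U" "independent C" "U \<subseteq> span C" "finite C" "card C = dim U"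
    using basis_extend[OF fU _ B(2)] B(1) by auto
  obtain D where D: "B \<subseteq> D" "D \<subseteq> W" "independent D" "W \<subseteq> span D" "finite D" "card D = dim W"
    using basis_extend[OF fW _ B(2)] B(1) by auto
  have UC: "span C = U" using C span_minimal[OF C(2) sU] by blast
  have WD: "span D = W" using D span_minimal[OF D(2) sW] by blast
  have UWB: "span B = U \<inter> W" using B span_minimal[OF B(1) sUW] by blast
  \<comment> \<open>The vectors of \<open>D - B\<close> are added to \<open>C\<close> one at a time.
    A relation d = c + e would put c into both \<open>U\<close> and \<open>W\<close>, hence into the
    span of \<open>B\<close>, and make d dependent on the rest of \<open>D\<close>.\<close>
  have ind: "finite E \<Longrightarrow> E \<subseteq> D - B \<Longrightarrow> independent (C \<union> E) \<and> C \<inter> E = {}" for E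
  proof (induction E rule: finite_induct)
    case empty
    then show ?case using C by simp
  next
    case (insert d E)
    then have IH: "independent (C \<union> E)" "C \<inter> E = {}" and dD: "d \<in> D" "d \<notin> B" and ED: "E \<subseteq> D - B" by auto
    have "d \<notin> span (C \<union> E)"
    proof
      assume "d \<in> span (C \<union> E)"
      then obtain c e where ce: "d = c + e" "c \<in> span C" "e \<in> span E"
        unfolding span_Un by blast
      have "e \<in> W" using ce(3) ED D(2) span_minimal[OF _ sW, of E] by blast
      then have "c \<in> W" using ce(1) dD D(2) sW by (metis add_diff_cancel_right' subsetD subspace_diff)
      then have "c \<in> span B" using UWB UC ce(2) by blast
      then have "d \<in> span (B \<union> E)" unfolding span_Un using ce by blast
      then have "d \<in> span (D - {d})"
        using span_mono[of "B \<union> E" "D - {d}"] dD ED D(1) insert.hyps by blast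
      then show False using D(3) dD dependent_def by blast
    qed
    moreover from this have "d \<notin> C" using span_base by blast
    ultimately show ?case using IH independent_insertI[of d "C \<union> E"] by auto
  qed
  have i: "independent (C \<union> (D - B))" "C \<inter> (D - B) = {}" using ind[of "D - B"] D(5) by auto
  have "span (C \<union> (D - B)) = span (C \<union> D)" using C(1) by (intro arg_cong[of _ _ span]) blast
  also have "\<dots> = ssum U W" unfolding span_Un UC WD ssum_def by auto
  finally have "dim (ssum U W) = card (C \<union> (D - B))"
    using dim_span_eq_card_independent[OF i(1)] by simp
  also have "\<dots> = card C + (card D - card B)"
    using i(2) C(5) D(1,5) B(4) by (simp add: card_Un_disjoint card_Diff_subset)
  finally show ?thesis
    using B(5) C(6) D(6) card_mono[OF D(5,1)] by linarith
qed

lemma dim_inter_le: "fd V \<Longrightarrow> dim (J \<inter> V) \<le> dim V"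
  by (rule dim_le_fd) auto

lemma cod_antimono:
  assumes "fd V" "J \<subseteq> K"
  shows "cod K V \<le> cod J V"
  unfolding cod_def using dim_le_fd[OF fd_subset[OF assms(1)], of "K \<inter> V" "J \<inter> V"] assms(2)
  by (intro diff_le_mono2) blast

text \<open>The quotient of \<open>U\<close> by \<open>J\<close> embeds into that of
  \<open>V\<close>; the count compares \<open>V\<close> with the sum of \<open>U\<close> and
  \<open>J \<inter> V\<close>.\<close>

lemma cod_mono:
  assumes "fd V" "subspace V" "subspace J" "U \<subseteq> V" "subspace U"
  shows "cod J U \<le> cod J V"
proof -
  have fU: "fd U" using assms fd_subset by blast
  have "dim (ssum U (J \<inter> V)) + dim (U \<inter> (J \<inter> V)) = dim U + dim (J \<inter> V)"
    using assms fU by (intro dim_sums_inter) (auto intro: fd_subset subspace_inter)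
  moreover have "U \<inter> (J \<inter> V) = J \<inter> U" using assms(4) by blast
  moreover have "dim (ssum U (J \<inter> V)) \<le> dim V"
    using assms by (intro dim_le_fd) (auto simp: ssum_def intro: subspace_add)
  ultimately show ?thesis unfolding cod_def
    using dim_inter_le[OF assms(1), of J] dim_inter_le[OF fU, of J] by simp
qed

lemma cod_sums_le:
  assumes "fd U" "fd W" "subspace U" "subspace W" "subspace J"
  shows "cod J (ssum U W) \<le> cod J U + cod J W"
proof -
  have 1: "dim (ssum U W) + dim (U \<inter> W) = dim U + dim W"
    using assms by (intro dim_sums_inter)
  have 2: "dim (ssum (J \<inter> U) (J \<inter> W)) + dim ((J \<inter> U) \<inter> (J \<inter> W)) = dim (J \<inter> U) + dim (J \<inter> W)"
    using assms by (intro dim_sums_inter) (auto intro: fd_subset subspace_inter)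
  have 3: "dim (ssum (J \<inter> U) (J \<inter> W)) \<le> dim (J \<inter> ssum U W)"
    using assms fd_sums[OF assms(1,2)]
    by (intro dim_le_fd) (auto simp: ssum_def intro: fd_subset subspace_add)
  have 4: "dim ((J \<inter> U) \<inter> (J \<inter> W)) \<le> dim (U \<inter> W)"
    using assms by (intro dim_le_fd) (auto intro: fd_subset)
  show ?thesis unfolding cod_def using 1 2 3 4
    dim_inter_le[OF assms(1), of J] dim_inter_le[OF assms(2), of J] by linarith
qed

lemma cod_eq_0:
  assumes "fd V" "subspace V" "subspace J" "cod J V = 0"
  shows "V \<subseteq> J"
  using subspace_eq_if_dim_le[OF assms(1) subspace_inter[OF assms(3,2)]] assms(4)
  unfolding cod_def by auto

lemma dim_image_inj:
  assumes "module_hom scale scale f" "inj f" "fd V"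
  shows "dim (f ` V) = dim V" "fd (f ` V)"
proof -
  interpret f: module_hom scale scale f by (rule assms(1))
  obtain B where B: "B \<subseteq> V" "independent B" "V \<subseteq> span B" "finite B" "card B = dim V"
    using basis_extend[OF assms(3), of "{}"] by (auto simp: independent_empty)
  have s: "f ` V \<subseteq> span (f ` B)" using B(3) f.span_image[of B] by blast
  then show "fd (f ` V)" using B(4) unfolding fd_def by blast
  have "independent (f ` B)"
    using f.independent_injective_image[OF B(2)] assms(2) inj_on_subset by blast
  then have "card (f ` B) = dim (f ` V)"
    using s B(1) by (intro basis_card_eq_dim) auto
  then show "dim (f ` V) = dim V" using B(5) card_image[of f B] assms(2) inj_on_subset by fastforce
qed

text \<open>The dimension count behind the exact sequence
  \<open>0 \<rightarrow> U/(J : f) \<rightarrow> V/J \<rightarrow> V/(J + f U) \<rightarrow> 0\<close>.\<close>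

lemma cod_exact:
  assumes "module_hom scale scale f" "inj f" "fd V" "subspace V" "fd U" "subspace U" "subspace J"
    and fUV: "f ` U \<subseteq> V"
  shows "cod J V = (dim V - dim (ssum (J \<inter> V) (f ` U))) + cod {u. f u \<in> J} U"
proof -
  interpret f: module_hom scale scale f by (rule assms(1))
  have sfU: "subspace (f ` U)" using assms f.subspace_image by blast
  have ffU: "fd (f ` U)" "dim (f ` U) = dim U" using dim_image_inj[OF assms(1,2,5)] by auto
  have fJ: "fd (J \<inter> V)" using assms by (auto intro: fd_subset)
  have 1: "dim (ssum (J \<inter> V) (f ` U)) + dim ((J \<inter> V) \<inter> f ` U) = dim (J \<inter> V) + dim (f ` U)"
    using assms sfU ffU fJ by (intro dim_sums_inter) (auto intro: subspace_inter)
  have "(J \<inter> V) \<inter> f ` U = f ` ({u. f u \<in> J} \<inter> U)" using fUV by auto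
  then have 2: "dim ((J \<inter> V) \<inter> f ` U) = dim ({u. f u \<in> J} \<inter> U)"
    using dim_image_inj[OF assms(1,2) fd_subset[OF assms(5) Int_lower2]] by simp
  have 3: "dim (ssum (J \<inter> V) (f ` U)) \<le> dim V"
    using assms by (intro dim_le_fd) (auto simp: ssum_def intro: subspace_add)
  show ?thesis unfolding cod_def using 1 2 3 ffU(2)
      dim_inter_le[OF assms(5), of "{u. f u \<in> J}"] by linarith
qed

end

section \<open>Ideals and non-zero-divisors in commutative rings\<close>

definition adj :: "'a::comm_ring_1 set \<Rightarrow> 'a \<Rightarrow> 'a set" where
  "adj K a = {k + a * r |k r. k \<in> K}"

text \<open>Unlike \<open>regular_seq\<close>, this does not ask the quotient to be nonzero. It
  holds modulo \<open>UNIV\<close>, which is where inductions on exponents, products and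
  multiplicities start.\<close>

definition nzd :: "'a::comm_ring_1 \<Rightarrow> 'a set \<Rightarrow> bool" where
  "nzd f K \<longleftrightarrow> (\<forall>g. f * g \<in> K \<longrightarrow> g \<in> K)"

lemma
  assumes "is_ideal K"
  shows ideal_zero: "0 \<in> K" and ideal_add: "a \<in> K \<Longrightarrow> b \<in> K \<Longrightarrow> a + b \<in> K"
    and ideal_mult: "a \<in> K \<Longrightarrow> r * a \<in> K" and ideal_mult': "a \<in> K \<Longrightarrow> a * r \<in> K"
    and ideal_minus: "a \<in> K \<Longrightarrow> - a \<in> K" and ideal_diff: "a \<in> K \<Longrightarrow> b \<in> K \<Longrightarrow> a - b \<in> K"
proof -
  show z: "0 \<in> K" and a: "\<And>a b. a \<in> K \<Longrightarrow> b \<in> K \<Longrightarrow> a + b \<in> K" and m: "\<And>a r. a \<in> K \<Longrightarrow> r * a \<in> K"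
    for a b r using assms unfolding is_ideal_def by auto
  show "a \<in> K \<Longrightarrow> a * r \<in> K" for a r using m[of a r] by (simp add: mult.commute)
  show mi: "a \<in> K \<Longrightarrow> - a \<in> K" for a using m[of a "-1"] by simp
  show "a \<in> K \<Longrightarrow> b \<in> K \<Longrightarrow> a - b \<in> K" for a b using a[of a "- b"] mi[of b] by simp
qed

lemma ideal_add_cancel: "is_ideal K \<Longrightarrow> a \<in> K \<Longrightarrow> a + b \<in> K \<Longrightarrow> b \<in> K"
  using ideal_diff[of K "a + b" a] by simp

lemma ideal_one: "is_ideal K \<Longrightarrow> 1 \<in> K \<Longrightarrow> K = UNIV"
  using ideal_mult[of K 1] by auto

lemma ideal_sum: "is_ideal K \<Longrightarrow> (\<And>i. i \<in> A \<Longrightarrow> f i \<in> K) \<Longrightarrow> sum f A \<in> K"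
  by (induction A rule: infinite_finite_induct) (auto simp: ideal_zero ideal_add)

lemma is_ideal_zero: "is_ideal {0}" and is_ideal_UNIV: "is_ideal UNIV"
  by (auto simp: is_ideal_def)

lemma adjI: "x = k + a * r \<Longrightarrow> k \<in> K \<Longrightarrow> x \<in> adj K a"
  unfolding adj_def by blast

lemma is_ideal_adj: assumes "is_ideal K" shows "is_ideal (adj K a)"
  unfolding is_ideal_def
proof (intro conjI ballI allI)
  show "0 \<in> adj K a" using ideal_zero[OF assms] by (intro adjI[of _ 0 _ 0]) auto
next
  fix x y assume "x \<in> adj K a" "y \<in> adj K a"
  then obtain k r l s where "x = k + a * r" "k \<in> K" "y = l + a * s" "l \<in> K" unfolding adj_def by blast
  then have "x + y = (k + l) + a * (r + s)" "k + l \<in> K" using assms ideal_add by (auto simp: algebra_simps)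
  then show "x + y \<in> adj K a" unfolding adj_def by blast
next
  fix t x assume "x \<in> adj K a"
  then obtain k r where "x = k + a * r" "k \<in> K" unfolding adj_def by blast
  then have "t * x = t * k + a * (t * r)" "t * k \<in> K" using assms ideal_mult by (auto simp: algebra_simps)
  then show "t * x \<in> adj K a" unfolding adj_def by blast
qed

lemma adj_base: "k \<in> K \<Longrightarrow> k \<in> adj K a"
  by (rule adjI[of _ k _ 0]) auto

lemma adj_mult: "is_ideal K \<Longrightarrow> a * r \<in> adj K a"
  using ideal_zero by (intro adjI[of _ 0 _ r]) auto

lemma adj_gen: "is_ideal K \<Longrightarrow> a \<in> adj K a"
  using adj_mult[of K a 1] by simp

lemma adjE: assumes "x \<in> adj K a" obtains k r where "x = k + a * r" "k \<in> K"
  using assms unfolding adj_def by blast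

lemma adj_least: "is_ideal M \<Longrightarrow> K \<subseteq> M \<Longrightarrow> a \<in> M \<Longrightarrow> adj K a \<subseteq> M"
  unfolding adj_def using ideal_add ideal_mult' by blast

lemma adj_mono: "K \<subseteq> M \<Longrightarrow> adj K a \<subseteq> adj M a"
  unfolding adj_def by blast

lemma adj_commute: "is_ideal K \<Longrightarrow> adj (adj K a) b = adj (adj K b) a"
proof -
  have "adj (adj K a) b \<subseteq> adj (adj K b) a" if "is_ideal K" for a b
    using that by (intro adj_least is_ideal_adj adj_gen adj_mono) (auto intro: adj_base adj_gen)
  then show "is_ideal K \<Longrightarrow> adj (adj K a) b = adj (adj K b) a" by blast
qed

lemma is_ideal_ideal_gen: "is_ideal (ideal_gen S)"
  unfolding ideal_gen_def is_ideal_def by auto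

lemma ideal_gen_base: "S \<subseteq> ideal_gen S"
  unfolding ideal_gen_def by auto

lemma ideal_gen_least: "is_ideal K \<Longrightarrow> S \<subseteq> K \<Longrightarrow> ideal_gen S \<subseteq> K"
  unfolding ideal_gen_def by auto

lemma ideal_gen_mono: "S \<subseteq> T \<Longrightarrow> ideal_gen S \<subseteq> ideal_gen T"
  unfolding ideal_gen_def by auto

lemma ideal_gen_ideal: "is_ideal K \<Longrightarrow> ideal_gen K = K"
  using ideal_gen_least[of K K] ideal_gen_base[of K] by blast

lemma ideal_gen_insert: "ideal_gen (insert a S) = adj (ideal_gen S) a"
proof
  show "ideal_gen (insert a S) \<subseteq> adj (ideal_gen S) a"
    using ideal_gen_base[of S]
    by (intro ideal_gen_least is_ideal_adj is_ideal_ideal_gen)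
      (auto intro: adj_gen adj_base is_ideal_ideal_gen)
  show "adj (ideal_gen S) a \<subseteq> ideal_gen (insert a S)"
    using ideal_gen_base[of "insert a S"]
    by (intro adj_least is_ideal_ideal_gen ideal_gen_mono) auto
qed

lemma ideal_gen_empty: "ideal_gen {} = {0}"
  using ideal_gen_least[OF is_ideal_zero, of "{}"] ideal_zero[OF is_ideal_ideal_gen, of "{}"] by auto

lemma is_ideal_colon: "is_ideal K \<Longrightarrow> is_ideal {g. f * g \<in> K}"
  unfolding is_ideal_def by (auto simp: distrib_left mult.left_commute)

lemma is_ideal_Inter: "(\<And>i. i \<in> A \<Longrightarrow> is_ideal (K i)) \<Longrightarrow> is_ideal {f. \<forall>i\<in>A. f \<in> K i}"
  unfolding is_ideal_def by auto

lemma nzdD: "nzd f K \<Longrightarrow> f * g \<in> K \<Longrightarrow> g \<in> K"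
  unfolding nzd_def by blast

lemma nzd_mult: "nzd f K \<Longrightarrow> nzd g K \<Longrightarrow> nzd (f * g) K"
  unfolding nzd_def by (metis mult.assoc)

lemma nzd_one: "nzd 1 K" by (simp add: nzd_def)

lemma nzd_power: "nzd f K \<Longrightarrow> nzd (f ^ n) K"
  by (induction n) (simp_all add: nzd_one nzd_mult)

lemma nzd_prod: "(\<And>i. i \<in> A \<Longrightarrow> nzd (f i) K) \<Longrightarrow> nzd (prod f A) K"
  by (induction A rule: infinite_finite_induct) (simp_all add: nzd_one nzd_mult)

lemma nzd_prime: "prime_ideal P \<Longrightarrow> f \<notin> P \<Longrightarrow> nzd f P"
  unfolding prime_ideal_def nzd_def by blast

text \<open>Since \<open>F\<close> is regular, multiplication by \<open>F\<close> embeds the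
  quotient by \<open>adj K G\<close> into the quotient by \<open>adj K (F * G)\<close>, with
  cokernel the quotient by \<open>adj K F\<close>. Regularity at both ends gives it in the
  middle.\<close>

lemma nzd_adj_mult:
  assumes "is_ideal K" "nzd F K" "nzd c (adj K F)" "nzd c (adj K G)"
  shows "nzd c (adj K (F * G))"
  unfolding nzd_def
proof (intro allI impI)
  fix g assume "c * g \<in> adj K (F * G)"
  then obtain k r where 1: "c * g = k + F * G * r" "k \<in> K" by (rule adjE)
  then have "c * g \<in> adj K F" unfolding adj_def by (auto simp: mult.assoc)
  then have "g \<in> adj K F" using assms(3) nzdD by blast
  then obtain l s where 2: "g = l + F * s" "l \<in> K" by (rule adjE)
  have "F * (c * s - G * r) = k - c * l" using 1(1) 2(1) by (simp add: algebra_simps)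
  then have "F * (c * s - G * r) \<in> K" using 1(2) 2(2) assms(1) by (simp add: ideal_diff ideal_mult)
  then have "c * s - G * r \<in> K" using assms(2) nzdD by blast
  then have "c * s \<in> adj K G" by (intro adjI[of _ "c * s - G * r" _ r]) auto
  then have "s \<in> adj K G" using assms(4) nzdD by blast
  then obtain n t where "s = n + G * t" "n \<in> K" by (rule adjE)
  then have "g = (l + F * n) + F * G * t" "l + F * n \<in> K"
    using 2 assms(1) by (auto simp: algebra_simps ideal_add ideal_mult)
  then show "g \<in> adj K (F * G)" unfolding adj_def by blast
qed

lemma adj_one: "is_ideal K \<Longrightarrow> adj K 1 = UNIV"
  using ideal_one[OF is_ideal_adj adj_gen] by blast

lemma nzd_adj_power:
  assumes "is_ideal K" "nzd F K" "nzd c (adj K F)"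
  shows "nzd c (adj K (F ^ n))"
proof (induction n)
  case 0
  then show ?case using assms(1) by (simp add: adj_one nzd_def)
next
  case (Suc n)
  then show ?case using nzd_adj_mult[OF assms(1,2,3)] by simp
qed

lemma nzd_adj_prod:
  assumes "is_ideal K" "\<And>q. q \<in> A \<Longrightarrow> nzd (F q) K" "\<And>q. q \<in> A \<Longrightarrow> nzd c (adj K (F q))"
  shows "nzd c (adj K (prod F A))"
  using assms(2,3)
proof (induction A rule: infinite_finite_induct)
  case (insert q A)
  then show ?case using nzd_adj_mult[OF assms(1)] by simp
qed (use assms(1) in \<open>simp_all add: adj_one nzd_def\<close>)

text \<open>Write f = k + (product so far) r. Modulo the next factor the product is regular, so r
  itself is divisible by that factor modulo \<open>K\<close>.\<close>

lemma inter_adj_prod: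
  assumes "is_ideal K" "finite A"
    and "\<And>q. q \<in> A \<Longrightarrow> f \<in> adj K (F q)"
    and "\<And>q q'. q \<in> A \<Longrightarrow> q' \<in> A \<Longrightarrow> q \<noteq> q' \<Longrightarrow> nzd (F q) (adj K (F q'))"
  shows "f \<in> adj K (prod F A)"
  using assms(2-)
proof (induction A rule: finite_induct)
  case empty
  then show ?case using assms(1) by (simp add: adj_one)
next
  case (insert q A)
  then have "f \<in> adj K (prod F A)" by auto
  then obtain k r where 1: "f = k + prod F A * r" "k \<in> K" by (rule adjE)
  have i: "is_ideal (adj K (F q))" using assms(1) by (rule is_ideal_adj)
  have "f \<in> adj K (F q)" using insert.prems by auto
  then have "prod F A * r \<in> adj K (F q)" using ideal_add_cancel[OF i] 1 adj_base by metis
  moreover have "nzd (prod F A) (adj K (F q))" using insert by (intro nzd_prod) auto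
  ultimately have "r \<in> adj K (F q)" using nzdD by blast
  then obtain l s where "r = l + F q * s" "l \<in> K" by (rule adjE)
  then have "f = (k + prod F A * l) + prod F (insert q A) * s" "k + prod F A * l \<in> K"
    using 1 assms(1) insert.hyps by (simp_all add: algebra_simps ideal_add ideal_mult')
  then show ?case unfolding adj_def by blast
qed

text \<open>The powers of the ideal \<open>(a, b)\<close>, written as \<open>p\<^bsup>m+1\<^esup> = a p\<^bsup>m\<^esup> + (b\<^bsup>m+1\<^esup>)\<close>.\<close>

fun pw :: "'a::comm_ring_1 \<Rightarrow> 'a \<Rightarrow> nat \<Rightarrow> 'a set" where
  "pw a b 0 = UNIV"
| "pw a b (Suc m) = {a * u + b ^ Suc m * w |u w. u \<in> pw a b m}"

lemma pwI: "x = a * u + b ^ Suc m * w \<Longrightarrow> u \<in> pw a b m \<Longrightarrow> x \<in> pw a b (Suc m)"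
  by auto

lemma is_ideal_pw: "is_ideal (pw a b m)"
proof (induction m)
  case (Suc m)
  show ?case unfolding is_ideal_def
  proof (intro conjI ballI allI)
    show "0 \<in> pw a b (Suc m)" using ideal_zero[OF Suc] by (intro pwI[of _ _ 0 _ _ 0]) auto
  next
    fix x y assume "x \<in> pw a b (Suc m)" "y \<in> pw a b (Suc m)"
    then obtain u w u' w' where "x = a * u + b ^ Suc m * w" "u \<in> pw a b m"
      "y = a * u' + b ^ Suc m * w'" "u' \<in> pw a b m" by auto
    then have "x + y = a * (u + u') + b ^ Suc m * (w + w')" "u + u' \<in> pw a b m"
      using Suc by (auto simp: algebra_simps ideal_add)
    then show "x + y \<in> pw a b (Suc m)" unfolding pw.simps by blast
  next
    fix t x assume "x \<in> pw a b (Suc m)"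
    then obtain u w where "x = a * u + b ^ Suc m * w" "u \<in> pw a b m" by auto
    then have "t * x = a * (t * u) + b ^ Suc m * (t * w)" "t * u \<in> pw a b m"
      using Suc by (auto simp: algebra_simps ideal_mult)
    then show "t * x \<in> pw a b (Suc m)" unfolding pw.simps by blast
  qed
qed (simp add: is_ideal_UNIV)

lemma pw_a_mult: "u \<in> pw a b m \<Longrightarrow> a * u \<in> pw a b (Suc m)"
  by (rule pwI[of _ _ u _ _ 0]) auto

lemma pw_b_power: "b ^ m \<in> pw a b m"
proof (cases m)
  case (Suc n)
  then show ?thesis using ideal_zero[OF is_ideal_pw, of a b n] pwI[of _ a 0 b n 1] by simp
qed simp

lemma pw_b_mult: "u \<in> pw a b m \<Longrightarrow> b * u \<in> pw a b (Suc m)"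
proof (induction m arbitrary: u)
  case 0
  show ?case by (rule pwI[of _ _ 0 _ _ u]) auto
next
  case (Suc m)
  then obtain v w where u: "u = a * v + b ^ Suc m * w" "v \<in> pw a b m" by auto
  then have "b * u = a * (b * v) + b ^ Suc (Suc m) * w" by (simp add: algebra_simps)
  moreover have "b * v \<in> pw a b (Suc m)" using Suc.IH u(2) .
  ultimately show ?case using pw.simps(2)[of a b "Suc m"] by blast
qed

lemma pw_decreasing: "pw a b (Suc m) \<subseteq> pw a b m"
proof
  fix x assume "x \<in> pw a b (Suc m)"
  then obtain u w where x: "x = a * u + b ^ Suc m * w" "u \<in> pw a b m" by auto
  have "b ^ Suc m * w = (b * w) * b ^ m" by (simp add: algebra_simps)
  then show "x \<in> pw a b m"
    using x pw_b_power ideal_add[OF is_ideal_pw] ideal_mult[OF is_ideal_pw] by metis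
qed

lemma pw_antimono: "m \<le> n \<Longrightarrow> pw a b n \<subseteq> pw a b m"
  by (rule lift_Suc_antimono_le[of "pw a b"]) (rule pw_decreasing)

lemma ideal_pow_eq_pw: "ideal_pow (ideal_gen {a, b}) m = pw a b m"
proof (induction m)
  case (Suc m)
  let ?p = "ideal_gen {a, b}"
  have ab: "a \<in> ?p" "b \<in> ?p" using ideal_gen_base[of "{a,b}"] by auto
  have p: "?p = adj (adj {0} b) a" by (simp add: ideal_gen_insert ideal_gen_empty)
  have "{x * y |x y. x \<in> ?p \<and> y \<in> pw a b m} \<subseteq> pw a b (Suc m)"
  proof clarify
    fix x y assume "x \<in> ?p" and y: "y \<in> pw a b m"
    then obtain r s where "x = b * s + a * r" unfolding p adj_def by auto
    then have "x * y = s * (b * y) + r * (a * y)" by (simp add: algebra_simps)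
    then show "x * y \<in> pw a b (Suc m)"
      using pw_a_mult[OF y] pw_b_mult[OF y] ideal_add[OF is_ideal_pw] ideal_mult[OF is_ideal_pw] by metis
  qed
  moreover have "pw a b (Suc m) \<subseteq> ideal_gen {x * y |x y. x \<in> ?p \<and> y \<in> pw a b m}" (is "_ \<subseteq> ideal_gen ?S")
  proof
    fix x assume "x \<in> pw a b (Suc m)"
    then obtain u w where x: "x = a * u + b * (b ^ m * w)" "u \<in> pw a b m" by (auto simp: mult.assoc)
    have "b ^ m * w \<in> pw a b m" using pw_b_power ideal_mult'[OF is_ideal_pw] by blast
    then have "a * u \<in> ?S" "b * (b ^ m * w) \<in> ?S" using x(2) ab by blast+
    then show "x \<in> ideal_gen ?S" unfolding x(1)
      using ideal_gen_base[of ?S] ideal_add[OF is_ideal_ideal_gen] by blast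
  qed
  ultimately have "ideal_gen {x * y |x y. x \<in> ?p \<and> y \<in> pw a b m} = pw a b (Suc m)"
    by (intro equalityI ideal_gen_least[OF is_ideal_pw])
  then show ?case unfolding ideal_pow.simps(2) ideal_prod_def Suc.IH .
qed simp

text \<open>The recursion for \<open>pw\<close> is asymmetric in its generators; the symmetry comes
  from the ideal power.\<close>

lemma pw_commute: "pw a b m = pw b a m"
  unfolding ideal_pow_eq_pw[symmetric] insert_commute[of a] ..

text \<open>Modulo \<open>a\<close> only the pure power of \<open>b\<close> survives.\<close>

lemma pw_subset_adj: "pw a b m \<subseteq> adj (adj {0} a) (b ^ m)"
proof (cases m)
  case 0
  then show ?thesis by (simp add: adj_one is_ideal_adj is_ideal_zero)
next
  case (Suc n)
  then show ?thesis by (auto simp: adj_def)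
qed

text \<open>As \<open>b\<close> is regular modulo \<open>a\<close>, a multiple of
  \<open>b ^ Suc m\<close> that is divisible by \<open>a\<close> has its cofactor divisible by
  \<open>a\<close>; after cancelling \<open>a\<close> this term already lies in the lower
  power.\<close>

lemma pw_colon_a:
  assumes "nzd a {0}" "nzd b (adj {0} a)" "a * g \<in> pw a b (Suc m)"
  shows "g \<in> pw a b m"
proof -
  obtain u w where 1: "a * g = a * u + b ^ Suc m * w" "u \<in> pw a b m" using assms(3) by auto
  then have "b ^ Suc m * w = a * (g - u)" by (simp add: algebra_simps)
  then have "b ^ Suc m * w \<in> adj {0} a" using adj_mult[OF is_ideal_zero] by metis
  then have "w \<in> adj {0} a" using nzdD[OF nzd_power[OF assms(2)]] by blast
  then obtain v where "w = a * v" unfolding adj_def by auto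
  then have "a * (g - (u + b ^ Suc m * v)) = 0" using 1(1) by (simp add: algebra_simps)
  then have "g - (u + b ^ Suc m * v) = 0" using nzdD[OF assms(1)] by blast
  then have "g = u + (b * v) * b ^ m" by (simp add: algebra_simps)
  then show ?thesis using 1(2) pw_b_power ideal_add[OF is_ideal_pw] ideal_mult[OF is_ideal_pw] by metis
qed

text \<open>Powers of an ideal generated by a regular sequence acquire no new zero-divisors. Modulo
  \<open>a\<close> only the ideal of \<open>a\<close> and a power of \<open>b\<close> is seen; once
  the \<open>b\<close> part is subtracted, \<open>a\<close> cancels and the exponent drops by
  one.\<close>

lemma nzd_pw:
  assumes "nzd a {0}" "nzd b (adj {0} a)" "nzd c (adj (adj {0} a) b)"
  shows "nzd c (pw a b m)"
proof (induction m)
  case (Suc m)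
  have ia: "is_ideal (adj {0} a)" by (rule is_ideal_adj[OF is_ideal_zero])
  show ?case unfolding nzd_def
  proof (intro allI impI)
    fix g assume cg: "c * g \<in> pw a b (Suc m)"
    have "nzd c (adj (adj {0} a) (b ^ Suc m))" by (rule nzd_adj_power[OF ia assms(2,3)])
    then have "g \<in> adj (adj {0} a) (b ^ Suc m)" using cg pw_subset_adj nzdD by blast
    then obtain h v where g: "g = a * h + b ^ Suc m * v" by (auto simp: adj_def)
    have bp: "b ^ Suc m * v \<in> pw a b (Suc m)"
      using pw_b_power ideal_mult'[OF is_ideal_pw] by blast
    have "a * (c * h) = c * g - c * (b ^ Suc m * v)" unfolding g by (simp add: algebra_simps)
    then have "a * (c * h) \<in> pw a b (Suc m)"
      using cg bp ideal_diff[OF is_ideal_pw] ideal_mult[OF is_ideal_pw] by metis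
    then have "c * h \<in> pw a b m" using pw_colon_a[OF assms(1,2)] by blast
    then have "h \<in> pw a b m" using Suc nzdD by blast
    then show "g \<in> pw a b (Suc m)" unfolding g by auto
  qed
qed (simp add: nzd_def)

text \<open>A depth-two ring has no socle modulo a regular element: from \<open>f u = L v\<close> and
  \<open>f' u = L w\<close> one gets \<open>f' v = f w\<close>, so \<open>v\<close> is a multiple of \<open>f\<close>.\<close>

lemma no_socle:
  assumes I: "is_ideal I" and "nzd L I" "nzd f I" "nzd f' (adj I f)"
    and fu: "f * u \<in> adj I L" "f' * u \<in> adj I L"
  shows "u \<in> adj I L"
proof -
  obtain i v where v: "f * u = i + L * v" "i \<in> I" using fu(1) by (rule adjE)
  obtain j w where w: "f' * u = j + L * w" "j \<in> I" using fu(2) by (rule adjE)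
  have "f' * (f * u) = f * (f' * u)" by (simp add: algebra_simps)
  then have "L * (f' * v - f * w) = f * j - f' * i" unfolding v(1) w(1) by (simp add: algebra_simps)
  then have "L * (f' * v - f * w) \<in> I" using v w I by (simp add: ideal_diff ideal_mult)
  then have "f' * v - f * w \<in> I" using assms(2) nzdD by blast
  then have "f' * v \<in> adj I f" by (intro adjI[of _ "f' * v - f * w" _ w]) auto
  then have "v \<in> adj I f" using assms(4) nzdD by blast
  then obtain k z where z: "v = k + f * z" "k \<in> I" by (rule adjE)
  have "f * (u - L * z) = i + L * k" using v(1) z(1) by (simp add: algebra_simps)
  then have "f * (u - L * z) \<in> I" using v z I by (simp add: ideal_add ideal_mult)
  then have "u - L * z \<in> I" using assms(3) nzdD by blast
  then show ?thesis by (intro adjI[of _ "u - L * z" _ z]) auto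
qed

text \<open>The depth lemma for \<open>0 \<rightarrow> R/(I : l) \<rightarrow> R/I \<rightarrow> R/(I + l) \<rightarrow> 0\<close>.\<close>

lemma regular_pair_extension:
  assumes I: "is_ideal I"
    and colon: "nzd M (adj {g. l * g \<in> I} L)"
    and quot: "nzd L (adj I l)" "nzd M (adj (adj I l) L)"
  shows "nzd M (adj I L)"
  unfolding nzd_def
proof (intro allI impI)
  fix g assume "M * g \<in> adj I L"
  then obtain i h where h: "M * g = i + L * h" "i \<in> I" by (rule adjE)
  have "M * g \<in> adj (adj I l) L" unfolding h(1) using h(2) adj_base adj_def by blast
  then have "g \<in> adj (adj I l) L" using quot(2) nzdD by blast
  then obtain i2 a b where g: "g = i2 + l * a + L * b" "i2 \<in> I" unfolding adj_def by auto
  have "L * (h - M * b) = (M * i2 - i) + l * (M * a)" using h(1) g(1) by (simp add: algebra_simps)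
  moreover have "M * i2 - i \<in> I" using h g I by (simp add: ideal_diff ideal_mult)
  ultimately have "L * (h - M * b) \<in> adj I l" unfolding adj_def by blast
  then have "h - M * b \<in> adj I l" using quot(1) nzdD by blast
  then obtain i3 c where c: "h - M * b = i3 + l * c" "i3 \<in> I" by (rule adjE)
  have "h = M * b + i3 + l * c" using c(1) by (simp add: algebra_simps)
  then have "l * (M * a - L * c) = i + L * i3 - M * i2"
    using h(1) g(1) by (simp add: algebra_simps)
  then have "M * a - L * c \<in> {g. l * g \<in> I}" using h g c I by (simp add: ideal_diff ideal_mult ideal_add)
  then have "M * a \<in> adj {g. l * g \<in> I} L"
    by (intro adjI[of _ "M * a - L * c" _ c]) auto
  then have "a \<in> adj {g. l * g \<in> I} L" using colon nzdD by blast
  then obtain k r where k: "a = k + L * r" "l * k \<in> I" unfolding adj_def by auto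
  have "g = (i2 + l * k) + L * (b + l * r)" unfolding g(1) k(1) by (simp add: algebra_simps)
  moreover have "i2 + l * k \<in> I" using g k I by (simp add: ideal_add)
  ultimately show "g \<in> adj I L" unfolding adj_def by blast
qed

section \<open>Polynomials\<close>

text \<open>The order on the variables is irrelevant; it makes the polynomial ring an instance of
  the class \<open>idom\<close>.\<close>

instantiation var4 :: linorder
begin

fun var4_index :: "var4 \<Rightarrow> nat" where
  "var4_index X0 = 0" | "var4_index X1 = 1" | "var4_index Y0 = 2" | "var4_index Y1 = 3"

definition less_eq_var4 :: "var4 \<Rightarrow> var4 \<Rightarrow> bool" where
  "less_eq_var4 u v \<longleftrightarrow> var4_index u \<le> var4_index v"

definition less_var4 :: "var4 \<Rightarrow> var4 \<Rightarrow> bool" where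
  "less_var4 u v \<longleftrightarrow> var4_index u < var4_index v"

instance
proof
  have inj: "u = v" if "var4_index u = var4_index v" for u v
    using that by (cases u; cases v) auto
  show "u \<le> v \<Longrightarrow> v \<le> u \<Longrightarrow> u = v" for u v :: var4
    unfolding less_eq_var4_def by (intro inj) auto
qed (auto simp: less_eq_var4_def less_var4_def)

end

lemma mconst_add: "mconst (a + b) = mconst a + mconst b"
  by (simp add: mconst_def single_add)

lemma mconst_mult: "mconst (a * b) = mconst a * mconst b"
  by (simp add: mconst_def mult_single)

lemma mconst_diff: "mconst (a - b) = mconst a - mconst b"
  by (simp add: mconst_def single_diff)

lemma mconst_0 [simp]: "mconst 0 = 0" and mconst_1 [simp]: "mconst 1 = 1"
  by (simp_all add: mconst_def)

lemma mconst_eq_0_iff [simp]: "mconst c = 0 \<longleftrightarrow> c = 0"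
  by (metis mconst_def lookup_single_eq lookup_zero single_zero)

lemma lookup_mconst_mult: "Poly_Mapping.lookup (mconst c * p) m = c * Poly_Mapping.lookup p m"
  unfolding mconst_def mult_map_scale_conv_mult[symmetric] by (simp add: map.rep_eq when_def)

lemma lookup_mvar: "Poly_Mapping.lookup (mvar v) m = (if m = Poly_Mapping.single v 1 then 1 else 0)"
  unfolding mvar_def by (simp add: lookup_single when_def)

lemma mvar_nonzero: "mvar v \<noteq> 0"
  by (metis lookup_mvar lookup_zero zero_neq_one)

interpretation mp: subspace_dim "mscale :: 'k::field \<Rightarrow> ('v, 'k) mpoly \<Rightarrow> ('v, 'k) mpoly"
  by unfold_locales (simp_all add: mscale_def mconst_add mconst_mult algebra_simps)

lemma subspace_ideal: "is_ideal J \<Longrightarrow> mp.subspace J"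
  unfolding mp.subspace_def by (auto simp: mscale_def ideal_zero ideal_add ideal_mult)

lemma module_hom_mult: "module_hom mscale mscale ((*) f)" for f :: "('v, 'k::field) mpoly"
  by unfold_locales (simp_all add: mscale_def algebra_simps)

lemma inj_mult: "f \<noteq> 0 \<Longrightarrow> inj ((*) f)" for f :: "'a::idom"
  by (rule injI) simp

definition supported :: "('v \<Rightarrow>\<^sub>0 nat) set \<Rightarrow> ('v, 'k::zero) mpoly set" where
  "supported A = {p. Poly_Mapping.keys p \<subseteq> A}"

lemma subspace_supported: "mp.subspace (supported A :: ('a, 'b::field) mpoly set)"
  unfolding mp.subspace_def supported_def
proof (intro conjI ballI allI)
  fix p q :: "('a, 'b) mpoly" and c :: 'b
  assume p: "p \<in> {p. Poly_Mapping.keys p \<subseteq> A}"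
  then show "mscale c p \<in> {p. Poly_Mapping.keys p \<subseteq> A}"
    by (auto simp: mscale_def in_keys_iff lookup_mconst_mult)
  assume "q \<in> {p. Poly_Mapping.keys p \<subseteq> A}"
  then show "p + q \<in> {p. Poly_Mapping.keys p \<subseteq> A}" using p keys_add[of p q] by auto
qed simp

lemma sum_singles: "p = (\<Sum>m\<in>Poly_Mapping.keys p. Poly_Mapping.single m (Poly_Mapping.lookup p m))"
  by (rule poly_mapping_eqI)
    (simp add: lookup_sum lookup_single when_def sum.delta in_keys_iff)

lemma single_eq_mscale: "Poly_Mapping.single m c = mscale c (Poly_Mapping.single m 1)"
  by (simp add: mscale_def mconst_def mult_single)

lemma supported_le_span:
  "(supported A :: ('v, 'k::field) mpoly set) \<subseteq> mp.span ((\<lambda>m. Poly_Mapping.single m 1) ` A)"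
proof
  fix p :: "('v, 'k) mpoly" assume p: "p \<in> supported A"
  have "(\<Sum>m\<in>Poly_Mapping.keys p. Poly_Mapping.single m (Poly_Mapping.lookup p m))
      \<in> mp.span ((\<lambda>m. Poly_Mapping.single m 1) ` A)"
    using p unfolding supported_def
    by (intro mp.span_sum) (metis (no_types, lifting) imageI mem_Collect_eq mp.span_base mp.span_scale single_eq_mscale subsetD)
  then show "p \<in> mp.span ((\<lambda>m. Poly_Mapping.single m 1) ` A)" by (simp only: sum_singles[symmetric])
qed

lemma fd_supported: "finite A \<Longrightarrow> mp.fd (supported A)"
  unfolding mp.fd_def using supported_le_span[of A] by blast

lemma dim_supported:
  assumes "finite A"
  shows "mp.dim (supported A :: ('v, 'k::field) mpoly set) = card A"
proof (rule mp.dim_unique)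
  let ?e = "\<lambda>m. Poly_Mapping.single m 1 :: ('v, 'k) mpoly"
  have inj: "inj_on ?e A"
    by (rule inj_onI) (metis lookup_single_eq lookup_single_not_eq zero_neq_one)
  show "?e ` A \<subseteq> supported A" by (auto simp: supported_def)
  show "supported A \<subseteq> mp.span (?e ` A)" by (rule supported_le_span)
  show "card (?e ` A) = card A" using inj by (rule card_image)
  show "mp.independent (?e ` A)"
  proof (rule mp.independent_if_scalars_zero)
    fix g x assume s: "(\<Sum>x\<in>?e ` A. mscale (g x) x) = 0" and "x \<in> ?e ` A"
    then obtain m where m: "x = ?e m" "m \<in> A" by blast
    have "(\<Sum>x\<in>?e ` A. mscale (g x) x) = (\<Sum>n\<in>A. Poly_Mapping.single n (g (?e n)))"
      by (simp add: sum.reindex[OF inj] single_eq_mscale[symmetric])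
    then have "0 = Poly_Mapping.lookup (\<Sum>n\<in>A. Poly_Mapping.single n (g (?e n))) m" using s by simp
    also have "\<dots> = g x" using m assms by (simp add: lookup_sum lookup_single when_def sum.delta)
    finally show "g x = 0" by simp
  qed (use assms in auto)
qed

lemma supported_Un:
  "(supported (A \<union> B) :: ('v, 'k::field) mpoly set) = mp.ssum (supported A) (supported B)"
proof
  show "mp.ssum (supported A) (supported B) \<subseteq> (supported (A \<union> B) :: ('v, 'k) mpoly set)"
    unfolding mp.ssum_def supported_def using keys_add by fastforce
  show "(supported (A \<union> B) :: ('v, 'k) mpoly set) \<subseteq> mp.ssum (supported A) (supported B)"
  proof
    fix p :: "('v, 'k) mpoly" assume p: "p \<in> supported (A \<union> B)"
    let ?s = "\<lambda>m. Poly_Mapping.single m (Poly_Mapping.lookup p m)"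
    let ?K = "Poly_Mapping.keys p"
    have "p = (\<Sum>m\<in>(?K \<inter> A) \<union> (?K - A). ?s m)"
      by (simp only: Int_Diff_Un sum_singles[symmetric])
    also have "\<dots> = (\<Sum>m\<in>?K \<inter> A. ?s m) + (\<Sum>m\<in>?K - A. ?s m)"
      by (rule sum.union_disjoint) auto
    finally have "p = (\<Sum>m\<in>?K \<inter> A. ?s m) + (\<Sum>m\<in>?K - A. ?s m)" .
    moreover have "(\<Sum>m\<in>?K \<inter> A. ?s m) \<in> supported A" "(\<Sum>m\<in>?K - A. ?s m) \<in> supported B"
      using p by (intro mp.subspace_sum[OF subspace_supported]; auto simp: supported_def split: if_splits)+
    ultimately show "p \<in> mp.ssum (supported A) (supported B)" unfolding mp.ssum_def by blast
  qed
qed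

lemma mpoly_induct_single:
  assumes "\<And>m c. P (Poly_Mapping.single m c)" "\<And>p q. P p \<Longrightarrow> P q \<Longrightarrow> P (p + q)"
  shows "P (p :: ('v, 'k::comm_ring_1) mpoly)"
proof -
  have "P (\<Sum>m\<in>A. Poly_Mapping.single m (Poly_Mapping.lookup p m))" if "finite A" for A
    using that by (induction A rule: finite_induct) (use assms assms(1)[of 0 0] in auto)
  from this[OF finite_keys[of p]] show ?thesis by (simp only: sum_singles[symmetric])
qed

section \<open>The bigrading\<close>

lemma mdeg_add: "mdeg dg (m + n) = mdeg dg m + mdeg dg n"
  unfolding mdeg_def
  by (simp add: setsum_keys_plus_distrib[of "\<lambda>v c. c * fst (dg v)"]
      setsum_keys_plus_distrib[of "\<lambda>v c. c * snd (dg v)"] distrib_right)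

lemma bicomp_eq_supported: "bicomp dg d = supported {m. mdeg dg m = d}"
  unfolding bicomp_def supported_def by auto

lemma subspace_bicomp: "mp.subspace (bicomp dg d)"
  unfolding bicomp_eq_supported by (rule subspace_supported)

lemma bicomp_mult: "p \<in> bicomp dg d \<Longrightarrow> q \<in> bicomp dg e \<Longrightarrow> p * q \<in> bicomp dg (d + e)"
  using keys_mult[of p q] by (fastforce simp: bicomp_def mdeg_add)

lemma single_in_bicomp: "Poly_Mapping.single m c \<in> bicomp dg (mdeg dg m)"
  by (simp add: bicomp_def)

definition bpart :: "('v \<Rightarrow> nat \<times> nat) \<Rightarrow> nat \<times> nat \<Rightarrow> ('v, 'k::comm_ring_1) mpoly \<Rightarrow> ('v, 'k) mpoly" where
  "bpart dg d p = Poly_Mapping.mapp (\<lambda>m c. if mdeg dg m = d then c else 0) p"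

lemma lookup_bpart: "Poly_Mapping.lookup (bpart dg d p) m = (if mdeg dg m = d then Poly_Mapping.lookup p m else 0)"
  unfolding bpart_def lookup_mapp by (simp add: when_def in_keys_iff)

lemma bpart_add: "bpart dg d (p + q) = bpart dg d p + bpart dg d q"
  by (rule poly_mapping_eqI) (simp add: lookup_bpart lookup_add)

lemma bpart_in_bicomp: "bpart dg d p \<in> bicomp dg d"
  unfolding bicomp_def by (auto simp: in_keys_iff lookup_bpart split: if_splits)

lemma bpart_bicomp: "p \<in> bicomp dg e \<Longrightarrow> bpart dg d p = (if e = d then p else 0)"
  by (rule poly_mapping_eqI) (auto simp: lookup_bpart bicomp_def in_keys_iff)

lemma bpart_zero: "bpart dg d 0 = 0"
  by (rule poly_mapping_eqI) (simp add: lookup_bpart)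

lemma bpart_mult:
  assumes "l \<in> bicomp dg e"
  shows "bpart dg (e + d) (l * g) = l * bpart dg d g"
proof (induction g rule: mpoly_induct_single)
  case (1 m c)
  have "l * Poly_Mapping.single m c \<in> bicomp dg (e + mdeg dg m)"
    using assms single_in_bicomp by (rule bicomp_mult)
  then show ?case using single_in_bicomp[of m c dg] by (simp add: bpart_bicomp)
qed (simp add: distrib_left bpart_add)

lemma bpart_mult_none:
  assumes "l \<in> bicomp dg e" "\<And>d'. d \<noteq> e + d'"
  shows "bpart dg d (l * g) = 0"
proof (induction g rule: mpoly_induct_single)
  case (1 m c)
  have "l * Poly_Mapping.single m c \<in> bicomp dg (e + mdeg dg m)"
    using assms(1) single_in_bicomp by (rule bicomp_mult)
  then show ?case using assms(2)[of "mdeg dg m"] by (auto simp: bpart_bicomp)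
qed (simp add: distrib_left bpart_add)

text \<open>Homogeneity as closure under components, the form in which graded pieces of sums of
  ideals can be computed.\<close>

definition hom_ideal :: "('v \<Rightarrow> nat \<times> nat) \<Rightarrow> ('v, 'k::comm_ring_1) mpoly set \<Rightarrow> bool" where
  "hom_ideal dg J \<longleftrightarrow> is_ideal J \<and> (\<forall>f\<in>J. \<forall>d. bpart dg d f \<in> J)"

lemma hom_ideal_ideal: "hom_ideal dg J \<Longrightarrow> is_ideal J"
  unfolding hom_ideal_def by simp

lemma hom_ideal_zero: "hom_ideal dg {0}"
  unfolding hom_ideal_def by (simp add: is_ideal_zero bpart_zero)

lemma bpart_mult_cases:
  assumes "l \<in> bicomp dg e"
  obtains r where "bpart dg d (l * g) = l * r"
proof (cases "\<exists>d'. d = e + d'")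
  case True
  then show ?thesis using that bpart_mult[OF assms] by blast
next
  case False
  then have "bpart dg d (l * g) = 0" by (intro bpart_mult_none[OF assms]) blast
  then show ?thesis using that[of 0] by simp
qed

lemma hom_ideal_adj:
  assumes "hom_ideal dg J" "l \<in> bicomp dg e"
  shows "hom_ideal dg (adj J l)"
  unfolding hom_ideal_def
proof (intro conjI ballI allI)
  show "is_ideal (adj J l)" using assms(1) by (simp add: hom_ideal_ideal is_ideal_adj)
  fix f d assume "f \<in> adj J l"
  then obtain k r where f: "f = k + l * r" "k \<in> J" by (rule adjE)
  obtain s where "bpart dg d (l * r) = l * s" using bpart_mult_cases[OF assms(2)] by blast
  then show "bpart dg d f \<in> adj J l"
    using f assms(1) unfolding f(1) bpart_add hom_ideal_def by (metis adjI)
qed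

lemma power_in_bicomp: "p \<in> bicomp dg (e1, e2) \<Longrightarrow> p ^ n \<in> bicomp dg (n * e1, n * e2)"
proof (induction n)
  case 0
  then show ?case by (simp add: bicomp_def mdeg_def)
next
  case (Suc n)
  then show ?case using bicomp_mult[of p dg "(e1, e2)" "p ^ n" "(n * e1, n * e2)"] by simp
qed

lemma hom_ideal_pw:
  assumes "a \<in> bicomp dg (a1, a2)" "b \<in> bicomp dg (b1, b2)"
  shows "hom_ideal dg (pw a b m)"
proof (induction m)
  case (Suc m)
  show ?case unfolding hom_ideal_def
  proof (intro conjI ballI allI)
    fix f d assume "f \<in> pw a b (Suc m)"
    then obtain u w where f: "f = a * u + b ^ Suc m * w" "u \<in> pw a b m" by auto
    have "\<exists>v\<in>pw a b m. bpart dg d (a * u) = a * v"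
      using bpart_mult[OF assms(1)] bpart_mult_none[OF assms(1)] Suc f(2) ideal_zero[OF is_ideal_pw]
      unfolding hom_ideal_def by (metis mult_zero_right)
    moreover obtain z where "bpart dg d (b ^ Suc m * w) = b ^ Suc m * z"
      using bpart_mult_cases[OF power_in_bicomp[OF assms(2)]] by blast
    ultimately show "bpart dg d f \<in> pw a b (Suc m)"
      unfolding f(1) bpart_add by (metis pwI)
  qed (rule is_ideal_pw)
qed (simp add: hom_ideal_def is_ideal_UNIV)

lemma hilb_eq_cod: "hilb dg J d = mp.cod J (bicomp dg d)"
  unfolding hilb_def kdim_def mp.cod_def ..

text \<open>Taking a component of \<open>k + l * r\<close> keeps the first term in \<open>J\<close>
  and replaces \<open>r\<close> by one of its components. This turns the middle term of
  \<open>cod_exact\<close> into a graded piece of \<open>adj J l\<close>.\<close>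

lemma adj_inter_bicomp:
  assumes "hom_ideal dg J" "l \<in> bicomp dg e"
  shows "adj J l \<inter> bicomp dg (e + d) = mp.ssum (J \<inter> bicomp dg (e + d)) ((*) l ` bicomp dg d)"
proof
  show "adj J l \<inter> bicomp dg (e + d) \<subseteq> mp.ssum (J \<inter> bicomp dg (e + d)) ((*) l ` bicomp dg d)"
  proof
    fix f assume "f \<in> adj J l \<inter> bicomp dg (e + d)"
    then obtain k r where f: "f = k + l * r" "k \<in> J" "f \<in> bicomp dg (e + d)" by (auto elim: adjE)
    then have "f = bpart dg (e + d) k + l * bpart dg d r"
      using bpart_bicomp[OF f(3), of "e + d"] bpart_mult[OF assms(2)] by (simp add: bpart_add)
    then show "f \<in> mp.ssum (J \<inter> bicomp dg (e + d)) ((*) l ` bicomp dg d)"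
      unfolding mp.ssum_def using f(2) assms(1) bpart_in_bicomp unfolding hom_ideal_def by blast
  qed
  show "mp.ssum (J \<inter> bicomp dg (e + d)) ((*) l ` bicomp dg d) \<subseteq> adj J l \<inter> bicomp dg (e + d)"
    unfolding mp.ssum_def adj_def
    using bicomp_mult[OF assms(2), of _ d] mp.subspace_add[OF subspace_bicomp, of _ dg "e + d"] by blast
qed

lemma adj_inter_degenerate:
  assumes "hom_ideal dg J" "l \<in> bicomp dg e" "\<And>d'. d \<noteq> e + d'"
  shows "adj J l \<inter> bicomp dg d \<subseteq> J"
proof
  fix f assume "f \<in> adj J l \<inter> bicomp dg d"
  then obtain k r where f: "f = k + l * r" "k \<in> J" "f \<in> bicomp dg d" by (auto elim: adjE)
  then have "f = bpart dg d k"
    using bpart_bicomp[OF f(3), of d] bpart_mult_none[OF assms(2,3)] by (simp add: bpart_add)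
  then show "f \<in> J" using f(2) assms(1) unfolding hom_ideal_def by blast
qed

lemma hilb_adj_degenerate:
  assumes "hom_ideal dg J" "l \<in> bicomp dg e" "\<And>d'. d \<noteq> e + d'"
  shows "hilb dg (adj J l) d = hilb dg J d"
proof -
  have "adj J l \<inter> bicomp dg d = J \<inter> bicomp dg d"
    using adj_inter_degenerate[OF assms] adj_base by blast
  then show ?thesis unfolding hilb_def by simp
qed

lemma hilb_cong: "J \<inter> bicomp dg d = K \<inter> bicomp dg d \<Longrightarrow> hilb dg J d = hilb dg K d"
  unfolding hilb_def by simp

lemma hilb_exact:
  fixes J :: "(var4, 'k::field) mpoly set"
  assumes "hom_ideal dg J" "l \<in> bicomp dg e" "l \<noteq> 0"
    and "mp.fd (bicomp dg d :: (var4, 'k) mpoly set)" "mp.fd (bicomp dg (e + d) :: (var4, 'k) mpoly set)"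
  shows "hilb dg J (e + d) = hilb dg (adj J l) (e + d) + hilb dg {g. l * g \<in> J} d"
proof -
  have "mp.cod J (bicomp dg (e + d)) =
      (mp.dim (bicomp dg (e + d) :: (var4, 'k) mpoly set)
        - mp.dim (mp.ssum (J \<inter> bicomp dg (e + d)) ((*) l ` bicomp dg d))) + mp.cod {u. l * u \<in> J} (bicomp dg d)"
    using assms bicomp_mult[OF assms(2), of _ d]
    by (intro mp.cod_exact module_hom_mult inj_mult subspace_bicomp subspace_ideal hom_ideal_ideal) auto
  then show ?thesis
    unfolding hilb_eq_cod adj_inter_bicomp[OF assms(1,2), symmetric] by (simp add: mp.cod_def)
qed

lemma mdeg_dg4: "mdeg dg4 m = (Poly_Mapping.lookup m X0 + Poly_Mapping.lookup m X1,
    Poly_Mapping.lookup m Y0 + Poly_Mapping.lookup m Y1)"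
proof -
  have s: "Poly_Mapping.keys m \<subseteq> {X0, X1, Y0, Y1}" using var4.exhaust by blast
  have "(\<Sum>v\<in>Poly_Mapping.keys m. Poly_Mapping.lookup m v * f v) = (\<Sum>v\<in>{X0, X1, Y0, Y1}. Poly_Mapping.lookup m v * f v)" for f
    using s by (intro sum.mono_neutral_left) (auto simp: in_keys_iff)
  then show ?thesis unfolding mdeg_def by simp
qed

definition mono4 :: "nat \<Rightarrow> nat \<Rightarrow> nat \<Rightarrow> nat \<Rightarrow> var4 \<Rightarrow>\<^sub>0 nat" where
  "mono4 a b c d = Poly_Mapping.single X0 a + Poly_Mapping.single X1 b
     + Poly_Mapping.single Y0 c + Poly_Mapping.single Y1 d"

lemma lookup_mono4: "Poly_Mapping.lookup (mono4 a b c d) X0 = a" "Poly_Mapping.lookup (mono4 a b c d) X1 = b"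
  "Poly_Mapping.lookup (mono4 a b c d) Y0 = c" "Poly_Mapping.lookup (mono4 a b c d) Y1 = d"
  unfolding mono4_def by (simp_all add: lookup_add lookup_single when_def)

lemma mono4_eqI: "Poly_Mapping.lookup m X0 = Poly_Mapping.lookup n X0 \<Longrightarrow> Poly_Mapping.lookup m X1 = Poly_Mapping.lookup n X1 \<Longrightarrow>
   Poly_Mapping.lookup m Y0 = Poly_Mapping.lookup n Y0 \<Longrightarrow> Poly_Mapping.lookup m Y1 = Poly_Mapping.lookup n Y1 \<Longrightarrow> m = n"
  by (rule poly_mapping_eqI, rename_tac v, case_tac v) auto

lemma monomials_bidegree:
  "{m. mdeg dg4 m = (i, j)} = (\<lambda>(a, c). mono4 a (i - a) c (j - c)) ` ({..i} \<times> {..j})"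
proof
  show "{m. mdeg dg4 m = (i, j)} \<subseteq> (\<lambda>(a, c). mono4 a (i - a) c (j - c)) ` ({..i} \<times> {..j})"
  proof
    fix m assume "m \<in> {m. mdeg dg4 m = (i, j)}"
    then have "m = mono4 (Poly_Mapping.lookup m X0) (i - Poly_Mapping.lookup m X0)
        (Poly_Mapping.lookup m Y0) (j - Poly_Mapping.lookup m Y0)"
        "Poly_Mapping.lookup m X0 \<le> i" "Poly_Mapping.lookup m Y0 \<le> j"
      by (auto simp: mdeg_dg4 lookup_mono4 intro!: mono4_eqI)
    then show "m \<in> (\<lambda>(a, c). mono4 a (i - a) c (j - c)) ` ({..i} \<times> {..j})" by force
  qed
qed (auto simp: mdeg_dg4 lookup_mono4)

lemma card_monomials_bidegree: "card {m. mdeg dg4 m = (i, j)} = (i + 1) * (j + 1)"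
proof -
  have "inj_on (\<lambda>(a, c). mono4 a (i - a) c (j - c)) ({..i} \<times> {..j})"
    by (auto intro!: inj_onI) (metis lookup_mono4)+
  then show ?thesis unfolding monomials_bidegree by (simp add: card_image card_cartesian_product)
qed

lemma finite_monomials_bidegree: "finite {m. mdeg dg4 m = d}"
  by (cases d) (simp add: monomials_bidegree)

lemma fd_bicomp: "mp.fd (bicomp dg4 d)"
  unfolding bicomp_eq_supported using finite_monomials_bidegree by (rule fd_supported)

lemma hilb_zero: "hilb dg4 {0 :: (var4, 'k::field) mpoly} (i, j) = (i + 1) * (j + 1)"
proof -
  have "{0 :: (var4, 'k) mpoly} \<inter> bicomp dg4 (i, j) = {0}"
    using mp.subspace_0[OF subspace_bicomp] by auto
  moreover have "mp.dim {0 :: (var4, 'k) mpoly} = 0"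
    using mp.dim_le_card[of "{0}" "{}"] by simp
  ultimately show ?thesis
    unfolding hilb_eq_cod mp.cod_def bicomp_eq_supported
    by (simp add: dim_supported finite_monomials_bidegree card_monomials_bidegree)
qed

lemma hilb_antimono: "J \<subseteq> K \<Longrightarrow> hilb dg4 K d \<le> hilb dg4 J d"
  unfolding hilb_eq_cod by (rule mp.cod_antimono[OF fd_bicomp])

section \<open>Substitution and ideals of linear forms\<close>

definition mpow :: "('v \<Rightarrow> 'a::comm_ring_1) \<Rightarrow> ('v \<Rightarrow>\<^sub>0 nat) \<Rightarrow> 'a" where
  "mpow s m = (\<Prod>v\<in>Poly_Mapping.keys m. s v ^ Poly_Mapping.lookup m v)"

lemma mpow_superset:
  "finite A \<Longrightarrow> Poly_Mapping.keys m \<subseteq> A \<Longrightarrow> mpow s m = (\<Prod>v\<in>A. s v ^ Poly_Mapping.lookup m v)"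
  unfolding mpow_def by (rule prod.mono_neutral_left) (auto simp: in_keys_iff)

lemma mpow_add: "mpow s (m + n) = mpow s m * mpow s n"
proof -
  let ?A = "Poly_Mapping.keys m \<union> Poly_Mapping.keys n"
  have "mpow s (m + n) = (\<Prod>v\<in>?A. s v ^ Poly_Mapping.lookup (m + n) v)"
    by (intro mpow_superset keys_add) auto
  also have "\<dots> = (\<Prod>v\<in>?A. s v ^ Poly_Mapping.lookup m v) * (\<Prod>v\<in>?A. s v ^ Poly_Mapping.lookup n v)"
    by (simp add: lookup_add power_add prod.distrib)
  also have "\<dots> = mpow s m * mpow s n" by (simp add: mpow_superset[of ?A])
  finally show ?thesis .
qed

lemma mvar_power: "mvar v ^ n = Poly_Mapping.single (Poly_Mapping.single v n) 1"
  by (induction n) (simp_all add: mvar_def mult_single single_add[symmetric])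

lemma mpow_mvar: "mpow mvar m = Poly_Mapping.single m 1"
proof -
  have "(\<Prod>v\<in>A. mvar v ^ Poly_Mapping.lookup m v)
      = Poly_Mapping.single (\<Sum>v\<in>A. Poly_Mapping.single v (Poly_Mapping.lookup m v)) 1" for A
    by (induction A rule: infinite_finite_induct) (simp_all add: mvar_power mult_single)
  from this[of "Poly_Mapping.keys m"] show ?thesis
    unfolding mpow_def by (simp only: sum_singles[symmetric])
qed

definition msubst :: "('v \<Rightarrow> ('v, 'k::comm_ring_1) mpoly) \<Rightarrow> ('v, 'k) mpoly \<Rightarrow> ('v, 'k) mpoly" where
  "msubst s p = (\<Sum>m\<in>Poly_Mapping.keys p. mconst (Poly_Mapping.lookup p m) * mpow s m)"

lemma msubst_add: "msubst s (p + q) = msubst s p + msubst s q"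
  unfolding msubst_def
  using setsum_keys_plus_distrib[of "\<lambda>m c. mconst c * mpow s m" p q]
  by (simp add: mconst_add distrib_right)

lemma msubst_single: "msubst s (Poly_Mapping.single m c) = mconst c * mpow s m"
  by (cases "c = 0") (simp_all add: msubst_def)

lemma msubst_mult: "msubst s (p * q) = msubst s p * msubst s q"
proof (induction p rule: mpoly_induct_single)
  case (1 m c)
  show ?case
  proof (induction q rule: mpoly_induct_single)
    case (1 n d)
    show ?case by (simp add: mult_single msubst_single mconst_mult mpow_add algebra_simps)
  qed (simp add: distrib_left msubst_add)
qed (simp add: distrib_right msubst_add)

lemma msubst_mconst: "msubst s (mconst c) = mconst c"
  unfolding mconst_def msubst_single by (simp add: mconst_def mpow_def)

lemma msubst_mvar: "msubst s (mvar v) = s v"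
  unfolding mvar_def msubst_single by (simp add: mpow_def)

lemma msubst_diff: "msubst s (p - q) = msubst s p - msubst s q"
  using msubst_add[of s "p - q" q] by simp

lemma msubst_zero: "msubst s 0 = 0" by (simp add: msubst_def)

lemma is_ideal_kernel: "is_ideal {f. msubst s f = 0}"
  unfolding is_ideal_def by (simp add: msubst_zero msubst_add msubst_mult)

lemma ideal_diff_mult:
  "is_ideal K \<Longrightarrow> a - b \<in> K \<Longrightarrow> c - d \<in> K \<Longrightarrow> a * c - b * d \<in> K"
proof -
  assume K: "is_ideal K" "a - b \<in> K" "c - d \<in> K"
  have "a * c - b * d = c * (a - b) + b * (c - d)" by (simp add: algebra_simps)
  then show ?thesis using K ideal_add ideal_mult by metis
qed

lemma diff_msubst_in_ideal:
  assumes K: "is_ideal K" and v: "\<And>v. mvar v - s v \<in> K"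
  shows "f - msubst s f \<in> K"
proof (induction f rule: mpoly_induct_single)
  case (1 m c)
  have pow: "mvar v ^ n - s v ^ n \<in> K" for v n
    by (induction n) (use K v in \<open>auto intro: ideal_diff_mult ideal_zero\<close>)
  have "(\<Prod>v\<in>A. mvar v ^ Poly_Mapping.lookup m v) - (\<Prod>v\<in>A. s v ^ Poly_Mapping.lookup m v) \<in> K" for A
    by (induction A rule: infinite_finite_induct)
      (use K pow in \<open>auto intro: ideal_diff_mult ideal_zero\<close>)
  then have "mpow mvar m - mpow s m \<in> K" unfolding mpow_def .
  then have "mconst c * (mpow mvar m - mpow s m) \<in> K" using K by (rule ideal_mult[rotated])
  then show ?case
    by (simp add: msubst_single right_diff_distrib mpow_mvar mconst_def mult_single)
next
  case (2 p q)
  have "p + q - msubst s (p + q) = (p - msubst s p) + (q - msubst s q)" by (simp add: msubst_add)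
  then show ?case using ideal_add[OF K 2] by (simp only:)
qed

text \<open>Modulo \<open>K\<close> every polynomial agrees with its image under \<open>s\<close>,
  so \<open>K\<close> is exactly the kernel of \<open>s\<close>; a kernel of a map into a domain is
  prime.\<close>

lemma kernel_prime:
  fixes K :: "(var4, 'k::idom) mpoly set"
  assumes K: "is_ideal K" and v: "\<And>v. mvar v - s v \<in> K" and z: "\<And>f. f \<in> K \<Longrightarrow> msubst s f = 0"
  shows "K = {f. msubst s f = 0}" "prime_ideal K"
proof -
  have "f \<in> K" if "msubst s f = 0" for f
    using diff_msubst_in_ideal[OF K v, of f] that by simp
  then show e: "K = {f. msubst s f = 0}" using z by blast
  have "1 \<notin> K" using msubst_mconst[of s 1] unfolding e by auto
  then show "prime_ideal K" unfolding prime_ideal_def using K by (subst (3) e, subst (3 4) e) (auto simp: e msubst_mult)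
qed

section \<open>Linear forms of points and the primes they generate\<close>

definition lform :: "(var4, 'k::field) mpoly \<Rightarrow> (var4, 'k) mpoly \<Rightarrow> 'k option \<Rightarrow> (var4, 'k) mpoly" where
  "lform z0 z1 p = mconst (snd (p1coords p)) * z0 - mconst (fst (p1coords p)) * z1"

lemma lform_simps [simp]: "lform z0 z1 None = z0" "lform z0 z1 (Some a) = mconst a * z0 - z1"
  by (simp_all add: lform_def)

text \<open>The images of the coordinates \<open>z0, z1\<close> modulo the linear forms of the points of \<open>S\<close>.\<close>

definition proj :: "(var4, 'k::field) mpoly \<Rightarrow> (var4, 'k) mpoly \<Rightarrow> 'k option set \<Rightarrow> (var4, 'k) mpoly \<times> (var4, 'k) mpoly" where
  "proj z0 z1 S = (if S = {} then (z0, z1) else if is_singleton S then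
     (case the_elem S of None \<Rightarrow> (0, z1) | Some a \<Rightarrow> (z0, mconst a * z0)) else (0, 0))"

lemma proj_simps [simp]: "proj z0 z1 {} = (z0, z1)" "proj z0 z1 {None} = (0, z1)"
  "proj z0 z1 {Some a} = (z0, mconst a * z0)"
  by (simp_all add: proj_def is_singleton_def)

lemma proj_many: "p \<in> S \<Longrightarrow> p' \<in> S \<Longrightarrow> p \<noteq> p' \<Longrightarrow> proj z0 z1 S = (0, 0)"
  by (auto simp: proj_def is_singleton_def)

lemma set_cases:
  obtains "S = {}" | p where "S = {p}" | p p' where "p \<in> S" "p' \<in> S" "p \<noteq> p'"
proof (cases "S = {}")
  case False
  then obtain p where p: "p \<in> S" by blast
  show ?thesis
  proof (cases "S = {p}")
    case False
    then obtain p' where "p' \<in> S" "p \<noteq> p'" using p by blast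
    then show ?thesis using p that(3) by blast
  qed (rule that(2))
qed (rule that(1))

lemma lform_proj:
  assumes "p \<in> S"
  shows "lform (fst (proj z0 z1 S)) (snd (proj z0 z1 S)) p = 0"
proof (cases rule: set_cases[of S])
  case (2 r)
  then show ?thesis using assms by (cases r) auto
next
  case (3 r r')
  then show ?thesis by (cases p) (auto simp: proj_many)
qed (use assms in auto)

text \<open>The forms of two distinct points are linearly independent, so they span both
  coordinates.\<close>

lemma coords_in_ideal:
  assumes K: "is_ideal K" and p: "lform z0 z1 p \<in> K" "lform z0 z1 p' \<in> K" "p \<noteq> p'"
  shows "z0 \<in> K" "z1 \<in> K"
proof -
  have *: "z0 \<in> K \<and> z1 \<in> K" if "z0 \<in> K" "lform z0 z1 (Some a) \<in> K" for a
  proof -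
    have "z1 = mconst a * z0 - lform z0 z1 (Some a)" by simp
    then show ?thesis using that K ideal_diff ideal_mult by metis
  qed
  have "z0 \<in> K" if "lform z0 z1 (Some a) \<in> K" "lform z0 z1 (Some a') \<in> K" "a \<noteq> a'" for a a'
  proof -
    have "mconst (a - a') * z0 = lform z0 z1 (Some a) - lform z0 z1 (Some a')"
      by (simp add: mconst_diff algebra_simps)
    then have "mconst (a - a') * z0 \<in> K" using that K ideal_diff by metis
    then have "mconst (inverse (a - a')) * (mconst (a - a') * z0) \<in> K" using K ideal_mult by metis
    moreover have "mconst (inverse (a - a')) * (mconst (a - a') * z0) = z0"
      using that by (simp add: mult.assoc[symmetric] mconst_mult[symmetric])
    ultimately show ?thesis by simp
  qed
  then have "z0 \<in> K \<and> z1 \<in> K" using p * by (cases p; cases p') auto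
  then show "z0 \<in> K" "z1 \<in> K" by auto
qed

lemma proj_diff_in_ideal:
  assumes K: "is_ideal K" "lform z0 z1 ` S \<subseteq> K"
  shows "z0 - fst (proj z0 z1 S) \<in> K" "z1 - snd (proj z0 z1 S) \<in> K"
proof -
  have "z0 - fst (proj z0 z1 S) \<in> K \<and> z1 - snd (proj z0 z1 S) \<in> K"
  proof (cases rule: set_cases[of S])
    case (2 r)
    then show ?thesis using K ideal_minus[OF K(1), of "lform z0 z1 r"]
      by (cases r) (auto simp: ideal_zero)
  next
    case (3 r r')
    then show ?thesis using coords_in_ideal[OF K(1), of z0 z1 r r'] K(2) by (auto simp: proj_many)
  qed (simp add: ideal_zero K)
  then show "z0 - fst (proj z0 z1 S) \<in> K" "z1 - snd (proj z0 z1 S) \<in> K" by auto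
qed

text \<open>For two or more points in \<open>S\<close> the projection is zero and kills every form,
  hence the restriction on \<open>S\<close>.\<close>

lemma lform_proj_nonzero:
  assumes "S = {} \<or> (\<exists>r. S = {r})" "p \<notin> S" "z0 = mvar v" "z1 = mvar w" "v \<noteq> w"
  shows "lform (fst (proj z0 z1 S)) (snd (proj z0 z1 S)) p \<noteq> 0"
proof -
  have "mconst a * mvar v - mvar w \<noteq> (0 :: (var4, 'a) mpoly)" for a
  proof
    assume "mconst a * mvar v - mvar w = (0 :: (var4, 'a) mpoly)"
    then have "Poly_Mapping.lookup (mconst a * mvar v - mvar w :: (var4, 'a) mpoly) (Poly_Mapping.single w 1) = 0" by simp
    moreover have "Poly_Mapping.single w (1::nat) \<noteq> Poly_Mapping.single v 1"
      using assms(5) by (metis lookup_single_eq lookup_single_not_eq zero_neq_one)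
    ultimately show False by (simp add: lookup_minus lookup_mconst_mult lookup_mvar)
  qed
  moreover have "mconst a * mvar v - mconst b * mvar v \<noteq> (0 :: (var4, 'a) mpoly)" if "a \<noteq> b" for a b
  proof -
    have "mconst a * mvar v - mconst b * mvar v = (mconst (a - b) * mvar v :: (var4, 'a) mpoly)"
      by (simp add: mconst_diff algebra_simps)
    then show ?thesis using that mvar_nonzero by simp
  qed
  ultimately show ?thesis
    using assms mvar_nonzero by (cases p; cases "S = {}"; cases "the_elem S") fastforce+
qed

definition lf :: "bool \<Rightarrow> 'k::field option \<Rightarrow> (var4, 'k) mpoly" where
  "lf b p = lform (mvar (if b then X0 else Y0)) (mvar (if b then X1 else Y1)) p"

text \<open>The flag \<open>b\<close> says whether the points of the first set are points of the first or of the
  second factor of the product of projective lines.\<close>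

definition lin :: "bool \<Rightarrow> 'k::field option set \<Rightarrow> 'k option set \<Rightarrow> (var4, 'k) mpoly set" where
  "lin b S T = ideal_gen (lf b ` S \<union> lf (\<not> b) ` T)"

lemma lin_swap: "lin (\<not> b) T S = lin b S T"
  unfolding lin_def by (simp add: Un_commute)

lemma lin_empty: "lin b {} {} = {0}"
  unfolding lin_def by (simp add: ideal_gen_empty)

lemma lin_insert1: "lin b (insert p S) T = adj (lin b S T) (lf b p)"
  and lin_insert2: "lin b S (insert q T) = adj (lin b S T) (lf (\<not> b) q)"
  unfolding lin_def by (simp_all add: ideal_gen_insert)

lemma is_ideal_lin: "is_ideal (lin b S T)"
  unfolding lin_def by (rule is_ideal_ideal_gen)

text \<open>The substitution that projects the first pair of variables along \<open>S\<close> and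
  the second along \<open>T\<close> has kernel \<open>lin True S T\<close>. Primality follows, and a
  form lies outside the ideal as soon as its image is nonzero.\<close>

lemma lin_True:
  fixes S T :: "'k::field option set"
  shows "prime_ideal (lin True S T)"
    and "S = {} \<or> (\<exists>r. S = {r}) \<Longrightarrow> p \<notin> S \<Longrightarrow> lf True p \<notin> lin True S T"
    and "T = {} \<or> (\<exists>r. T = {r}) \<Longrightarrow> q \<notin> T \<Longrightarrow> lf False q \<notin> lin True S T"
proof -
  define s where "s v = (case v of X0 \<Rightarrow> fst (proj (mvar X0) (mvar X1) S) | X1 \<Rightarrow> snd (proj (mvar X0) (mvar X1) S)
    | Y0 \<Rightarrow> fst (proj (mvar Y0) (mvar Y1) T) | Y1 \<Rightarrow> snd (proj (mvar Y0) (mvar Y1) T))"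
    for v :: var4
  have ss: "msubst s (lf b p) = lform (s (if b then X0 else Y0)) (s (if b then X1 else Y1)) p" for b p
    unfolding lf_def by (cases p) (simp_all add: msubst_mult msubst_diff msubst_mconst msubst_mvar)
  have gens: "lf True ` S \<union> lf False ` T \<subseteq> lin True S T"
    unfolding lin_def using ideal_gen_base[of "lf True ` S \<union> lf (\<not> True) ` T"] by simp
  have 1: "mvar v - s v \<in> lin True S T" for v
    using gens proj_diff_in_ideal[OF is_ideal_lin, of "mvar X0" "mvar X1" S True S T]
      proj_diff_in_ideal[OF is_ideal_lin, of "mvar Y0" "mvar Y1" T True S T]
    by (cases v) (auto simp: s_def lf_def)
  have "lin True S T \<subseteq> {f. msubst s f = 0}"
    unfolding lin_def
    by (rule ideal_gen_least[OF is_ideal_kernel]) (auto simp: ss, simp_all add: s_def lform_proj)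
  then have 2: "f \<in> lin True S T \<Longrightarrow> msubst s f = 0" for f by blast
  show "prime_ideal (lin True S T)" by (rule kernel_prime[OF is_ideal_lin 1 2])
  show "S = {} \<or> (\<exists>r. S = {r}) \<Longrightarrow> p \<notin> S \<Longrightarrow> lf True p \<notin> lin True S T"
    using 2[of "lf True p"] lform_proj_nonzero[of S p _ X0 _ X1, OF _ _ refl refl]
    by (auto simp: ss s_def)
  show "T = {} \<or> (\<exists>r. T = {r}) \<Longrightarrow> q \<notin> T \<Longrightarrow> lf False q \<notin> lin True S T"
    using 2[of "lf False q"] lform_proj_nonzero[of T q _ Y0 _ Y1, OF _ _ refl refl]
    by (auto simp: ss s_def)
qed

lemma prime_lin: "prime_ideal (lin b S T)"
  by (metis (full_types) lin_True(1) lin_swap)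

lemma lf_notin_lin:
  assumes "S = {} \<or> (\<exists>r. S = {r})" "p \<notin> S"
  shows "lf b p \<notin> lin b S T"
proof (cases b)
  case False
  then show ?thesis using lin_True(3)[OF assms, of T] lin_swap[of True S T] by simp
qed (use lin_True(2)[OF assms] in simp)

lemma nzd_lf:
  assumes "S = {} \<or> (\<exists>r. S = {r})" "p \<notin> S"
  shows "nzd (lf b p) (lin b S T)"
  using nzd_prime[OF prime_lin lf_notin_lin[OF assms]] .

lemma nzd_lf':
  assumes "T = {} \<or> (\<exists>r. T = {r})" "q \<notin> T"
  shows "nzd (lf (\<not> b) q) (lin b S T)"
  using nzd_lf[OF assms, of "\<not> b" S] by (simp add: lin_swap)

lemma lf_nonzero: "lf b p \<noteq> 0"
  using lf_notin_lin[of "{}" p b "{}"] by (simp add: lin_empty)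

text \<open>Bidegree written from the viewpoint of ruling \<open>b\<close>: the first number is the
  degree in the variables of that ruling.\<close>

definition bd :: "bool \<Rightarrow> nat \<Rightarrow> nat \<Rightarrow> nat \<times> nat" where
  "bd b i j = (if b then (i, j) else (j, i))"

lemma bd_add: "bd b i j + bd b i' j' = bd b (i + i') (j + j')"
  by (simp add: bd_def)

lemma bd_inject: "bd b i j = bd b i' j' \<longleftrightarrow> i = i' \<and> j = j'"
  by (auto simp: bd_def)

lemma bd_cases: obtains i j where "d = bd b i j"
  unfolding bd_def by (cases d; cases b) auto

lemma bd_not: "bd (\<not> b) j i = bd b i j"
  by (simp add: bd_def)

lemma mvar_bicomp: "mvar v \<in> bicomp dg4 (dg4 v)"
  unfolding mvar_def using single_in_bicomp[of "Poly_Mapping.single v 1" 1 dg4]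
  by (simp add: mdeg_def)

lemma bicomp_mconst_mult: "p \<in> bicomp dg d \<Longrightarrow> mconst c * p \<in> bicomp dg d"
  unfolding bicomp_def by (auto simp: in_keys_iff lookup_mconst_mult)

lemma lf_bicomp: "lf b p \<in> bicomp dg4 (bd b 1 0)"
proof -
  have "mvar (if b then X0 else Y0) \<in> bicomp dg4 (bd b 1 0)" "mvar (if b then X1 else Y1) \<in> bicomp dg4 (bd b 1 0)"
    using mvar_bicomp[of X0] mvar_bicomp[of Y0] mvar_bicomp[of X1] mvar_bicomp[of Y1]
    by (auto simp: bd_def)
  then show ?thesis unfolding lf_def lform_def
    by (intro mp.subspace_diff[OF subspace_bicomp] bicomp_mconst_mult)
qed

lemma lf_bicomp': "lf (\<not> b) p \<in> bicomp dg4 (bd b 0 1)"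
  using lf_bicomp[of "\<not> b" p] by (simp add: bd_not)

lemma prod_bicomp:
  assumes "\<And>q. q \<in> A \<Longrightarrow> F q \<in> bicomp dg4 (bd b (u q) (w q))"
  shows "prod F A \<in> bicomp dg4 (bd b (sum u A) (sum w A))"
  using assms
proof (induction A rule: infinite_finite_induct)
  case (insert q A)
  then have "F q * prod F A \<in> bicomp dg4 (bd b (u q) (w q) + bd b (sum u A) (sum w A))"
    by (intro bicomp_mult) auto
  then show ?case using insert.hyps by (simp add: bd_add)
qed (simp_all add: bicomp_def mdeg_def bd_def)

lemma lf_power_bicomp: "lf b p ^ n \<in> bicomp dg4 (bd b n 0)"
  using prod_bicomp[of "{..<n}" "\<lambda>_. lf b p" b "\<lambda>_. 1" "\<lambda>_. 0"] lf_bicomp[of b p] by simp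

lemma lf_power_bicomp': "lf (\<not> b) p ^ n \<in> bicomp dg4 (bd b 0 n)"
  using lf_power_bicomp[of "\<not> b" p n] by (simp add: bd_not)

section \<open>Fat point ideals\<close>

text \<open>The first argument of \<open>nu\<close> is a point of the factor selected by
  \<open>b\<close>. All pairs of points may be intersected over, since exponent 0 contributes
  \<open>UNIV\<close>.\<close>

definition fatI :: "bool \<Rightarrow> ('k::field option \<Rightarrow> 'k option \<Rightarrow> nat) \<Rightarrow> (var4, 'k) mpoly set" where
  "fatI b nu = {f. \<forall>p q. f \<in> pw (lf b p) (lf (\<not> b) q) (nu p q)}"

definition dec :: "'a \<Rightarrow> ('a \<Rightarrow> 'b \<Rightarrow> nat) \<Rightarrow> 'a \<Rightarrow> 'b \<Rightarrow> nat" where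
  "dec p nu = (\<lambda>p' q. if p' = p then nu p q - 1 else nu p' q)"

definition supported_on :: "'a set \<Rightarrow> 'b set \<Rightarrow> ('a \<Rightarrow> 'b \<Rightarrow> nat) \<Rightarrow> bool" where
  "supported_on S T nu \<longleftrightarrow> finite S \<and> finite T \<and> (\<forall>p q. 0 < nu p q \<longrightarrow> p \<in> S \<and> q \<in> T)"

lemma dec_le: "dec p nu p' q \<le> nu p' q"
  by (simp add: dec_def)

lemma supported_on_dec: "supported_on S T nu \<Longrightarrow> supported_on S T (dec p nu)"
  unfolding supported_on_def using dec_le[of p nu] by (meson order.strict_trans2)

lemma supported_on_swap: "supported_on S T nu \<Longrightarrow> supported_on T S (\<lambda>q p. nu p q)"
  unfolding supported_on_def by auto

text \<open>Induction on the total multiplicity. The hypothesis is offered for every line that meets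
  the support, so that an application may peel off a line of its choice, such as a maximal
  one.\<close>

lemma multiplicity_induct [consumes 1, case_names zero step]:
  assumes "supported_on S T nu"
    and zero: "\<And>nu. (\<And>p q. nu p q = 0) \<Longrightarrow> P nu"
    and step: "\<And>nu p q. supported_on S T nu \<Longrightarrow> 0 < nu p q \<Longrightarrow>
      (\<And>p q. 0 < nu p q \<Longrightarrow> P (dec p nu)) \<Longrightarrow> P nu"
  shows "P nu"
  using assms(1)
proof (induction "\<Sum>p\<in>S. \<Sum>q\<in>T. nu p q" arbitrary: nu rule: less_induct)
  case less
  show ?case
  proof (cases "\<forall>p q. nu p q = 0")
    case True
    then show ?thesis using zero by blast
  next
    case False
    then obtain p q where pq: "0 < nu p q" by auto
    have "P (dec p nu)" if "0 < nu p q" for p q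
    proof (rule less.hyps)
      have fin: "finite S" "finite T" "p \<in> S" "q \<in> T" using less.prems that unfolding supported_on_def by auto
      have "(\<Sum>q\<in>T. dec p nu p q) < (\<Sum>q\<in>T. nu p q)"
        using fin that dec_le[of p nu]
        by (intro sum_strict_mono_ex1) (auto simp: dec_def intro!: bexI[of _ q])
      then show "(\<Sum>p'\<in>S. \<Sum>q\<in>T. dec p nu p' q) < (\<Sum>p\<in>S. \<Sum>q\<in>T. nu p q)"
        using fin dec_le[of p nu] by (intro sum_strict_mono_ex1) (auto intro!: sum_mono bexI[of _ p])
      show "supported_on S T (dec p nu)" using less.prems by (rule supported_on_dec)
    qed
    then show ?thesis using step[OF less.prems pq] by blast
  qed
qed

lemma fatI_swap: "fatI (\<not> b) (\<lambda>q p. nu p q) = fatI b nu"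
  unfolding fatI_def by (auto simp: pw_commute)

lemma point_ideal_eq: "point_ideal P = ideal_gen {lf True (fst P), lf False (snd P)}"
  unfolding point_ideal_def lf_def lform_def by (simp add: split_def Let_def)

lemma fat_ideal_eq: "fat_ideal mu = fatI True (\<lambda>p q. mu (p, q))"
proof -
  have "fat_ideal mu = {f. \<forall>P\<in>supp mu. f \<in> pw (lf True (fst P)) (lf False (snd P)) (mu P)}"
    unfolding fat_ideal_def point_ideal_eq ideal_pow_eq_pw by blast
  moreover have "f \<in> pw (lf True p) (lf False q) (mu (p, q))"
    if "\<forall>P\<in>supp mu. f \<in> pw (lf True (fst P)) (lf False (snd P)) (mu P)" for f p q
    using bspec[OF that, of "(p, q)"] by (cases "mu (p, q) = 0") (auto simp: supp_def)
  ultimately show ?thesis unfolding fatI_def by auto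
qed

lemma is_ideal_fatI: "is_ideal (fatI b nu)"
proof -
  have "fatI b nu = {f. \<forall>P\<in>UNIV. f \<in> pw (lf b (fst P)) (lf (\<not> b) (snd P)) (nu (fst P) (snd P))}"
    unfolding fatI_def by auto
  also have "is_ideal \<dots>" by (rule is_ideal_Inter) (rule is_ideal_pw)
  finally show ?thesis .
qed

lemma hom_ideal_fatI: "hom_ideal dg4 (fatI b nu)"
  unfolding hom_ideal_def
proof (intro conjI ballI allI)
  fix f d assume f: "f \<in> fatI b nu"
  have "hom_ideal dg4 (pw (lf b p) (lf (\<not> b) q) (nu p q))" for p q
    using lf_bicomp[of b p] lf_bicomp[of "\<not> b" q] by (cases b) (auto simp: bd_def intro: hom_ideal_pw)
  then show "bpart dg4 d f \<in> fatI b nu" using f unfolding fatI_def hom_ideal_def by blast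
qed (rule is_ideal_fatI)

lemma lin_one: "lin b {p} {} = adj {0} (lf b p)"
  by (simp add: lin_insert1 lin_empty)

lemma nzd_lf_zero: "nzd (lf b p) {0}"
  using nzd_lf[of "{}" p b "{}"] by (simp add: lin_empty)

lemma nzd_lf_one: "nzd (lf (\<not> b) q) (lin b {p} {})"
  by (rule nzd_lf') auto

text \<open>The form of a different line avoids the prime of the point, and \<open>nzd_pw\<close>
  passes from the prime to its powers.\<close>

lemma nzd_lf_pw: "p' \<noteq> p \<Longrightarrow> nzd (lf b p') (pw (lf b p) (lf (\<not> b) q) m)"
  using nzd_lf_zero nzd_lf_one[of b q p] nzd_lf[of "{p}" p' b "{q}"]
  by (intro nzd_pw) (auto simp: lin_one[symmetric] lin_insert2[symmetric])

lemma nzd_lf_fatI: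
  assumes "\<And>q. nu p q = 0"
  shows "nzd (lf b p) (fatI b nu)"
  unfolding nzd_def
proof (intro allI impI)
  fix g assume g: "lf b p * g \<in> fatI b nu"
  have "g \<in> pw (lf b p') (lf (\<not> b) q) (nu p' q)" for p' q
  proof (cases "p' = p")
    case False
    have "lf b p * g \<in> pw (lf b p') (lf (\<not> b) q) (nu p' q)" using g unfolding fatI_def by blast
    then show ?thesis using nzdD[OF nzd_lf_pw] False by metis
  qed (simp add: assms)
  then show "g \<in> fatI b nu" unfolding fatI_def by blast
qed

text \<open>Taken point by point: on the line the exponent drops by \<open>pw_colon_a\<close>, off
  the line the form is regular.\<close>

lemma fatI_colon: "{g. lf b p * g \<in> fatI b nu} = fatI b (dec p nu)"
proof -
  have "lf b p * g \<in> pw (lf b p') (lf (\<not> b) q) (nu p' q) \<longleftrightarrow> g \<in> pw (lf b p') (lf (\<not> b) q) (dec p nu p' q)"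
    for g p' q
  proof (cases "p' = p")
    case True
    show ?thesis
    proof (cases "nu p q")
      case (Suc m)
      then show ?thesis using True pw_a_mult pw_colon_a[OF nzd_lf_zero, of "lf (\<not> b) q" b p g m]
          nzd_lf_one[of b q p] by (auto simp: dec_def lin_one simp del: pw.simps(2))
    qed (simp add: dec_def True)
  next
    case False
    then have "lf b p * g \<in> pw (lf b p') (lf (\<not> b) q) (nu p' q) \<longleftrightarrow> g \<in> pw (lf b p') (lf (\<not> b) q) (nu p' q)"
      using nzdD[OF nzd_lf_pw[of p p']] ideal_mult[OF is_ideal_pw] by metis
    then show ?thesis using False by (simp add: dec_def)
  qed
  then show ?thesis unfolding fatI_def by auto
qed

lemma nzd_lf_adj_power:
  "q \<noteq> q' \<Longrightarrow> nzd (lf (\<not> b) q) (adj (lin b S {}) (lf (\<not> b) q' ^ n))"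
  using nzd_lf'[of "{q'}" q b S] nzd_lf'[of "{}" q' b S]
  by (intro nzd_adj_power is_ideal_lin) (simp_all add: lin_insert2)

text \<open>Restriction to the line of \<open>p\<close>: each point gives one power of a form of the
  other ruling, and these powers are regular modulo each other, so their intersection is generated
  by the product.\<close>

lemma fatI_subset_adj:
  assumes "finite T"
  shows "fatI b nu \<subseteq> adj (lin b {p} {}) (\<Prod>q\<in>T. lf (\<not> b) q ^ nu p q)"
proof
  fix f assume "f \<in> fatI b nu"
  then have "f \<in> adj (lin b {p} {}) (lf (\<not> b) q ^ nu p q)" for q
    using pw_subset_adj unfolding fatI_def lin_one by blast
  then show "f \<in> adj (lin b {p} {}) (\<Prod>q\<in>T. lf (\<not> b) q ^ nu p q)"
    using assms by (intro inter_adj_prod is_ideal_lin nzd_power nzd_lf_adj_power) auto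
qed

text \<open>Lines of one ruling alone cover the scheme if each is taken at least as often as its
  largest multiplicity.\<close>

lemma prod_in_fatI:
  assumes "finite T" "\<And>p q. 0 < nu p q \<Longrightarrow> q \<in> T" "\<And>p q. q \<in> T \<Longrightarrow> nu p q \<le> w q"
  shows "(\<Prod>q\<in>T. lf (\<not> b) q ^ w q) \<in> fatI b nu"
proof -
  have "(\<Prod>q\<in>T. lf (\<not> b) q ^ w q) \<in> pw (lf b p) (lf (\<not> b) q) (nu p q)" for p q
  proof (cases "nu p q = 0")
    case False
    then have q: "q \<in> T" using assms(2) by blast
    have "lf (\<not> b) q ^ w q \<in> pw (lf b p) (lf (\<not> b) q) (nu p q)"
      using pw_b_power pw_antimono[OF assms(3)[OF q]] by blast
    then show ?thesis unfolding prod.remove[OF assms(1) q] by (rule ideal_mult'[OF is_ideal_pw])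
  qed simp
  then show ?thesis unfolding fatI_def by blast
qed

lemma fatI_zero: "(\<And>p q. nu p q = 0) \<Longrightarrow> fatI b nu = UNIV"
  unfolding fatI_def by simp

section \<open>Hilbert functions of fat points\<close>

lemma hilb_UNIV: "hilb dg4 UNIV d = 0"
  by (simp add: hilb_def)

lemma hilb_step:
  fixes J :: "(var4, 'k::field) mpoly set"
  assumes "hom_ideal dg4 J" "F \<in> bicomp dg4 (bd b m n)" "F \<noteq> 0"
  shows "hilb dg4 J (bd b (m + i) (n + j)) = hilb dg4 (adj J F) (bd b (m + i) (n + j)) + hilb dg4 {g. F * g \<in> J} (bd b i j)"
  using hilb_exact[OF assms fd_bicomp fd_bicomp, where d = "bd b i j"] by (simp add: bd_add)

lemma hilb_step_degenerate:
  fixes J :: "(var4, 'k::field) mpoly set"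
  assumes "hom_ideal dg4 J" "F \<in> bicomp dg4 (bd b m n)" "i < m \<or> j < n"
  shows "hilb dg4 J (bd b i j) = hilb dg4 (adj J F) (bd b i j)"
proof -
  have "bd b i j \<noteq> bd b m n + d" for d
    by (rule bd_cases[of d b]) (use assms(3) in \<open>auto simp: bd_add bd_inject\<close>)
  then show ?thesis using hilb_adj_degenerate[OF assms(1,2)] by simp
qed

text \<open>Modulo \<open>lf b p\<close> one variable of ruling \<open>b\<close> remains, so only
  the monomials of degree \<open>j\<close> in the other ruling are counted.\<close>

lemma hilb_lin_one:
  fixes p :: "'k::field option"
  shows "hilb dg4 (lin b {p} {}) (bd b i j) = j + 1"
proof -
  have z: "hilb dg4 {0 :: (var4, 'k) mpoly} (bd b i j) = (i + 1) * (j + 1)" for i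
    by (auto simp: bd_def hilb_zero)
  show ?thesis
  proof (cases i)
    case 0
    then show ?thesis
      using hilb_step_degenerate[OF hom_ideal_zero lf_bicomp[of b p], of 0 j] z[of 0] by (simp add: lin_one)
  next
    case (Suc k)
    have "{g. lf b p * g \<in> {0}} = {0}" using nzd_lf_zero[of b p] by (auto simp: nzd_def)
    then show ?thesis
      using hilb_step[OF hom_ideal_zero lf_bicomp[of b p] lf_nonzero, of k j] z[of k] z[of "Suc k"] Suc
      by (simp add: lin_one)
  qed
qed

lemma hom_ideal_lin_one: "hom_ideal dg4 (lin b {p} {})"
  unfolding lin_one by (rule hom_ideal_adj[OF hom_ideal_zero lf_bicomp])

lemma nzd_nonzero: "nzd F K \<Longrightarrow> is_ideal K \<Longrightarrow> K \<noteq> UNIV \<Longrightarrow> F \<noteq> 0"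
  by (metis UNIV_eq_I ideal_zero mult_zero_left nzd_def)

lemma colon_nzd: "nzd F K \<Longrightarrow> is_ideal K \<Longrightarrow> {g. F * g \<in> K} = K"
  unfolding nzd_def using ideal_mult by blast

lemma lin_proper: "lin b S T \<noteq> UNIV"
  using prime_lin unfolding prime_ideal_def by blast

text \<open>Below degree \<open>n\<close> the form \<open>F\<close> contributes nothing; from
  \<open>n\<close> on the value is (j + 1) - (j - n + 1). The degree \<open>i\<close> does not
  enter.\<close>

lemma hilb_adj_lin:
  assumes F: "F \<in> bicomp dg4 (bd b 0 n)" "nzd F (lin b {p} {})"
  shows "hilb dg4 (adj (lin b {p} {}) F) (bd b i j) = min (j + 1) n"
proof (cases "j < n")
  case True
  then show ?thesis
    using hilb_step_degenerate[OF hom_ideal_lin_one[of b p] F(1), of i j] hilb_lin_one[of b p i j] by simp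
next
  case False
  then obtain k where k: "j = n + k" using le_Suc_ex by (metis not_less)
  show ?thesis
    using hilb_step[OF hom_ideal_lin_one[of b p] F(1) nzd_nonzero[OF F(2) is_ideal_lin lin_proper], of i k]
      hilb_lin_one[of b p i j] hilb_lin_one[of b p i k] colon_nzd[OF F(2) is_ideal_lin] k by simp
qed

lemma hilb_peel:
  "hilb dg4 (fatI b nu) (bd b (Suc i) j) =
     hilb dg4 (adj (fatI b nu) (lf b p)) (bd b (Suc i) j) + hilb dg4 (fatI b (dec p nu)) (bd b i j)"
  using hilb_step[OF hom_ideal_fatI[of b nu] lf_bicomp[of b p] lf_nonzero, of i j]
  by (simp add: fatI_colon)

lemma hilb_peel_0:
  "hilb dg4 (fatI b nu) (bd b 0 j) = hilb dg4 (adj (fatI b nu) (lf b p)) (bd b 0 j)"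
  by (rule hilb_step_degenerate[OF hom_ideal_fatI lf_bicomp]) simp

lemma prod_lf_bicomp: "(\<Prod>q\<in>T. lf (\<not> b) q ^ w q) \<in> bicomp dg4 (bd b 0 (\<Sum>q\<in>T. w q))"
  using prod_bicomp[of T "\<lambda>q. lf (\<not> b) q ^ w q" b "\<lambda>_. 0" w, OF lf_power_bicomp'] by simp

lemma nzd_prod_lf: "nzd (\<Prod>q\<in>T. lf (\<not> b) q ^ w q) (lin b {p} {})"
  by (intro nzd_prod nzd_power nzd_lf_one)

text \<open>Each peeled line adds at most the Hilbert function of a complete intersection contained
  in I + (l), which is bounded.\<close>

lemma hilb_fatI_bounded:
  assumes "supported_on S T nu"
  shows "\<exists>C. \<forall>d. hilb dg4 (fatI b nu) d \<le> C"
  using assms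
proof (induction rule: multiplicity_induct)
  case (zero nu)
  then show ?case by (simp add: fatI_zero hilb_UNIV)
next
  case (step nu p q)
  obtain C where C: "\<And>d. hilb dg4 (fatI b (dec p nu)) d \<le> C" using step.IH[OF step.hyps(2)] by blast
  have fin: "finite S" "finite T" using step.hyps(1) unfolding supported_on_def by auto
  \<comment> \<open>Column sums bound all multiplicities of a column, so the product of lines with
    these exponents lies in the ideal whichever row is peeled.\<close>
  define w where "w q = (\<Sum>p\<in>S. nu p q)" for q
  have le: "nu p q \<le> w q" for p q
    using member_le_sum[of p S "\<lambda>p. nu p q"] fin step.hyps(1) unfolding w_def supported_on_def
    by (cases "nu p q = 0") auto
  let ?F = "\<Prod>q\<in>T. lf (\<not> b) q ^ w q"
  have "?F \<in> fatI b nu" using step.hyps(1) fin le unfolding supported_on_def by (intro prod_in_fatI) auto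
  then have sub: "adj (lin b {p} {}) ?F \<subseteq> adj (fatI b nu) (lf b p)"
    unfolding lin_one
    by (intro adj_least is_ideal_adj is_ideal_fatI adj_gen)
      (auto intro: adj_base ideal_zero[OF is_ideal_fatI] is_ideal_fatI)
  have le2: "hilb dg4 (adj (fatI b nu) (lf b p)) (bd b i j) \<le> (\<Sum>q\<in>T. w q)" for i j
  proof -
    have "hilb dg4 (adj (fatI b nu) (lf b p)) (bd b i j) \<le> hilb dg4 (adj (lin b {p} {}) ?F) (bd b i j)"
      by (rule hilb_antimono[OF sub])
    also have "\<dots> = min (j + 1) (\<Sum>q\<in>T. w q)" by (rule hilb_adj_lin[OF prod_lf_bicomp nzd_prod_lf])
    finally show ?thesis by simp
  qed
  have "hilb dg4 (fatI b nu) (bd b i j) \<le> (\<Sum>q\<in>T. w q) + C" for i j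
  proof (cases i)
    case 0
    then show ?thesis using hilb_peel_0[of b nu j p] le2[of 0 j] by simp
  next
    case (Suc k)
    then show ?thesis using hilb_peel[of b nu k j p] le2[of i j] C[of "bd b k j"] by simp
  qed
  then show ?case by (metis bd_cases)
qed

section \<open>Hilbert functions in large degree along one ruling\<close>

lemma vars_in_ideal:
  assumes "is_ideal K" "lf b p \<in> K" "lf b p' \<in> K" "p \<noteq> p'"
  shows "mvar (if b then X0 else Y0) \<in> K" "mvar (if b then X1 else Y1) \<in> K"
  using coords_in_ideal[OF assms(1), of _ _ p p'] assms(2-) unfolding lf_def by blast+

lemma single_factor:
  assumes "0 < Poly_Mapping.lookup m v"
  shows "Poly_Mapping.single m c = mvar v * Poly_Mapping.single (m - Poly_Mapping.single v 1) c"
proof -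
  have "m = Poly_Mapping.single v 1 + (m - Poly_Mapping.single v 1)"
    using assms by (intro poly_mapping_eqI) (auto simp: lookup_add minus_poly_mapping.rep_eq lookup_single when_def)
  then show ?thesis unfolding mvar_def mult_single by simp
qed

lemma bicomp_in_ideal:
  assumes K: "is_ideal K" "lf b p \<in> K" "lf b p' \<in> K" "p \<noteq> p'" and s: "s \<in> bicomp dg4 (bd b i j)" and i: "0 < i"
  shows "s \<in> K"
proof -
  have "Poly_Mapping.single m c \<in> K" if "mdeg dg4 m = bd b i j" for m c
  proof -
    have "0 < Poly_Mapping.lookup m (if b then X0 else Y0) \<or> 0 < Poly_Mapping.lookup m (if b then X1 else Y1)"
      using that i by (auto simp: mdeg_dg4 bd_def split: if_splits)
    then show ?thesis
    proof
      assume "0 < Poly_Mapping.lookup m (if b then X0 else Y0)"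
      from single_factor[OF this, of c] show ?thesis
        using ideal_mult'[OF K(1) vars_in_ideal(1)[OF K]] by simp
    next
      assume "0 < Poly_Mapping.lookup m (if b then X1 else Y1)"
      from single_factor[OF this, of c] show ?thesis
        using ideal_mult'[OF K(1) vars_in_ideal(2)[OF K]] by simp
    qed
  qed
  then have "(\<Sum>m\<in>Poly_Mapping.keys s. Poly_Mapping.single m (Poly_Mapping.lookup s m)) \<in> K"
    using s unfolding bicomp_def by (intro ideal_sum[OF K(1)]) auto
  then show ?thesis by (simp only: sum_singles[symmetric])
qed

text \<open>Modulo the line of \<open>p\<close>, the form \<open>G\<close> divides everything of
  degree at least \<open>g\<close> in ruling \<open>b\<close>. The reason is that one variable of
  that ruling remains there, and \<open>G\<close> will be a product of forms of other lines.\<close>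

definition covers :: "bool \<Rightarrow> 'k::field option \<Rightarrow> (var4, 'k) mpoly \<Rightarrow> nat \<Rightarrow> bool" where
  "covers b p G g \<longleftrightarrow> (\<forall>i j s. g \<le> i \<longrightarrow> s \<in> bicomp dg4 (bd b i j) \<longrightarrow>
     (\<exists>u v. s = lf b p * u + G * v \<and> v \<in> bicomp dg4 (bd b (i - g) j)))"

lemma covers_one: "covers b p 1 0"
  unfolding covers_def by (metis add_0 diff_zero mult_1 mult_zero_right)

lemma covers_mult:
  fixes G :: "(var4, 'k::field) mpoly"
  assumes "covers b p G g" "covers b p G' g'"
  shows "covers b p (G * G') (g + g')"
  unfolding covers_def
proof (intro allI impI)
  fix i j and s :: "(var4, 'k) mpoly" assume i: "g + g' \<le> i" and s: "s \<in> bicomp dg4 (bd b i j)"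
  then obtain u v where 1: "s = lf b p * u + G * v" "v \<in> bicomp dg4 (bd b (i - g) j)"
    using assms(1) unfolding covers_def by (meson add_leD1)
  have "g' \<le> i - g" using i by simp
  then obtain u' v' where 2: "v = lf b p * u' + G' * v'" "v' \<in> bicomp dg4 (bd b (i - g - g') j)"
    using assms(2) 1(2) unfolding covers_def by blast
  have "s = lf b p * (u + G * u') + G * G' * v'" unfolding 1(1) 2(1) by (simp add: algebra_simps)
  then show "\<exists>u v. s = lf b p * u + G * G' * v \<and> v \<in> bicomp dg4 (bd b (i - (g + g')) j)"
    using 2(2) by (auto simp: diff_diff_eq)
qed

lemma covers_lf:
  fixes p :: "'k::field option"
  assumes "p' \<noteq> p"
  shows "covers b p (lf b p') 1"
  unfolding covers_def
proof (intro allI impI)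
  fix i j and s :: "(var4, 'k) mpoly" assume i: "1 \<le> i" and s: "s \<in> bicomp dg4 (bd b i j)"
  let ?K = "adj (adj {0} (lf b p)) (lf b p')"
  have "s \<in> ?K"
    using i assms by (intro bicomp_in_ideal[OF _ _ _ _ s, of ?K p p'] is_ideal_adj is_ideal_zero adj_gen adj_base) auto
  then obtain u v where uv: "s = lf b p * u + lf b p' * v" unfolding adj_def by auto
  have e: "bd b i j = bd b 1 0 + bd b (i - 1) j" using i by (simp add: bd_add)
  have "s = bpart dg4 (bd b i j) s" using s by (simp add: bpart_bicomp)
  also have "\<dots> = lf b p * bpart dg4 (bd b (i - 1) j) u + lf b p' * bpart dg4 (bd b (i - 1) j) v"
    unfolding uv bpart_add e by (simp only: bpart_mult[OF lf_bicomp])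
  finally show "\<exists>u v. s = lf b p * u + lf b p' * v \<and> v \<in> bicomp dg4 (bd b (i - 1) j)"
    using bpart_in_bicomp by blast
qed

lemma covers_power: "p' \<noteq> p \<Longrightarrow> covers b p (lf b p' ^ n) n"
proof (induction n)
  case (Suc n)
  then show ?case using covers_mult[OF covers_lf[OF Suc.prems]] by simp
qed (simp add: covers_one)

lemma covers_prod: "p \<notin> A \<Longrightarrow> covers b p (\<Prod>p'\<in>A. lf b p' ^ w p') (\<Sum>p'\<in>A. w p')"
proof (induction A rule: infinite_finite_induct)
  case (insert x A)
  then show ?case using covers_mult[OF covers_power[of x p b "w x"] insert.IH] by auto
qed (simp_all add: covers_one)

text \<open>I + (l) lies in (l, F), where \<open>F\<close> describes the scheme on the line of
  \<open>p\<close>. Conversely \<open>F * G\<close> lies in I if \<open>G\<close> passes through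
  everything off that line; in degree at least \<open>g\<close> any cofactor of \<open>F\<close> is
  a multiple of \<open>G\<close> modulo l, so both ideals agree there.\<close>

lemma hilb_adj_fatI_eventually:
  assumes nu: "supported_on S T nu"
  shows "\<exists>i0. \<forall>i\<ge>i0. \<forall>j. hilb dg4 (adj (fatI b nu) (lf b p)) (bd b i j) = min (j + 1) (\<Sum>q\<in>T. nu p q)"
proof -
  have fin: "finite S" "finite T" using nu unfolding supported_on_def by auto
  define w where "w p = (\<Sum>q\<in>T. nu p q)" for p
  have le: "nu p q \<le> w p" for p q
    using member_le_sum[of q T "nu p"] fin nu unfolding w_def supported_on_def
    by (cases "nu p q = 0") auto
  define G where "G = (\<Prod>p'\<in>S - {p}. lf b p' ^ w p')"
  define g where "g = (\<Sum>p'\<in>S - {p}. w p')"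
  define F where "F = (\<Prod>q\<in>T. lf (\<not> b) q ^ nu p q)"
  have F: "F \<in> bicomp dg4 (bd b 0 (w p))" unfolding F_def w_def by (rule prod_lf_bicomp)
  have nF: "nzd F (lin b {p} {})" unfolding F_def by (rule nzd_prod_lf)
  have cov: "covers b p G g" unfolding G_def g_def by (rule covers_prod) simp
  have FG: "F * G \<in> fatI b nu"
  proof -
    have "G \<in> fatI b (\<lambda>p' q. if p' = p then 0 else nu p' q)"
      using prod_in_fatI[of "S - {p}" "\<lambda>q p'. if p' = p then 0 else nu p' q" w "\<not> b"] fin le nu
        fatI_swap[of b "\<lambda>p' q. if p' = p then 0 else nu p' q"]
      unfolding G_def supported_on_def by (auto split: if_splits)
    moreover have "F \<in> fatI b (\<lambda>p' q. if p' = p then nu p q else 0)"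
      using nu fin unfolding F_def supported_on_def
      by (intro prod_in_fatI) (auto split: if_splits)
    ultimately have "G \<in> pw (lf b p') (lf (\<not> b) q) (if p' = p then 0 else nu p' q)"
      "F \<in> pw (lf b p') (lf (\<not> b) q) (if p' = p then nu p q else 0)" for p' q
      unfolding fatI_def by blast+
    note FG = this
    have "F * G \<in> pw (lf b p') (lf (\<not> b) q) (nu p' q)" for p' q
    proof (cases "p' = p")
      case True
      then show ?thesis using FG(2)[of p' q] by (simp add: ideal_mult'[OF is_ideal_pw])
    next
      case False
      then show ?thesis using FG(1)[of p' q] by (simp add: ideal_mult[OF is_ideal_pw])
    qed
    then show ?thesis unfolding fatI_def by blast
  qed
  let ?I = "adj (fatI b nu) (lf b p)" and ?J = "adj (lin b {p} {}) F"
  have lin: "lin b {p} {} \<subseteq> ?I"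
    unfolding lin_one using ideal_zero[OF is_ideal_fatI] by (intro adj_mono) auto
  have IJ: "?I \<subseteq> ?J"
    using fatI_subset_adj[OF fin(2), of b nu p] unfolding F_def
    by (intro adj_least is_ideal_adj is_ideal_lin) (auto intro!: adj_base adj_gen simp: lin_one is_ideal_zero)
  have JI: "?J \<inter> bicomp dg4 (bd b i j) \<subseteq> ?I" if "g \<le> i" for i j
  proof (cases "j < w p")
    case True
    have "bd b i j \<noteq> bd b 0 (w p) + d" for d
      by (rule bd_cases[of d b]) (use True in \<open>auto simp: bd_add bd_inject\<close>)
    from adj_inter_degenerate[OF hom_ideal_lin_one F this] show ?thesis using lin by blast
  next
    case False
    then obtain k where k: "j = w p + k" using le_Suc_ex by (metis not_less)
    have "?J \<inter> bicomp dg4 (bd b i j) = mp.ssum (lin b {p} {} \<inter> bicomp dg4 (bd b i j)) ((*) F ` bicomp dg4 (bd b i k))"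
      using adj_inter_bicomp[OF hom_ideal_lin_one[of b p] F, of "bd b i k"] k by (simp add: bd_add)
    also have "\<dots> \<subseteq> ?I"
    proof
      fix f assume "f \<in> mp.ssum (lin b {p} {} \<inter> bicomp dg4 (bd b i j)) ((*) F ` bicomp dg4 (bd b i k))"
      then obtain l s where ls: "f = l + F * s" "l \<in> lin b {p} {}" "s \<in> bicomp dg4 (bd b i k)"
        unfolding mp.ssum_def by blast
      obtain u v where "s = lf b p * u + G * v" using cov \<open>g \<le> i\<close> ls(3) unfolding covers_def by blast
      then have "F * s = (F * G) * v + lf b p * (F * u)" by (simp add: algebra_simps)
      then have "F * s \<in> ?I" using ideal_mult'[OF is_ideal_fatI FG] by (intro adjI)
      then show "f \<in> ?I" using ls(1,2) lin ideal_add[OF is_ideal_adj[OF is_ideal_fatI]] by blast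
    qed
    finally show ?thesis .
  qed
  have "hilb dg4 ?I (bd b i j) = min (j + 1) (w p)" if "g \<le> i" for i j
  proof -
    have "?I \<inter> bicomp dg4 (bd b i j) = ?J \<inter> bicomp dg4 (bd b i j)" using IJ JI[OF that] by blast
    then show ?thesis using hilb_cong hilb_adj_lin[OF F nF] by metis
  qed
  then show ?thesis unfolding w_def by blast
qed

text \<open>Peeling a line contributes one part of the partition, and lowering its multiplicities
  moves the index \<open>k\<close> on by one.\<close>

theorem hilb_fatI_eventually:
  assumes "supported_on S T nu" "\<And>p q. nu p q \<le> N"
  shows "\<exists>i0. \<forall>i\<ge>i0. \<forall>j. hilb dg4 (fatI b nu) (bd b i j) =
    (\<Sum>p\<in>S. \<Sum>k<N. min (j + 1) (\<Sum>q\<in>T. nu p q - k))"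
  using assms
proof (induction rule: multiplicity_induct)
  case (zero nu)
  then show ?case by (simp add: fatI_zero hilb_UNIV)
next
  case (step nu p q)
  have fin: "finite S" "finite T" "p \<in> S" using step.hyps unfolding supported_on_def by auto
  have "dec p nu p' q' \<le> N" for p' q' using step.prems[of p' q'] step.prems[of p q'] by (auto simp: dec_def)
  then obtain i0 where i0: "\<And>i j. i0 \<le> i \<Longrightarrow> hilb dg4 (fatI b (dec p nu)) (bd b i j) =
    (\<Sum>p'\<in>S. \<Sum>k<N. min (j + 1) (\<Sum>q\<in>T. dec p nu p' q - k))"
    using step.IH[OF step.hyps(2)] by blast
  obtain i1 where i1: "\<And>i j. i1 \<le> i \<Longrightarrow>
      hilb dg4 (adj (fatI b nu) (lf b p)) (bd b i j) = min (j + 1) (\<Sum>q\<in>T. nu p q)"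
    using hilb_adj_fatI_eventually[OF step.hyps(1)] by blast
  have "hilb dg4 (fatI b nu) (bd b i j) = (\<Sum>p\<in>S. \<Sum>k<N. min (j + 1) (\<Sum>q\<in>T. nu p q - k))"
    if i: "Suc (max i0 i1) \<le> i" for i j
  proof -
    \<comment> \<open>Peeling costs one degree, so the predecessor of \<open>i\<close> must still
      reach the threshold \<open>i0\<close>.\<close>
    obtain i' where i': "i = Suc i'" "i0 \<le> i'" "i1 \<le> i" using i by (cases i) auto
    define f where "f k = min (j + 1) (\<Sum>q\<in>T. nu p q - k)" for k
    \<comment> \<open>The shift brings in the term with index \<open>N\<close>, which vanishes
      because \<open>N\<close> bounds all multiplicities.\<close>
    have "f N = 0" unfolding f_def using step.prems by simp
    then have "(\<Sum>k<N. f k) = f 0 + (\<Sum>k<N. f (Suc k))"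
      using sum.lessThan_Suc_shift[of f N] by simp
    then have "(\<Sum>k<N. min (j + 1) (\<Sum>q\<in>T. nu p q - k))
        = min (j + 1) (\<Sum>q\<in>T. nu p q) + (\<Sum>k<N. min (j + 1) (\<Sum>q\<in>T. dec p nu p q - k))"
      by (simp add: f_def dec_def)
    moreover have "(\<Sum>p'\<in>S - {p}. \<Sum>k<N. min (j + 1) (\<Sum>q\<in>T. dec p nu p' q - k))
        = (\<Sum>p'\<in>S - {p}. \<Sum>k<N. min (j + 1) (\<Sum>q\<in>T. nu p' q - k))"
      by (rule sum.cong) (auto simp: dec_def)
    ultimately have "(\<Sum>p\<in>S. \<Sum>k<N. min (j + 1) (\<Sum>q\<in>T. nu p q - k)) = min (j + 1) (\<Sum>q\<in>T. nu p q)
        + (\<Sum>p'\<in>S. \<Sum>k<N. min (j + 1) (\<Sum>q\<in>T. dec p nu p' q - k))"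
      using fin by (simp add: sum.remove[of S p])
    then show ?thesis using hilb_peel[of b nu i' j p] i0[OF i'(2)] i1[OF i'(3)] i'(1) by simp
  qed
  then show ?case by blast
qed

section \<open>Regular sequences from totally ordered multiplicities\<close>

definition chain_rows :: "('a \<Rightarrow> 'b \<Rightarrow> nat) \<Rightarrow> bool" where
  "chain_rows nu \<longleftrightarrow> (\<forall>p p' h h'. (\<forall>q. nu p q - h \<le> nu p' q - h') \<or> (\<forall>q. nu p' q - h' \<le> nu p q - h))"

text \<open>Lowering a row by one only shifts its parameter \<open>h\<close>, and the condition
  ranges over all \<open>h\<close>.\<close>

lemma chain_rows_dec: "chain_rows nu \<Longrightarrow> chain_rows (dec p0 nu)"
proof -
  assume c: "chain_rows nu"
  have "dec p0 nu p q - h = nu p q - (if p = p0 then Suc h else h)" for p q h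
    by (simp add: dec_def)
  then show ?thesis using c unfolding chain_rows_def by presburger
qed

text \<open>A row of largest sum dominates all others: a row exceeding it somewhere would be
  comparable to it, hence larger everywhere, with a larger sum.\<close>

lemma chain_rows_max:
  assumes c: "chain_rows nu" and nu: "supported_on S T nu" and ne: "0 < nu p0 q0"
  obtains p q where "0 < nu p q" "\<And>p' q. nu p' q \<le> nu p q"
proof -
  have fin: "finite S" "finite T" "p0 \<in> S" using nu ne unfolding supported_on_def by auto
  let ?s = "\<lambda>p. \<Sum>q\<in>T. nu p q"
  have "Max (?s ` S) \<in> ?s ` S" using fin by (intro Max_in) auto
  then obtain p where p: "p \<in> S" "?s p = Max (?s ` S)" by auto
  have mx: "?s p' \<le> ?s p" if "p' \<in> S" for p' using that fin p(2) by simp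
  have le: "nu p' q \<le> nu p q" for p' q
  proof (rule ccontr)
    assume n: "\<not> nu p' q \<le> nu p q"
    then have "0 < nu p' q" by simp
    then have pq: "p' \<in> S" "q \<in> T" using nu unfolding supported_on_def by auto
    have "\<forall>q. nu p q \<le> nu p' q" using c n unfolding chain_rows_def by (metis diff_zero)
    then have "?s p < ?s p'" using fin n pq by (intro sum_strict_mono_ex1) (auto intro!: bexI[of _ q])
    then show False using mx[OF pq(1)] by simp
  qed
  have "0 < nu p q0" using le[of p0 q0] ne by simp
  then show ?thesis using that le by blast
qed

lemma nzd_lf_adj_power_one:
  "r \<noteq> p \<Longrightarrow> nzd (lf b r) (adj (lin b {p} {}) (lf (\<not> b) q ^ n))"
  using nzd_lf[of "{p}" r b "{q}"] nzd_lf_one[of b q p]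
  by (intro nzd_adj_power is_ideal_lin) (simp_all add: lin_insert2)

theorem chain_rows_regular:
  assumes "supported_on S T nu" "chain_rows nu" "\<And>q. nu r q = 0" "\<And>p. nu p t = 0"
  shows "nzd (lf (\<not> b) t) (adj (fatI b nu) (lf b r))"
  using assms
proof (induction rule: multiplicity_induct)
  case (zero nu)
  then show ?case by (simp add: fatI_zero nzd_def adj_base)
next
  case (step nu p0 q0)
  obtain p q where p: "0 < nu p q" "\<And>p' q. nu p' q \<le> nu p q"
    using chain_rows_max[OF step.prems(1) step.hyps] by blast
  have fin: "finite T" using step.hyps unfolding supported_on_def by auto
  have pr: "r \<noteq> p" using p step.prems by auto
  define F where "F = (\<Prod>q\<in>T. lf (\<not> b) q ^ nu p q)"
  \<comment> \<open>The row of \<open>p\<close> dominates every other row, so the exponents of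
    \<open>F\<close> suffice for all points; this is the only use of maximality.\<close>
  have "F \<in> fatI b nu"
    using step.hyps(1) p fin unfolding F_def supported_on_def by (intro prod_in_fatI) auto
  then have "adj (lin b {p} {}) F \<subseteq> adj (fatI b nu) (lf b p)"
    unfolding lin_one
    by (intro adj_least is_ideal_adj is_ideal_fatI adj_gen)
      (auto intro: adj_base ideal_zero[OF is_ideal_fatI] is_ideal_fatI)
  moreover have "adj (fatI b nu) (lf b p) \<subseteq> adj (lin b {p} {}) F"
    using fatI_subset_adj[OF fin, of b nu p] unfolding F_def
    by (intro adj_least is_ideal_adj is_ideal_lin) (auto intro!: adj_base adj_gen simp: lin_one is_ideal_zero)
  ultimately have eq: "adj (fatI b nu) (lf b p) = adj (lin b {p} {}) F" by blast
  show ?case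
  proof (rule regular_pair_extension[OF is_ideal_fatI])
    show "nzd (lf (\<not> b) t) (adj {g. lf b p * g \<in> fatI b nu} (lf b r))"
      unfolding fatI_colon using step.prems by (intro step.IH[OF p(1)] chain_rows_dec) (auto simp: dec_def)
    show "nzd (lf b r) (adj (fatI b nu) (lf b p))"
      unfolding eq F_def using pr
      by (intro nzd_adj_prod is_ideal_lin nzd_power nzd_lf_one nzd_lf_adj_power_one)
    have "adj (adj (fatI b nu) (lf b p)) (lf b r) = adj (lin b {r, p} {}) F"
      unfolding eq adj_commute[OF is_ideal_lin, of b "{p}" "{}" F] lin_insert1[of b r "{p}"] ..
    moreover have "nzd (lf (\<not> b) t) (adj (lin b {r, p} {}) F)"
      unfolding F_def
    proof (intro nzd_adj_prod is_ideal_lin nzd_power)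
      fix q assume "q \<in> T"
      show "nzd (lf (\<not> b) q) (lin b {r, p} {})" by (rule nzd_lf') auto
      show "nzd (lf (\<not> b) t) (adj (lin b {r, p} {}) (lf (\<not> b) q ^ nu p q))"
      \<comment> \<open>\<open>T\<close> may contain \<open>t\<close>; a point with positive
        multiplicity differs from \<open>t\<close>, and exponent 0 gives the unit ideal.\<close>
      proof (cases "nu p q = 0")
        case True
        then show ?thesis by (simp add: adj_one is_ideal_lin nzd_def)
      next
        case False
        then show ?thesis using step.prems(3)[of p] by (intro nzd_lf_adj_power) auto
      qed
    qed
    ultimately show "nzd (lf (\<not> b) t) (adj (adj (fatI b nu) (lf b p)) (lf b r))" by simp
  qed
qed

section \<open>Dimension and depth via growth of Hilbert functions\<close>

definition tdeg :: "(var4 \<Rightarrow>\<^sub>0 nat) \<Rightarrow> nat" where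
  "tdeg m = fst (mdeg dg4 m) + snd (mdeg dg4 m)"

definition filt :: "nat \<Rightarrow> (var4, 'k::field) mpoly set" where
  "filt d = supported {m. tdeg m \<le> d}"

definition growth :: "nat \<Rightarrow> (var4, 'k::field) mpoly set \<Rightarrow> bool" where
  "growth s J \<longleftrightarrow> (\<exists>C. \<forall>d. mp.cod J (filt d) \<le> C * (d + 1) ^ s)"

lemma tdeg_add: "tdeg (m + n) = tdeg m + tdeg n"
  unfolding tdeg_def mdeg_add by simp

lemma tdeg_le_eq: "{m. tdeg m \<le> d} = {m. mdeg dg4 m \<in> {(i, j). i + j \<le> d}}"
  unfolding tdeg_def by (auto simp: split_def)

lemma finite_triangle: "finite {(i, j). i + j \<le> (d::nat)}"
  and card_triangle: "card {(i, j). i + j \<le> (d::nat)} \<le> (d + 1) ^ 2"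
proof -
  have s: "{(i, j). i + j \<le> d} \<subseteq> {..d} \<times> {..d}" by auto
  then show "finite {(i, j). i + j \<le> d}" by (rule finite_subset) auto
  have "card {(i, j). i + j \<le> d} \<le> card ({..d} \<times> {..d})" using s by (intro card_mono) auto
  then show "card {(i, j). i + j \<le> d} \<le> (d + 1) ^ 2"
    by (simp add: card_cartesian_product power2_eq_square)
qed

lemma finite_monomials_in: "finite E \<Longrightarrow> finite {m. mdeg dg4 m \<in> E}"
proof -
  assume "finite E"
  moreover have "{m. mdeg dg4 m \<in> E} = (\<Union>e\<in>E. {m. mdeg dg4 m = e})" by auto
  ultimately show ?thesis by (simp only: finite_UN finite_monomials_bidegree) simp
qed

lemma fd_filt: "mp.fd (filt d)"
  unfolding filt_def tdeg_le_eq by (intro fd_supported finite_monomials_in finite_triangle)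

lemma subspace_filt: "mp.subspace (filt d)"
  unfolding filt_def by (rule subspace_supported)

lemma filt_mono: "d \<le> e \<Longrightarrow> filt d \<subseteq> filt e"
  unfolding filt_def supported_def by auto

lemma filt_mult: "f \<in> filt e \<Longrightarrow> g \<in> filt d \<Longrightarrow> f * g \<in> filt (e + d)"
  using keys_mult[of f g] unfolding filt_def supported_def by (fastforce simp: tdeg_add)

lemma filt_exhaustive: obtains e where "f \<in> filt e"
proof -
  have "f \<in> filt (Max (insert 0 (tdeg ` Poly_Mapping.keys f)))"
    unfolding filt_def supported_def by auto
  then show ?thesis using that by blast
qed

lemma growth_antimono: "growth s J \<Longrightarrow> J \<subseteq> K \<Longrightarrow> growth s K"
  unfolding growth_def using mp.cod_antimono[OF fd_filt] by (meson order_trans)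

lemma cod_filt_mono: "is_ideal J \<Longrightarrow> d \<le> e \<Longrightarrow> mp.cod J (filt d) \<le> mp.cod J (filt e)"
  by (intro mp.cod_mono fd_filt subspace_filt subspace_ideal filt_mono)

text \<open>Common form of a strict inclusion of primes, where any new element is regular modulo the
  smaller prime, and of a step in a regular sequence. Dimension and depth are bounded by one
  argument.\<close>

definition reg_step :: "'a::comm_ring_1 set \<Rightarrow> 'a set \<Rightarrow> bool" where
  "reg_step J J' \<longleftrightarrow> is_ideal J \<and> is_ideal J' \<and> J \<subseteq> J' \<and> (\<exists>f\<in>J'. nzd f J)"

lemma cod_filt_step:
  fixes J :: "(var4, 'k::field) mpoly set"
  assumes J: "is_ideal J" "J \<noteq> UNIV" "nzd f J" and J': "is_ideal J'" "J \<subseteq> J'" "f \<in> J'" and f: "f \<in> filt e"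
  shows "mp.cod J' (filt (e + d)) + mp.cod J (filt d) \<le> mp.cod J (filt (e + d))"
proof -
  have f0: "f \<noteq> 0" using nzd_nonzero J by blast
  have im: "(*) f ` filt d \<subseteq> filt (e + d)" using filt_mult[OF f] by blast
  let ?S = "mp.ssum (J \<inter> filt (e + d)) ((*) f ` filt d)"
  have "mp.cod J (filt (e + d)) = (mp.dim (filt (e + d) :: (var4, 'k) mpoly set) - mp.dim ?S)
      + mp.cod {u. f * u \<in> J} (filt d)"
    by (intro mp.cod_exact module_hom_mult inj_mult f0 fd_filt subspace_filt subspace_ideal J im)
  moreover have "?S \<subseteq> J' \<inter> filt (e + d)"
    using im J' mp.subspace_add[OF subspace_filt] ideal_add[OF J'(1)] ideal_mult'[OF J'(1,3)]
    unfolding mp.ssum_def by blast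
  then have "mp.dim ?S \<le> mp.dim (J' \<inter> filt (e + d))"
    by (rule mp.dim_le_fd[OF mp.fd_subset[OF fd_filt Int_lower2]])
  ultimately show ?thesis using colon_nzd[OF J(3,1)] by (simp add: mp.cod_def)
qed

text \<open>Iterating \<open>cod_filt_step\<close> stacks \<open>n\<close> copies of the smaller
  quotient, each shifted by the degree \<open>e\<close> of the regular element.\<close>

lemma cod_filt_iterate:
  fixes J :: "(var4, 'k::field) mpoly set"
  assumes "reg_step J J'" "J' \<noteq> UNIV"
  obtains e where "\<And>n d. n * mp.cod J' (filt d) \<le> mp.cod J (filt (d + n * e))"
proof -
  obtain f where f: "f \<in> J'" "nzd f J" using assms(1) unfolding reg_step_def by blast
  obtain e where e: "f \<in> filt e" by (rule filt_exhaustive)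
  have J: "is_ideal J" "is_ideal J'" "J \<subseteq> J'" "J \<noteq> UNIV" using assms unfolding reg_step_def by auto
  have "n * mp.cod J' (filt d) \<le> mp.cod J (filt (d + n * e))" for n d
  proof (induction n)
    case (Suc n)
    have "mp.cod J' (filt d) \<le> mp.cod J' (filt (e + (d + n * e)))" using J(2) by (rule cod_filt_mono) simp
    then show ?case
      using Suc cod_filt_step[OF J(1,4) f(2) J(2,3) f(1) e, of "d + n * e"] by (simp add: algebra_simps)
  qed simp
  then show ?thesis using that by blast
qed

lemma growth_drop:
  fixes J :: "(var4, 'k::field) mpoly set"
  assumes "reg_step J J'" "J' \<noteq> UNIV" "growth (Suc s) J"
  shows "growth s J'"
proof -
  obtain e where e: "\<And>n d. n * mp.cod J' (filt d) \<le> mp.cod J (filt (d + n * e))"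
    using cod_filt_iterate[OF assms(1,2)] by blast
  obtain C where C: "\<And>d. mp.cod J (filt d) \<le> C * (d + 1) ^ Suc s"
    using assms(3) unfolding growth_def by blast
  have "mp.cod J' (filt d) \<le> C * (e + 1) ^ Suc s * (d + 1) ^ s" for d
  proof -
    \<comment> \<open>With n = d + 1 copies the degree stays linear in d, and dividing by d + 1
      lowers the exponent by one.\<close>
    have "(d + 1) * mp.cod J' (filt d) \<le> C * (d + (d + 1) * e + 1) ^ Suc s"
      using e[of "d + 1" d] C[of "d + (d + 1) * e"] by linarith
    also have "d + (d + 1) * e + 1 = (d + 1) * (e + 1)" by simp
    also have "C * ((d + 1) * (e + 1)) ^ Suc s = (d + 1) * (C * (e + 1) ^ Suc s * (d + 1) ^ s)"
      unfolding power_mult_distrib by (simp only: power_Suc mult_ac)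
    finally show ?thesis by (simp only: mult_le_cancel1)
  qed
  then show ?thesis unfolding growth_def by blast
qed

lemma growth_zero:
  fixes J :: "(var4, 'k::field) mpoly set"
  assumes "reg_step J J'" "growth 0 J"
  shows "J' = UNIV"
proof (rule ccontr)
  assume n: "J' \<noteq> UNIV"
  obtain e where e: "\<And>n d. n * mp.cod J' (filt d) \<le> mp.cod J (filt (d + n * e))"
    using cod_filt_iterate[OF assms(1) n] by blast
  obtain C where C: "\<And>d. mp.cod J (filt d) \<le> C" using assms(2) unfolding growth_def by auto
  have J': "is_ideal J'" using assms(1) unfolding reg_step_def by blast
  \<comment> \<open>More copies than the bound \<open>C\<close> permits, so not even the constants
    survive modulo \<open>J'\<close>.\<close>
  have "Suc C * mp.cod J' (filt 0) \<le> C" using e[of "Suc C" 0] C order_trans by blast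
  then have "mp.cod J' (filt 0) = 0" by (cases "mp.cod J' (filt 0)") auto
  then have "filt 0 \<subseteq> J'" by (intro mp.cod_eq_0 fd_filt subspace_filt subspace_ideal J')
  moreover have "1 \<in> filt 0" unfolding filt_def supported_def tdeg_def mdeg_def by simp
  ultimately show False using ideal_one[OF J'] n by blast
qed

lemma growth_two_bound:
  fixes J0 :: "(var4, 'k::field) mpoly set"
  assumes "growth 2 J0" "reg_step J0 J1" "reg_step J1 J2" "reg_step J2 J3"
  shows "J3 = UNIV"
proof (rule ccontr)
  assume n: "J3 \<noteq> UNIV"
  then have "J2 \<noteq> UNIV" "J1 \<noteq> UNIV" using assms unfolding reg_step_def by blast+
  then have "growth 0 J2" using assms growth_drop[of J0 J1 1] growth_drop[of J1 J2 0] by (simp add: numeral_2_eq_2)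
  then show False using growth_zero assms(4) n by blast
qed

lemma cod_supported_le_sum:
  assumes "finite E" "is_ideal J"
  shows "mp.cod J (supported {m. mdeg dg4 m \<in> E}) \<le> (\<Sum>e\<in>E. hilb dg4 J e)"
  using assms(1)
proof (induction E rule: finite_induct)
  case empty
  have "J \<inter> supported {} = supported {}"
    using ideal_zero[OF assms(2)] by (auto simp: supported_def)
  then show ?case by (simp add: mp.cod_def)
next
  case (insert e E)
  have "{m. mdeg dg4 m \<in> insert e E} = {m. mdeg dg4 m = e} \<union> {m. mdeg dg4 m \<in> E}" by auto
  then have "mp.cod J (supported {m. mdeg dg4 m \<in> insert e E}) \<le>
      mp.cod J (supported {m. mdeg dg4 m = e}) + mp.cod J (supported {m. mdeg dg4 m \<in> E})"
    unfolding supported_Un[symmetric]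
    by (simp only: supported_Un)
      (intro mp.cod_sums_le fd_supported finite_monomials_bidegree finite_monomials_in insert.hyps
        subspace_supported subspace_ideal assms)
  then show ?case using insert by (simp add: hilb_eq_cod bicomp_eq_supported)
qed

text \<open>Bounded values summed over the quadratically many bidegrees of total degree at most
  d.\<close>

lemma growth_fatI:
  assumes "supported_on S T nu"
  shows "growth 2 (fatI b nu)"
proof -
  obtain C where C: "\<And>d. hilb dg4 (fatI b nu) d \<le> C" using hilb_fatI_bounded[OF assms] by blast
  have "mp.cod (fatI b nu) (filt d) \<le> C * (d + 1) ^ 2" for d
  proof -
    have "mp.cod (fatI b nu) (filt d) \<le> (\<Sum>e\<in>{(i, j). i + j \<le> d}. hilb dg4 (fatI b nu) e)"
      unfolding filt_def tdeg_le_eq by (rule cod_supported_le_sum[OF finite_triangle is_ideal_fatI])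
    also have "\<dots> \<le> (\<Sum>e\<in>{(i, j). i + j \<le> d}. C)" using C by (intro sum_mono) auto
    also have "\<dots> \<le> C * (d + 1) ^ 2" using card_triangle[of d] by (simp add: mult.commute)
    finally show ?thesis .
  qed
  then show ?thesis unfolding growth_def by blast
qed

lemma ex_other: obtains p' where "p' \<noteq> (p :: 'a option)"
  using that by (cases p) auto

section \<open>Dimension, depth and the Cohen--Macaulay test for fat points\<close>

lemma fatI_subset_lin:
  assumes "0 < nu p q"
  shows "fatI b nu \<subseteq> lin b {p} {q}"
proof -
  obtain m where m: "nu p q = Suc m" using assms gr0_conv_Suc by blast
  have "fatI b nu \<subseteq> pw (lf b p) (lf (\<not> b) q) (Suc m)" unfolding fatI_def m[symmetric] by blast
  also have "\<dots> \<subseteq> adj (lin b {p} {}) (lf (\<not> b) q ^ Suc m)" unfolding lin_one by (rule pw_subset_adj)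
  also have "\<dots> \<subseteq> adj (lin b {p} {}) (lf (\<not> b) q)"
    by (intro adj_least is_ideal_adj is_ideal_lin) (auto simp: adj_base intro: adj_mult is_ideal_lin)
  also have "\<dots> = lin b {p} {q}" by (simp only: lin_insert2)
  finally show ?thesis .
qed

lemma lin_mono: "S \<subseteq> S' \<Longrightarrow> T \<subseteq> T' \<Longrightarrow> lin b S T \<subseteq> lin b S' T'"
  unfolding lin_def by (intro ideal_gen_mono) auto

lemma lf_in_lin: "p \<in> S \<Longrightarrow> lf b p \<in> lin b S T" "q \<in> T \<Longrightarrow> lf (\<not> b) q \<in> lin b S T"
  unfolding lin_def using ideal_gen_base[of "lf b ` S \<union> lf (\<not> b) ` T"] by auto

lemma krull_dim_fatI:
  assumes nu: "supported_on S T nu" "0 < nu p q"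
  shows "krull_dim_quot (fatI b nu) = 2"
proof (rule antisym)
  show "krull_dim_quot (fatI b nu) \<le> 2"
    unfolding krull_dim_quot_def
  proof (rule Sup_least, clarify)
    fix n C assume C: "\<forall>i\<le>n. prime_ideal (C i) \<and> fatI b nu \<subseteq> C i" "\<forall>i<n. C i \<subset> C (Suc i)"
    have step: "reg_step (C i) (C (Suc i))" if "i < n" for i
    proof -
      have "prime_ideal (C i)" "prime_ideal (C (Suc i))" "C i \<subset> C (Suc i)" using C that by auto
      then show ?thesis unfolding reg_step_def using nzd_prime by (auto simp: prime_ideal_def)
    qed
    have "n \<le> 2"
    proof (rule ccontr)
      assume "\<not> n \<le> 2"
      then have n: "0 < n" "1 < n" "2 < n" by auto
      have "growth 2 (C 0)" using growth_antimono[OF growth_fatI[OF nu(1)]] C(1) by blast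
      then have "C 3 = UNIV"
        using growth_two_bound[of "C 0" "C 1" "C 2" "C 3"] step[OF n(1)] step[OF n(2)] step[OF n(3)]
        by (simp add: numeral_2_eq_2 numeral_3_eq_3)
      then show False using C(1) n(3) unfolding prime_ideal_def by (metis Suc_leI numeral_2_eq_2 numeral_3_eq_3)
    qed
    then show "enat n \<le> 2" by (simp add: numeral_eq_enat)
  qed
  obtain p' where p': "p' \<noteq> p" by (rule ex_other)
  obtain q' where q': "q' \<noteq> q" by (rule ex_other)
  \<comment> \<open>The prime of a point of the support, enlarged by both variables of ruling
    \<open>b\<close> (spanned by the forms of \<open>p\<close> and \<open>p'\<close>), and finally
    by all four variables.\<close>
  define C where "C i = (if i = 0 then lin b {p} {q} else if i = 1 then lin b {p, p'} {q} else lin b {p, p'} {q, q'})"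
    for i :: nat
  have s0: "lin b {p} {q} \<subset> lin b {p, p'} {q}"
    using lin_mono[of "{p}" "{p, p'}" "{q}" "{q}" b] lf_notin_lin[of "{p}" p' b "{q}"] p'
      lf_in_lin(1)[of p' "{p, p'}" b "{q}"] by auto
  have "lf (\<not> b) q' \<notin> lin b {p, p'} {q}"
    using lf_notin_lin[of "{q}" q' "\<not> b" "{p, p'}"] q' by (simp add: lin_swap)
  then have s1: "lin b {p, p'} {q} \<subset> lin b {p, p'} {q, q'}"
    using lin_mono[of "{p, p'}" "{p, p'}" "{q}" "{q, q'}" b] lf_in_lin(2)[of q' "{q, q'}" b "{p, p'}"] by auto
  have "fatI b nu \<subseteq> C 0" using fatI_subset_lin[of nu p q b] nu by (simp add: C_def)
  then have "\<forall>i\<le>2. prime_ideal (C i) \<and> fatI b nu \<subseteq> C i"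
    using s0 s1 prime_lin by (auto simp: C_def)
  moreover have "\<forall>i<2. C i \<subset> C (Suc i)" using s0 s1 by (auto simp: C_def less_2_cases_iff)
  ultimately have "enat 2 \<in> {enat n |n. \<exists>C. (\<forall>i\<le>n. prime_ideal (C i) \<and> fatI b nu \<subseteq> C i) \<and> (\<forall>i<n. C i \<subset> C (Suc i))}"
    by blast
  then show "2 \<le> krull_dim_quot (fatI b nu)"
    unfolding krull_dim_quot_def numeral_eq_enat by (rule Sup_upper)
qed

lemma depth_fatI_le:
  assumes nu: "supported_on S T nu" and fs: "regular_seq (fatI b nu) fs"
  shows "length fs \<le> 2"
proof (rule ccontr)
  assume "\<not> length fs \<le> 2"
  then have n: "0 < length fs" "1 < length fs" "2 < length fs" by auto
  define J where "J i = ideal_gen (fatI b nu \<union> set (take i fs))" for i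
  have step: "reg_step (J i) (J (Suc i))" if i: "i < length fs" for i
  proof -
    have "fatI b nu \<union> set (take (Suc i) fs) = insert (fs ! i) (fatI b nu \<union> set (take i fs))"
      using i by (auto simp: take_Suc_conv_app_nth)
    then have "J (Suc i) = adj (J i) (fs ! i)" unfolding J_def by (simp only: ideal_gen_insert)
    moreover have "is_ideal (J i)" for i unfolding J_def by (rule is_ideal_ideal_gen)
    moreover have "nzd (fs ! i) (J i)" using fs i unfolding regular_seq_def J_def nzd_def by blast
    ultimately show ?thesis unfolding reg_step_def by (auto intro: adj_gen adj_base is_ideal_adj)
  qed
  have "J 0 = fatI b nu" unfolding J_def by (simp add: ideal_gen_ideal is_ideal_fatI)
  then have "J 3 = UNIV"
    using growth_two_bound[of "J 0" "J 1" "J 2" "J 3"] step[OF n(1)] step[OF n(2)] step[OF n(3)] growth_fatI[OF nu]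
    by (simp add: numeral_2_eq_2 numeral_3_eq_3)
  moreover have "J 3 \<subseteq> ideal_gen (fatI b nu \<union> set fs)"
    unfolding J_def by (intro ideal_gen_mono Un_mono order_refl set_take_subset)
  ultimately show False using fs unfolding regular_seq_def by blast
qed

lemma regular_seq_pair:
  assumes "is_ideal I"
  shows "regular_seq I [f, g] \<longleftrightarrow> nzd f I \<and> nzd g (adj I f) \<and> adj (adj I f) g \<noteq> UNIV"
proof -
  have 1: "ideal_gen (insert f I) = adj I f" by (simp add: ideal_gen_insert ideal_gen_ideal assms)
  have "ideal_gen (insert g (insert f I)) = adj (adj I f) g" by (simp only: ideal_gen_insert ideal_gen_ideal assms)
  then have 2: "ideal_gen (insert f (insert g I)) = adj (adj I f) g" by (simp add: insert_commute)
  show ?thesis unfolding regular_seq_def nzd_def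
    by (auto simp: less_Suc_eq ideal_gen_ideal assms 1 2)
qed

text \<open>The dimension is 2 and no regular sequence is longer than 2, so equality means that a
  sequence of length 2 attains the supremum.\<close>

lemma cohen_macaulay_fatI_iff:
  assumes nu: "supported_on S T nu" "0 < nu p q"
  shows "cohen_macaulay_quot (fatI b nu) \<longleftrightarrow>
    (\<exists>f\<in>irrelevant_ideal. \<exists>g\<in>irrelevant_ideal. regular_seq (fatI b nu) [f, g])" (is "_ \<longleftrightarrow> ?R")
proof -
  let ?D = "{enat (length fs) |fs. set fs \<subseteq> irrelevant_ideal \<and> regular_seq (fatI b nu) fs}"
  have le: "x \<le> 2" if "x \<in> ?D" for x using that depth_fatI_le[OF nu(1)] by (auto simp: numeral_eq_enat)
  have "Sup ?D = 2 \<longleftrightarrow> ?R"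
  proof
    assume r: ?R
    then obtain f g where fg: "set [f, g] \<subseteq> irrelevant_ideal" "regular_seq (fatI b nu) [f, g]" by auto
    have "\<exists>fs. enat 2 = enat (length fs) \<and> set fs \<subseteq> irrelevant_ideal \<and> regular_seq (fatI b nu) fs"
      using fg by (intro exI[of _ "[f, g]"]) auto
    then have "enat 2 \<in> ?D" by blast
    then show "Sup ?D = 2" using le by (intro antisym Sup_least Sup_upper) (auto simp: numeral_eq_enat)
  next
    assume s: "Sup ?D = 2"
    have "\<exists>x\<in>?D. 1 < x"
    proof (rule ccontr)
      assume "\<not> (\<exists>x\<in>?D. 1 < x)"
      then have "Sup ?D \<le> 1" by (intro Sup_least) (auto simp: not_less)
      then show False using s by (simp add: numeral_eq_enat one_enat_def)
    qed
    then obtain fs where fs: "1 < length fs" "set fs \<subseteq> irrelevant_ideal" "regular_seq (fatI b nu) fs"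
      by (auto simp: one_enat_def)
    then have "length fs = 2" using depth_fatI_le[OF nu(1) fs(3)] by simp
    then obtain f g where "fs = [f, g]" by (auto simp: numeral_2_eq_2 length_Suc_conv)
    then show ?R using fs by auto
  qed
  then show ?thesis unfolding cohen_macaulay_quot_def depth_quot_def krull_dim_fatI[OF nu] .
qed

lemma is_ideal_irrelevant: "is_ideal irrelevant_ideal"
  unfolding irrelevant_ideal_def by (rule is_ideal_ideal_gen)

lemma lf_irrelevant: "lf b p \<in> irrelevant_ideal"
proof -
  have "mvar v \<in> irrelevant_ideal" for v
    unfolding irrelevant_ideal_def by (rule subsetD[OF ideal_gen_base rangeI])
  then show ?thesis unfolding lf_def lform_def by (intro ideal_diff ideal_mult is_ideal_irrelevant)
qed

text \<open>The lines of ruling \<open>b\<close> through the support, with enough multiplicity, form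
  an element of I; as \<open>r\<close> is none of them, it divides all forms of large degree modulo
  the line of \<open>r\<close>.\<close>

lemma high_degree_in_ideal:
  assumes nu: "supported_on S T nu" and r: "\<And>q. nu r q = 0"
  shows "\<exists>N. \<forall>i\<ge>N. \<forall>j. bicomp dg4 (bd b i j) \<subseteq> adj (fatI b nu) (lf b r)"
proof -
  have fin: "finite S" "finite T" using nu unfolding supported_on_def by auto
  define w where "w p = (\<Sum>q\<in>T. nu p q)" for p
  have le: "nu p q \<le> w p" for p q
    using member_le_sum[of q T "nu p"] fin nu unfolding w_def supported_on_def
    by (cases "nu p q = 0") auto
  let ?G = "\<Prod>p\<in>S - {r}. lf b p ^ w p"
  have "?G \<in> fatI (\<not> b) (\<lambda>q p. nu p q)"
    using prod_in_fatI[of "S - {r}" "\<lambda>q p. nu p q" w "\<not> b"] fin le nu r unfolding supported_on_def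
    by (metis (no_types, lifting) Diff_iff finite_Diff less_irrefl singletonD)
  then have G: "?G \<in> fatI b nu" by (simp add: fatI_swap)
  have cov: "covers b r ?G (\<Sum>p\<in>S - {r}. w p)" by (rule covers_prod) simp
  have "s \<in> adj (fatI b nu) (lf b r)" if s: "(\<Sum>p\<in>S - {r}. w p) \<le> i" "s \<in> bicomp dg4 (bd b i j)" for i j s
  proof -
    obtain u v where "s = lf b r * u + ?G * v" using cov s unfolding covers_def by blast
    then show ?thesis using ideal_mult'[OF is_ideal_fatI G]
      by (intro adjI[of _ "?G * v" _ u]) (auto simp: add.commute)
  qed
  then show ?thesis by blast
qed

lemma high_degree_in_ideal2:
  assumes nu: "supported_on S T nu" and r: "\<And>q. nu r q = 0" and t: "\<And>p. nu p t = 0"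
  shows "\<exists>N. \<forall>i j. N \<le> i \<or> N \<le> j \<longrightarrow>
    bicomp dg4 (bd b i j) \<subseteq> adj (adj (fatI b nu) (lf b r)) (lf (\<not> b) t)"
proof -
  obtain N where N: "\<And>i j. N \<le> i \<Longrightarrow> bicomp dg4 (bd b i j) \<subseteq> adj (fatI b nu) (lf b r)"
    using high_degree_in_ideal[OF nu r] by blast
  obtain N' where N': "\<And>i j. N' \<le> j \<Longrightarrow> bicomp dg4 (bd b i j) \<subseteq> adj (fatI b nu) (lf (\<not> b) t)"
    using high_degree_in_ideal[OF supported_on_swap[OF nu] t, of "\<not> b"] by (auto simp: fatI_swap bd_not)
  have "bicomp dg4 (bd b i j) \<subseteq> adj (adj (fatI b nu) (lf b r)) (lf (\<not> b) t)"
    if "max N N' \<le> i \<or> max N N' \<le> j" for i j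
  proof (cases "N \<le> i")
    case True
    then show ?thesis using N adj_base by blast
  next
    case False
    then have "N' \<le> j" using that by auto
    then show ?thesis unfolding adj_commute[OF is_ideal_fatI, of b nu "lf b r"] using N' adj_base by blast
  qed
  then show ?thesis by blast
qed

theorem cohen_macaulay_iff_regular:
  assumes nu: "supported_on S T nu" "0 < nu p q" and r: "\<And>q. nu r q = 0" and t: "\<And>p. nu p t = 0"
  shows "cohen_macaulay_quot (fatI b nu) \<longleftrightarrow> nzd (lf (\<not> b) t) (adj (fatI b nu) (lf b r))"
proof
  let ?I = "fatI b nu" and ?L = "lf b r" and ?M = "lf (\<not> b) t"
  have L: "nzd ?L ?I" using r by (rule nzd_lf_fatI)
  {
    assume M: "nzd ?M (adj ?I ?L)"
    have "fatI b nu \<subseteq> lin b {p, r} {q, t}"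
      using fatI_subset_lin[of nu p q b] nu(2) lin_mono[of "{p}" "{p, r}" "{q}" "{q, t}" b] by blast
    then have "adj (adj ?I ?L) ?M \<subseteq> lin b {p, r} {q, t}"
      by (intro adj_least is_ideal_lin lf_in_lin) auto
    then have "regular_seq ?I [?L, ?M]"
      using L M lin_proper[of b "{p, r}" "{q, t}"] by (auto simp: regular_seq_pair is_ideal_fatI)
    then show "cohen_macaulay_quot ?I"
      unfolding cohen_macaulay_fatI_iff[OF nu] using lf_irrelevant by blast
  }
  assume "cohen_macaulay_quot ?I"
  then obtain f g where fg: "f \<in> irrelevant_ideal" "g \<in> irrelevant_ideal" "nzd f ?I" "nzd g (adj ?I f)"
    unfolding cohen_macaulay_fatI_iff[OF nu] by (auto simp: regular_seq_pair is_ideal_fatI)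
  let ?A = "adj ?I ?L"
  have A: "is_ideal ?A" by (intro is_ideal_adj is_ideal_fatI)
  \<comment> \<open>An element killed by all variables modulo \<open>?A\<close> is killed by
    \<open>f\<close> and \<open>g\<close>, and \<open>no_socle\<close> applies to this unknown
    regular sequence.\<close>
  have soc: "u \<in> ?A" if "\<And>v. mvar v * u \<in> ?A" for u
  proof -
    have "irrelevant_ideal \<subseteq> {h. u * h \<in> ?A}"
      unfolding irrelevant_ideal_def using that
      by (intro ideal_gen_least is_ideal_colon A) (auto simp: mult.commute)
    then have "f * u \<in> ?A" "g * u \<in> ?A" using fg(1,2) by (auto simp: mult.commute)
    then show ?thesis using no_socle[OF is_ideal_fatI L fg(3,4)] by blast
  qed
  obtain N where N: "\<And>i j. N \<le> i \<or> N \<le> j \<Longrightarrow> bicomp dg4 (bd b i j) \<subseteq> adj ?A ?M"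
    using high_degree_in_ideal2[OF nu(1) r t] by blast
  show "nzd ?M ?A" unfolding nzd_def
  proof (intro allI impI)
    fix h assume h: "?M * h \<in> ?A"
    \<comment> \<open>Descending induction on the degree of the monomial, \<open>n\<close> measuring
      how far it is below 2N. Total degree 2N forces one entry of the bidegree to reach
      \<open>N\<close>, so the monomial then lies in \<open>adj ?A ?M\<close>; below that,
      \<open>soc\<close> applies.\<close>
    have "Poly_Mapping.single m 1 * h \<in> ?A" if "2 * N \<le> tdeg m + n" for m n
      using that
    proof (induction n arbitrary: m)
      case 0
      obtain i j where ij: "mdeg dg4 m = bd b i j" by (rule bd_cases)
      then have "N \<le> i \<or> N \<le> j" using 0 unfolding tdeg_def by (cases b) (auto simp: bd_def)
      then have "Poly_Mapping.single m 1 \<in> adj ?A ?M"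
        using N[of i j] single_in_bicomp[of m 1 dg4] ij by auto
      then obtain k s where k: "Poly_Mapping.single m 1 = k + ?M * s" "k \<in> ?A" by (rule adjE)
      have "Poly_Mapping.single m 1 * h = h * k + s * (?M * h)" unfolding k(1) by (simp add: algebra_simps)
      then show ?case using h k(2) ideal_add[OF A] ideal_mult[OF A] by metis
    next
      case (Suc n)
      show ?case
      proof (rule soc)
        fix v
        have "tdeg (Poly_Mapping.single v 1) = 1"
          unfolding tdeg_def by (cases v) (simp_all add: mdeg_def)
        then have "2 * N \<le> tdeg (Poly_Mapping.single v 1 + m) + n" using Suc.prems by (simp add: tdeg_add)
        then have "Poly_Mapping.single (Poly_Mapping.single v 1 + m) 1 * h \<in> ?A" by (rule Suc.IH)
        then show "mvar v * (Poly_Mapping.single m 1 * h) \<in> ?A"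
          unfolding mvar_def by (simp add: mult.assoc[symmetric] mult_single)
      qed
    qed
    from this[of 0 "2 * N"] show "h \<in> ?A" by simp
  qed
qed

section \<open>Monomial ideals in two variables\<close>

lemma mdeg_dg2: "mdeg dg2 m = (Poly_Mapping.lookup m VX1, Poly_Mapping.lookup m VY1)"
proof -
  have s: "Poly_Mapping.keys m \<subseteq> {VX1, VY1}" using var2.exhaust by blast
  have "(\<Sum>v\<in>Poly_Mapping.keys m. Poly_Mapping.lookup m v * f v) = (\<Sum>v\<in>{VX1, VY1}. Poly_Mapping.lookup m v * f v)" for f
    using s by (intro sum.mono_neutral_left) (auto simp: in_keys_iff)
  then show ?thesis unfolding mdeg_def by simp
qed

definition mono2 :: "nat \<Rightarrow> nat \<Rightarrow> var2 \<Rightarrow>\<^sub>0 nat" where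
  "mono2 i j = Poly_Mapping.single VX1 i + Poly_Mapping.single VY1 j"

lemma mdeg_mono2: "mdeg dg2 (mono2 i j) = (i, j)"
  unfolding mdeg_dg2 mono2_def by (simp add: lookup_add lookup_single when_def)

lemma mdeg_dg2_inj: "mdeg dg2 m = mdeg dg2 n \<Longrightarrow> m = n"
  unfolding mdeg_dg2 by (rule poly_mapping_eqI, rename_tac v, case_tac v) auto

lemma mono2_mdeg: "mdeg dg2 m = (i, j) \<longleftrightarrow> m = mono2 i j"
  using mdeg_dg2_inj[of m "mono2 i j"] mdeg_mono2 by auto

lemma bicomp_dg2: "bicomp dg2 (i, j) = supported {mono2 i j}"
  unfolding bicomp_eq_supported mono2_mdeg by simp

lemma mono2_add: "mono2 i j + mono2 i' j' = mono2 (i + i') (j + j')"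
  by (rule mdeg_dg2_inj) (simp add: mdeg_add mdeg_mono2)

lemma hilb_dg2:
  fixes J :: "(var2, 'k::field) mpoly set"
  assumes J: "is_ideal J"
  shows "hilb dg2 J (i, j) = (if Poly_Mapping.single (mono2 i j) 1 \<in> J then 0 else 1)"
proof -
  let ?w = "Poly_Mapping.single (mono2 i j) 1 :: (var2, 'k) mpoly"
  have d: "mp.dim (supported {mono2 i j} :: (var2, 'k) mpoly set) = 1" by (simp add: dim_supported)
  have el: "\<exists>c. x = mconst c * ?w" if "x \<in> supported {mono2 i j}" for x :: "(var2, 'k) mpoly"
  proof
    show "x = mconst (Poly_Mapping.lookup x (mono2 i j)) * ?w"
      using that by (intro poly_mapping_eqI) (auto simp: lookup_mconst_mult lookup_single when_def supported_def in_keys_iff)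
  qed
  show ?thesis
  proof (cases "?w \<in> J")
    case True
    then have "J \<inter> supported {mono2 i j} = supported {mono2 i j}"
      using el ideal_mult[OF J] by blast
    then show ?thesis using True by (simp add: hilb_eq_cod mp.cod_def bicomp_dg2)
  next
    case False
    have "x = 0" if x: "x \<in> J" "x \<in> supported {mono2 i j}" for x
    proof (rule ccontr)
      assume "x \<noteq> 0"
      obtain c where c: "x = mconst c * ?w" using el[OF x(2)] by blast
      then have "c \<noteq> 0" using \<open>x \<noteq> 0\<close> by auto
      then have "?w = mconst (inverse c) * x"
        unfolding c by (simp add: mult.assoc[symmetric] mconst_mult[symmetric])
      then show False using False x(1) ideal_mult[OF J] by metis
    qed
    then have "J \<inter> supported {mono2 i j} \<subseteq> {0}" by blast
    then have "mp.dim (J \<inter> supported {mono2 i j}) = 0"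
      using mp.dim_le_card[of "J \<inter> supported {mono2 i j}" "{}"] by simp
    then show ?thesis using False d by (simp add: hilb_eq_cod mp.cod_def bicomp_dg2)
  qed
qed

definition down_closed :: "(nat \<times> nat) set \<Rightarrow> bool" where
  "down_closed D \<longleftrightarrow> (\<forall>i j i' j'. (i, j) \<in> D \<longrightarrow> i' \<le> i \<longrightarrow> j' \<le> j \<longrightarrow> (i', j') \<in> D)"

lemma ideal_down_closed:
  fixes J :: "(var2, 'k::field) mpoly set"
  assumes "is_ideal J"
  shows "down_closed {(i, j). Poly_Mapping.single (mono2 i j) 1 \<notin> J}"
proof -
  have "Poly_Mapping.single (mono2 i j) 1 \<in> J"
    if "Poly_Mapping.single (mono2 i' j') 1 \<in> J" "i' \<le> i" "j' \<le> j" for i j i' j'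
  proof -
    have "mono2 i j = mono2 (i - i') (j - j') + mono2 i' j'" using that by (simp add: mono2_add)
    then have "Poly_Mapping.single (mono2 i j) (1::'k) = Poly_Mapping.single (mono2 (i - i') (j - j')) 1 * Poly_Mapping.single (mono2 i' j') 1"
      by (simp add: mult_single)
    then show ?thesis using ideal_mult[OF assms that(1)] by simp
  qed
  then show ?thesis unfolding down_closed_def by blast
qed

text \<open>Ideals above \<open>J\<close> are determined by their intersection with the
  finite-dimensional span of \<open>B\<close>, so a chain is constant once the dimension of that
  intersection is minimal.\<close>

lemma artinian_if_finite_complement:
  fixes J :: "('v, 'k::field) mpoly set"
  assumes "supported (- B) \<subseteq> J" "finite B"
  shows "artinian_quot J"
  unfolding artinian_quot_def
proof (intro allI impI)
  fix C :: "nat \<Rightarrow> ('v, 'k) mpoly set"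
  assume C: "\<forall>i. is_ideal (C i) \<and> J \<subseteq> C i \<and> C (Suc i) \<subseteq> C i"
  then have id: "is_ideal (C i)" and JC: "J \<subseteq> C i" for i by auto
  have mono: "C k \<subseteq> C n" if "n \<le> k" for n k
  proof (rule lift_Suc_antimono_le[OF _ that])
    show "C (Suc i) \<subseteq> C i" for i using C by simp
  qed
  let ?W = "supported B :: ('v, 'k) mpoly set"
  have fdW: "mp.fd ?W" using assms(2) by (rule fd_supported)
  let ?f = "\<lambda>n. mp.dim (C n \<inter> ?W)"
  obtain n where n: "\<And>k. ?f n \<le> ?f k" using ex_has_least_nat[of "\<lambda>_. True" 0 ?f] by auto
  have "C k = C n" if "n \<le> k" for k
  proof
    show "C k \<subseteq> C n" using mono[OF that] .
    have "C k \<inter> ?W = C n \<inter> ?W"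
      using mono[OF that] n[of k]
      by (intro mp.subspace_eq_if_dim_le mp.fd_subset[OF fdW] mp.subspace_inter subspace_ideal id subspace_supported) auto
    then have W: "C n \<inter> ?W \<subseteq> C k" by blast
    show "C n \<subseteq> C k"
    proof
      fix x assume x: "x \<in> C n"
      have "x \<in> supported (- B \<union> B)" by (simp add: supported_def)
      then obtain y z where yz: "x = y + z" "y \<in> supported (- B)" "z \<in> ?W"
        unfolding supported_Un mp.ssum_def by blast
      then have y: "y \<in> C n" "y \<in> C k" using assms(1) JC by blast+
      then have "z \<in> C k" using W x yz ideal_add_cancel[OF id] by blast
      then show "x \<in> C k" unfolding yz(1) using y ideal_add[OF id] by blast
    qed
  qed
  then show "\<exists>n. \<forall>k\<ge>n. C k = C n" by blast
qed

text \<open>Realised by the monomial ideal spanned by the monomials outside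
  \<open>D\<close>.\<close>

lemma staircase_ideal:
  assumes "finite D" "down_closed D"
  obtains J :: "(var2, 'k::field) mpoly set"
  where "bihom_ideal dg2 J" "artinian_quot J" "\<And>i j. hilb dg2 J (i, j) = (if (i, j) \<in> D then 1 else 0)"
proof
  let ?B = "{m. mdeg dg2 m \<in> D}"
  let ?J = "supported (- ?B) :: (var2, 'k) mpoly set"
  have up: "m + n \<in> - ?B" if "n \<in> - ?B" for m n
  proof -
    obtain i j i' j' where "mdeg dg2 m = (i, j)" "mdeg dg2 n = (i', j')" by fastforce
    then show ?thesis using that assms(2) unfolding down_closed_def by (auto simp: mdeg_add)
  qed
  have J: "is_ideal ?J" unfolding is_ideal_def
  proof (intro conjI ballI allI)
    fix r a :: "(var2, 'k) mpoly" assume "a \<in> ?J"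
    then show "r * a \<in> ?J" using keys_mult[of r a] up unfolding supported_def by blast
  qed (use subspace_supported in \<open>auto simp: mp.subspace_def\<close>)
  let ?H = "?J \<inter> (\<Union>d. bicomp dg2 d)"
  have "?J \<subseteq> ideal_gen ?H"
  proof
    fix p assume p: "p \<in> ?J"
    have "Poly_Mapping.single m (Poly_Mapping.lookup p m) \<in> ?H" if "m \<in> Poly_Mapping.keys p" for m
    proof
      show "Poly_Mapping.single m (Poly_Mapping.lookup p m) \<in> ?J" using p that by (auto simp: supported_def)
    qed (use single_in_bicomp in blast)
    then have "(\<Sum>m\<in>Poly_Mapping.keys p. Poly_Mapping.single m (Poly_Mapping.lookup p m)) \<in> ideal_gen ?H"
      using ideal_gen_base[of ?H] by (intro ideal_sum[OF is_ideal_ideal_gen]) blast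
    then show "p \<in> ideal_gen ?H" by (simp only: sum_singles[symmetric])
  qed
  moreover have "ideal_gen ?H \<subseteq> ?J" by (rule ideal_gen_least[OF J]) blast
  ultimately show "bihom_ideal dg2 ?J" unfolding bihom_ideal_def using J by blast
  have "finite (mdeg dg2 -` D)" using assms(1) by (rule finite_vimageI) (auto intro: injI mdeg_dg2_inj)
  then have "finite ?B" by (simp add: vimage_def)
  then show "artinian_quot ?J" by (intro artinian_if_finite_complement[of ?B]) auto
  show "hilb dg2 ?J (i, j) = (if (i, j) \<in> D then 1 else 0)" for i j
    unfolding hilb_dg2[OF J] by (simp add: supported_def mdeg_mono2)
qed

section \<open>The difference function\<close>

lemma HZ_nat: "HZ mu (int i) (int j) = int (hilb dg4 (fat_ideal mu) (i, j))"
  by (simp add: HZ_def)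

lemma HZ_neg: "HZ mu (- 1) j = 0" "HZ mu i (- 1) = 0"
  by (simp_all add: HZ_def)

text \<open>Each regular form takes one first difference. In degree 0 the degenerate exact sequence
  matches the convention that \<open>HZ\<close> vanishes at negative arguments.\<close>

lemma DeltaHZ_regular:
  assumes L: "nzd (lf True r) (fat_ideal mu)" and M: "nzd (lf False t) (adj (fat_ideal mu) (lf True r))"
  shows "DeltaHZ mu (int i) (int j) = int (hilb dg4 (adj (adj (fat_ideal mu) (lf True r)) (lf False t)) (i, j))"
proof -
  let ?I = "fat_ideal mu" and ?A = "adj (fat_ideal mu) (lf True r)"
  let ?K = "adj ?A (lf False t)"
  have I: "hom_ideal dg4 ?I" unfolding fat_ideal_eq by (rule hom_ideal_fatI)
  have A: "hom_ideal dg4 ?A" by (rule hom_ideal_adj[OF I lf_bicomp])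
  have l: "lf True r \<in> bicomp dg4 (bd True 1 0)" by (rule lf_bicomp)
  have m: "lf False t \<in> bicomp dg4 (bd True 0 1)" using lf_bicomp'[of True t] by simp
  have 1: "hilb dg4 ?I (Suc i, j) = hilb dg4 ?A (Suc i, j) + hilb dg4 ?I (i, j)" for i j
    using hilb_step[OF I l lf_nonzero, of i j] colon_nzd[OF L hom_ideal_ideal[OF I]] by (simp add: bd_def)
  have 2: "hilb dg4 ?I (0, j) = hilb dg4 ?A (0, j)" for j
    using hilb_step_degenerate[OF I l, of 0 j] by (simp add: bd_def)
  have 3: "hilb dg4 ?A (i, Suc j) = hilb dg4 ?K (i, Suc j) + hilb dg4 ?A (i, j)" for i j
    using hilb_step[OF A m lf_nonzero, of i j] colon_nzd[OF M hom_ideal_ideal[OF A]] by (simp add: bd_def)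
  have 4: "hilb dg4 ?A (i, 0) = hilb dg4 ?K (i, 0)" for i
    using hilb_step_degenerate[OF A m, of i 0] by (simp add: bd_def)
  have eqs: "int (Suc n) - 1 = int n" for n by simp
  show ?thesis
  proof (cases i; cases j)
    assume ij: "i = 0" "j = 0"
    show ?thesis unfolding DeltaHZ_def ij by (simp add: HZ_def 2 4)
  next
    fix j' assume ij: "i = 0" "j = Suc j'"
    show ?thesis unfolding DeltaHZ_def ij eqs HZ_nat using 3[of 0 j'] by (simp add: HZ_neg 2 HZ_def)
  next
    fix i' assume ij: "i = Suc i'" "j = 0"
    show ?thesis unfolding DeltaHZ_def ij eqs HZ_nat using 1[of i' 0] 4[of i] ij by (simp add: HZ_neg HZ_def)
  next
    fix i' j' assume ij: "i = Suc i'" "j = Suc j'"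
    show ?thesis unfolding DeltaHZ_def ij eqs HZ_nat
      using 1[of i' j] 1[of i' j'] 3[of i j'] ij by simp
  qed
qed

lemma bicomp_subset_ideal_Suc:
  assumes K: "is_ideal K" and s: "bicomp dg4 (i, j) \<subseteq> K"
  shows "bicomp dg4 (Suc i, j) \<subseteq> K" "bicomp dg4 (i, Suc j) \<subseteq> K"
proof -
  have key: "Poly_Mapping.single m c \<in> K" if "0 < Poly_Mapping.lookup m v" "mdeg dg4 m = dg4 v + (i, j)" for m c v
  proof -
    have "mdeg dg4 m = dg4 v + mdeg dg4 (m - Poly_Mapping.single v 1)"
    proof -
      have "m = Poly_Mapping.single v 1 + (m - Poly_Mapping.single v 1)"
        using that(1) by (intro poly_mapping_eqI) (auto simp: lookup_add minus_poly_mapping.rep_eq lookup_single when_def)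
      then have "mdeg dg4 m = mdeg dg4 (Poly_Mapping.single v 1) + mdeg dg4 (m - Poly_Mapping.single v 1)"
        using mdeg_add by metis
      moreover have "mdeg dg4 (Poly_Mapping.single v 1) = dg4 v" by (simp add: mdeg_def)
      ultimately show ?thesis by simp
    qed
    then have "mdeg dg4 (m - Poly_Mapping.single v 1) = (i, j)" using that(2) by simp
    then have "Poly_Mapping.single (m - Poly_Mapping.single v 1) c \<in> K"
      using s single_in_bicomp[of "m - Poly_Mapping.single v 1" c dg4] by auto
    then show ?thesis unfolding single_factor[OF that(1)] by (rule ideal_mult[OF K])
  qed
  have ext: "p \<in> K" if "\<And>m c. m \<in> Poly_Mapping.keys p \<Longrightarrow> Poly_Mapping.single m c \<in> K" for p
  proof -
    have "(\<Sum>m\<in>Poly_Mapping.keys p. Poly_Mapping.single m (Poly_Mapping.lookup p m)) \<in> K"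
      using that by (intro ideal_sum[OF K])
    then show ?thesis by (simp only: sum_singles[symmetric])
  qed
  have "Poly_Mapping.single m c \<in> K" if "mdeg dg4 m = (Suc i, j)" for m c
  proof -
    have "0 < Poly_Mapping.lookup m X0 \<or> 0 < Poly_Mapping.lookup m X1" using that by (auto simp: mdeg_dg4)
    then show ?thesis using key[of m X0 c] key[of m X1 c] that by auto
  qed
  then show "bicomp dg4 (Suc i, j) \<subseteq> K" unfolding bicomp_def using ext by blast
  have "Poly_Mapping.single m c \<in> K" if "mdeg dg4 m = (i, Suc j)" for m c
  proof -
    have "0 < Poly_Mapping.lookup m Y0 \<or> 0 < Poly_Mapping.lookup m Y1" using that by (auto simp: mdeg_dg4)
    then show ?thesis using key[of m Y0 c] key[of m Y1 c] that by auto
  qed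
  then show "bicomp dg4 (i, Suc j) \<subseteq> K" unfolding bicomp_def using ext by blast
qed

lemma hilb_dg4_eq_0_iff: "is_ideal K \<Longrightarrow> hilb dg4 K d = 0 \<longleftrightarrow> bicomp dg4 d \<subseteq> K"
proof
  show "is_ideal K \<Longrightarrow> hilb dg4 K d = 0 \<Longrightarrow> bicomp dg4 d \<subseteq> K"
    unfolding hilb_eq_cod by (intro mp.cod_eq_0 fd_bicomp subspace_bicomp subspace_ideal)
  assume "bicomp dg4 d \<subseteq> K"
  then have "K \<inter> bicomp dg4 d = bicomp dg4 d" by blast
  then show "hilb dg4 K d = 0" by (simp add: hilb_eq_cod mp.cod_def)
qed

text \<open>\<open>?K\<close> contains a form from each ruling, so its quotient has dimension at
  most 1 in every bidegree. No change of coordinates is made: only the set \<open>D\<close> of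
  bidegrees where it is nonzero is carried over to two variables, as a staircase.\<close>

theorem regular_imp_artinian_difference:
  fixes mu :: "'k::field option \<times> 'k option \<Rightarrow> nat"
  assumes nu: "supported_on S T (\<lambda>p q. mu (p, q))" and r: "\<And>q. mu (r, q) = 0" and t: "\<And>p. mu (p, t) = 0"
    and M: "nzd (lf False t) (adj (fat_ideal mu) (lf True r))"
  shows "\<exists>J :: (var2, 'k) mpoly set. bihom_ideal dg2 J \<and> artinian_quot J \<and>
    (\<forall>i j. DeltaHZ mu (int i) (int j) = int (hilb dg2 J (i, j)))"
proof -
  let ?K = "adj (adj (fat_ideal mu) (lf True r)) (lf False t)"
  have K: "is_ideal ?K" unfolding fat_ideal_eq by (intro is_ideal_adj is_ideal_fatI)
  have L: "nzd (lf True r) (fat_ideal mu)" unfolding fat_ideal_eq using r by (intro nzd_lf_fatI)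
  define D where "D = {(i, j). \<not> bicomp dg4 (i, j) \<subseteq> ?K}"
  have "adj (lin True {r} {}) (lf False t) \<subseteq> ?K"
    unfolding lin_one fat_ideal_eq using ideal_zero[OF is_ideal_fatI] by (intro adj_mono) auto
  then have "hilb dg4 ?K (i, j) \<le> hilb dg4 (adj (lin True {r} {}) (lf False t)) (i, j)" for i j
    by (rule hilb_antimono)
  moreover have "hilb dg4 (adj (lin True {r} {}) (lf False t)) (i, j) = 1" for i j
    using hilb_adj_lin[OF lf_bicomp'[of True t] nzd_lf_one[of True t r], of i j] by (simp add: bd_def)
  ultimately have le1: "hilb dg4 ?K (i, j) \<le> 1" for i j by metis
  have HK: "hilb dg4 ?K (i, j) = (if (i, j) \<in> D then 1 else 0)" for i j
  proof (cases "hilb dg4 ?K (i, j) = 0")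
    case True
    then show ?thesis using hilb_dg4_eq_0_iff[OF K, of "(i, j)"] by (simp add: D_def)
  next
    case False
    then show ?thesis using hilb_dg4_eq_0_iff[OF K, of "(i, j)"] le1[of i j] by (simp add: D_def)
  qed
  have step: "bicomp dg4 (i + a, j + c) \<subseteq> ?K" if "bicomp dg4 (i, j) \<subseteq> ?K" for i j a c
  proof -
    have "bicomp dg4 (i + a, j) \<subseteq> ?K"
      by (induction a) (use that bicomp_subset_ideal_Suc[OF K] in auto)
    then show ?thesis by (induction c) (use bicomp_subset_ideal_Suc[OF K] in auto)
  qed
  have "down_closed D"
    unfolding down_closed_def
  proof (intro allI impI)
    fix i j i' j' assume "(i, j) \<in> D" "i' \<le> i" "j' \<le> j"
    then show "(i', j') \<in> D" using step[of i' j' "i - i'" "j - j'"] by (auto simp: D_def)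
  qed
  moreover have "finite D"
  proof -
    have "\<exists>N. \<forall>i j. N \<le> i \<or> N \<le> j \<longrightarrow> bicomp dg4 (bd True i j) \<subseteq> ?K"
      using high_degree_in_ideal2[OF nu, of r t True] r t by (simp add: fat_ideal_eq)
    then obtain N where N: "\<And>i j. N \<le> i \<or> N \<le> j \<Longrightarrow> bicomp dg4 (bd True i j) \<subseteq> ?K" by blast
    have "D \<subseteq> {..<N} \<times> {..<N}" using N by (force simp: D_def bd_def not_le[symmetric])
    then show ?thesis by (rule finite_subset) simp
  qed
  ultimately obtain J :: "(var2, 'k) mpoly set" where "bihom_ideal dg2 J" "artinian_quot J"
    "\<And>i j. hilb dg2 J (i, j) = (if (i, j) \<in> D then 1 else 0)"
    using staircase_ideal by metis
  moreover from this have "DeltaHZ mu (int i) (int j) = int (hilb dg2 J (i, j))" for i j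
    using DeltaHZ_regular[OF L M, of i j] HK[of i j] by simp
  ultimately show ?thesis by blast
qed

section \<open>Counting\<close>

text \<open>A downward closed set of numbers is an initial segment, and its length is the eventual
  value of its counting function.\<close>

lemma down_closed_segment:
  assumes "\<And>i i'. i \<in> A \<Longrightarrow> i' \<le> i \<Longrightarrow> i' \<in> A" "\<And>i. i0 \<le> i \<Longrightarrow> card {i'. i' \<le> i \<and> i' \<in> A} = n"
  shows "i \<in> A \<longleftrightarrow> i < (n::nat)"
proof
  assume "i \<in> A"
  then have "{..i} \<subseteq> {i'. i' \<le> max i i0 \<and> i' \<in> A}" using assms(1) by auto
  then have "card {..i} \<le> card {i'. i' \<le> max i i0 \<and> i' \<in> A}" by (intro card_mono) auto
  then show "i < n" using assms(2)[of "max i i0"] by simp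
next
  assume "i < n"
  show "i \<in> A"
  proof (rule ccontr)
    assume "i \<notin> A"
    then have "{i'. i' \<le> i0 \<and> i' \<in> A} \<subseteq> {..<i}" using assms(1) not_less by blast
    then have "card {i'. i' \<le> i0 \<and> i' \<in> A} \<le> card {..<i}" by (intro card_mono) auto
    then show False using assms(2)[of i0] \<open>i < n\<close> by simp
  qed
qed

text \<open>For the parts \<open>a x\<close> of a partition, \<open>exceed a X j\<close> is the part with zero-based index \<open>j\<close> of
  the conjugate partition.\<close>

definition exceed :: "('a \<Rightarrow> nat) \<Rightarrow> 'a set \<Rightarrow> nat \<Rightarrow> nat" where
  "exceed a X j = card {x \<in> X. j < a x}"

text \<open>The parts of \<open>alphaZ\<close> before sorting, indexed by pairs; with the arguments
  of \<open>nu\<close> swapped, those of \<open>betaZ\<close>. Pairs with \<open>k\<close> beyond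
  the largest multiplicity yield 0, which \<open>exceed\<close> ignores.\<close>

definition excess :: "('a \<Rightarrow> 'b \<Rightarrow> nat) \<Rightarrow> 'b set \<Rightarrow> 'a \<times> nat \<Rightarrow> nat" where
  "excess nu T = (\<lambda>(p, k). \<Sum>q\<in>T. nu p q - k)"

lemma sum_min_diff:
  assumes "finite X"
  shows "(\<Sum>x\<in>X. min (Suc j) (a x)) = (\<Sum>x\<in>X. min j (a x)) + exceed a X j"
  using assms
proof (induction X rule: finite_induct)
  case (insert x X)
  have "{y \<in> insert x X. j < a y} = (if j < a x then insert x {y \<in> X. j < a y} else {y \<in> X. j < a y})" by auto
  then show ?case using insert by (auto simp: exceed_def min_def)
qed (simp add: exceed_def)

lemma hilb_difference_eventually:
  assumes "supported_on S T nu" "\<And>p q. nu p q \<le> N"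
  obtains i0 where "\<And>i. i0 \<le> i \<Longrightarrow> hilb dg4 (fatI b nu) (bd b i 0) = exceed (excess nu T) (S \<times> {..<N}) 0"
    "\<And>i j. i0 \<le> i \<Longrightarrow> hilb dg4 (fatI b nu) (bd b i (Suc j)) =
      hilb dg4 (fatI b nu) (bd b i j) + exceed (excess nu T) (S \<times> {..<N}) (Suc j)"
proof -
  have fin: "finite S" using assms(1) unfolding supported_on_def by auto
  obtain i0 where i0: "\<And>i j. i0 \<le> i \<Longrightarrow> hilb dg4 (fatI b nu) (bd b i j) =
    (\<Sum>p\<in>S. \<Sum>k<N. min (j + 1) (\<Sum>q\<in>T. nu p q - k))"
    using hilb_fatI_eventually[OF assms] by blast
  have *: "hilb dg4 (fatI b nu) (bd b i j) = (\<Sum>x\<in>S \<times> {..<N}. min (Suc j) (excess nu T x))" if "i0 \<le> i" for i j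
    unfolding i0[OF that] by (simp add: sum.cartesian_product excess_def split_def)
  show ?thesis
  proof
    show "hilb dg4 (fatI b nu) (bd b i 0) = exceed (excess nu T) (S \<times> {..<N}) 0" if "i0 \<le> i" for i
      unfolding *[OF that] using sum_min_diff[of "S \<times> {..<N}" 0 "excess nu T"] fin by simp
    show "hilb dg4 (fatI b nu) (bd b i (Suc j)) =
      hilb dg4 (fatI b nu) (bd b i j) + exceed (excess nu T) (S \<times> {..<N}) (Suc j)" if "i0 \<le> i" for i j
      unfolding *[OF that] using sum_min_diff[of "S \<times> {..<N}" "Suc j" "excess nu T"] fin by simp
  qed
qed

lemma sum_DeltaHZ:
  "(\<Sum>i'\<le>i. DeltaHZ mu (int i') j) = HZ mu (int i) j - HZ mu (int i) (j - 1)"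
  "(\<Sum>j'\<le>k. DeltaHZ mu l (int j')) = HZ mu l (int k) - HZ mu (l - 1) (int k)"
proof -
  show "(\<Sum>i'\<le>i. DeltaHZ mu (int i') j) = HZ mu (int i) j - HZ mu (int i) (j - 1)"
    by (induction i) (simp_all add: DeltaHZ_def HZ_neg)
  show "(\<Sum>j'\<le>k. DeltaHZ mu l (int j')) = HZ mu l (int k) - HZ mu (l - 1) (int k)"
    by (induction k) (simp_all add: DeltaHZ_def HZ_neg)
qed

lemma sum_indicator_int: "(\<Sum>i'\<le>i. int (if P i' then 1 else 0)) = int (card {i'. i' \<le> (i::nat) \<and> P i'})"
proof -
  have "(\<Sum>i'\<le>i. if P i' then 1 else 0) = card {i'. i' \<le> i \<and> P i'}"
    by (subst sum.inter_filter[symmetric]) (simp_all add: atMost_def Collect_conj_eq)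
  then show ?thesis by (metis (no_types, lifting) of_nat_sum sum.cong)
qed

text \<open>Both sides say that (i, j) lies in the diagram \<open>?D\<close>. Summing the indicator
  of \<open>?D\<close> along \<open>i\<close> telescopes to a first difference of \<open>HZ\<close>,
  whose limit counts the parts of \<open>alphaZ\<close> above \<open>j\<close>; summing along
  \<open>j\<close> gives \<open>betaZ\<close>.\<close>

theorem artinian_difference_imp_conjugate:
  fixes mu :: "'k::field option \<times> 'k option \<Rightarrow> nat" and J :: "(var2, 'k) mpoly set"
  assumes nu: "supported_on S T (\<lambda>p q. mu (p, q))" and N: "\<And>P. mu P \<le> N"
    and J: "is_ideal J" and D: "\<And>i j. DeltaHZ mu (int i) (int j) = int (hilb dg2 J (i, j))"
  shows "i < exceed (excess (\<lambda>p q. mu (p, q)) T) (S \<times> {..<N}) j \<longleftrightarrow>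
    j < exceed (excess (\<lambda>q p. mu (p, q)) S) (T \<times> {..<N}) i"
proof -
  let ?D = "{(i, j). Poly_Mapping.single (mono2 i j) 1 \<notin> J}"
  let ?R = "exceed (excess (\<lambda>p q. mu (p, q)) T) (S \<times> {..<N})"
  let ?C = "exceed (excess (\<lambda>q p. mu (p, q)) S) (T \<times> {..<N})"
  have dc: "down_closed ?D" using J by (rule ideal_down_closed)
  have D': "DeltaHZ mu (int i) (int j) = int (if (i, j) \<in> ?D then 1 else 0)" for i j
    unfolding D hilb_dg2[OF J] by simp
  have eqs: "int (Suc n) - 1 = int n" for n by simp
  obtain i0 where i0: "\<And>i. i0 \<le> i \<Longrightarrow> hilb dg4 (fatI True (\<lambda>p q. mu (p, q))) (bd True i 0) = ?R 0"
    "\<And>i j. i0 \<le> i \<Longrightarrow> hilb dg4 (fatI True (\<lambda>p q. mu (p, q))) (bd True i (Suc j)) =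
      hilb dg4 (fatI True (\<lambda>p q. mu (p, q))) (bd True i j) + ?R (Suc j)"
    using hilb_difference_eventually[OF nu, of N True] N by blast
  have r: "HZ mu (int i) (int j) - HZ mu (int i) (int j - 1) = int (?R j)" if "i0 \<le> i" for i j
  proof (cases j)
    case 0
    then show ?thesis using i0(1)[OF that] HZ_nat[of mu i 0] by (simp add: HZ_neg bd_def fat_ideal_eq)
  next
    case (Suc j')
    then show ?thesis using i0(2)[OF that, of j'] unfolding Suc eqs HZ_nat by (simp add: bd_def fat_ideal_eq)
  qed
  have fs: "fatI False (\<lambda>q p. mu (p, q)) = fat_ideal mu"
    using fatI_swap[of True "\<lambda>p q. mu (p, q)"] by (simp add: fat_ideal_eq)
  have nu': "supported_on T S (\<lambda>q p. mu (p, q))" using supported_on_swap[OF nu] .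
  obtain j0 where j0: "\<And>j. j0 \<le> j \<Longrightarrow> hilb dg4 (fatI False (\<lambda>q p. mu (p, q))) (bd False j 0) = ?C 0"
    "\<And>i j. j0 \<le> j \<Longrightarrow> hilb dg4 (fatI False (\<lambda>q p. mu (p, q))) (bd False j (Suc i)) =
      hilb dg4 (fatI False (\<lambda>q p. mu (p, q))) (bd False j i) + ?C (Suc i)"
    by (rule hilb_difference_eventually[OF nu', of N False]) (use N in auto)
  have c: "HZ mu (int i) (int j) - HZ mu (int i - 1) (int j) = int (?C i)" if "j0 \<le> j" for i j
  proof (cases i)
    case 0
    then show ?thesis using j0(1)[OF that] HZ_nat[of mu 0 j] by (simp add: HZ_neg bd_def fs)
  next
    case (Suc i')
    then show ?thesis using j0(2)[OF that, of i'] unfolding Suc eqs HZ_nat by (simp add: bd_def fs)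
  qed
  have "i \<in> {i. (i, j) \<in> ?D} \<longleftrightarrow> i < ?R j"
  proof (rule down_closed_segment)
    show "i' \<in> {i. (i, j) \<in> ?D}" if "i \<in> {i. (i, j) \<in> ?D}" "i' \<le> i" for i i'
      using that dc unfolding down_closed_def by blast
    show "card {i'. i' \<le> i \<and> i' \<in> {i. (i, j) \<in> ?D}} = ?R j" if "i0 \<le> i" for i
      using r[OF that, of j] sum_DeltaHZ(1)[of mu "int j" i] sum_indicator_int[of "\<lambda>i. (i, j) \<in> ?D" i]
      unfolding D' by simp
  qed
  moreover have "j \<in> {j. (i, j) \<in> ?D} \<longleftrightarrow> j < ?C i"
  proof (rule down_closed_segment)
    show "j' \<in> {j. (i, j) \<in> ?D}" if "j \<in> {j. (i, j) \<in> ?D}" "j' \<le> j" for j j'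
      using that dc unfolding down_closed_def by blast
    show "card {j'. j' \<le> j \<and> j' \<in> {j. (i, j) \<in> ?D}} = ?C i" if "j0 \<le> j" for j
      using c[OF that, of i] sum_DeltaHZ(2)[of mu "int i" j] sum_indicator_int[of "\<lambda>j. (i, j) \<in> ?D" j]
      unfolding D' by simp
  qed
  ultimately show ?thesis by blast
qed

section \<open>Partitions and zero-one matrices\<close>

lemma nth_desc_ge_iff:
  assumes "sorted_wrt (\<ge>) xs"
  shows "j < length (filter (\<lambda>x. i \<le> x) xs) \<longleftrightarrow> j < length xs \<and> i \<le> (xs ! j :: nat)"
  using assms
proof (induction xs arbitrary: j)
  case (Cons x xs)
  show ?case
  proof (cases "i \<le> x")
    case True
    then show ?thesis using Cons by (cases j) auto
  next
    case False
    have "\<forall>y\<in>set (x # xs). y \<le> x" using Cons.prems by auto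
    then have "\<not> i \<le> (x # xs) ! j" if "j < length (x # xs)"
      using nth_mem[OF that] False by (meson order_trans)
    moreover have "filter (\<lambda>x. i \<le> x) (x # xs) = []"
      using False Cons.prems by (auto simp: filter_empty_conv)
    ultimately show ?thesis by auto
  qed
qed simp

lemma nat_eqI_less: "(\<And>i. i < m \<longleftrightarrow> i < n) \<Longrightarrow> m = (n :: nat)"
  by (meson linorder_neq_iff less_irrefl)

text \<open>Conjugacy as the equality of a Young diagram with the transpose of another. Positivity
  of the parts of \<open>be\<close> fixes its length, since a conjugate partition has no zero
  parts.\<close>

lemma conj_part_eq_iff:
  assumes a: "sorted_wrt (\<ge>) al" and b: "sorted_wrt (\<ge>) be" "\<And>x. x \<in> set be \<Longrightarrow> 0 < x"
  shows "conj_part al = be \<longleftrightarrow>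
    (\<forall>i j. i < length (filter (\<lambda>x. Suc j \<le> x) al) \<longleftrightarrow> j < length (filter (\<lambda>x. Suc i \<le> x) be))"
proof -
  let ?R = "\<lambda>j. length (filter (\<lambda>x. Suc j \<le> x) al)" and ?C = "\<lambda>i. length (filter (\<lambda>x. Suc i \<le> x) be)"
  define n where "n = (if al = [] then 0 else hd al)"
  have conj: "conj_part al = map ?R [0..<n]"
    by (rule nth_equalityI) (auto simp: conj_part_def n_def simp del: upt_Suc)
  have pos: "0 < ?R j \<longleftrightarrow> j < n" for j
    using a unfolding n_def by (cases al) (auto simp: filter_empty_conv)
  have C: "j < ?C i \<longleftrightarrow> j < length be \<and> i < be ! j" for i j
    using nth_desc_ge_iff[OF b(1), of j "Suc i"] by (simp add: Suc_le_eq)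
  show ?thesis
  proof
    assume e: "conj_part al = be"
    have "i < ?R j \<longleftrightarrow> j < ?C i" for i j
    proof -
      have "j < ?C i \<longleftrightarrow> j < n \<and> i < ?R j" unfolding C unfolding e[symmetric] conj by auto
      then show ?thesis using pos[of j] by auto
    qed
    then show "\<forall>i j. i < ?R j \<longleftrightarrow> j < ?C i" by blast
  next
    assume s: "\<forall>i j. i < ?R j \<longleftrightarrow> j < ?C i"
    have "j < length be \<longleftrightarrow> j < n" for j
      using C[of j 0] s pos[of j] b(2)[OF nth_mem, of j] by auto
    then have n: "length be = n" by (rule nat_eqI_less)
    have "?R j = be ! j" if "j < length be" for j
      using C[of j] s that by (intro nat_eqI_less) blast
    then show "conj_part al = be" unfolding conj using n by (intro nth_equalityI) auto
  qed
qed

lemma size_filter_sum_mset: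
  "finite S \<Longrightarrow> size (filter_mset P (\<Sum>x\<in>S. g x)) = (\<Sum>x\<in>S. size (filter_mset P (g x)))"
  by (induction S rule: finite_induct) auto

lemma partition_filter_length:
  assumes fin: "finite S" and N: "\<And>p q. nu p q \<le> N"
    and M: "M = (\<Sum>p\<in>S. mset (map (\<lambda>k. \<Sum>q\<in>T. nu p q - k) [0..<Max (nu p ` T)]))"
    and T: "finite T" "T \<noteq> {}"
  shows "length (filter (\<lambda>x. Suc j \<le> x) (rev (sorted_list_of_multiset M))) = exceed (excess nu T) (S \<times> {..<N}) j"
    and "x \<in> set (rev (sorted_list_of_multiset M)) \<Longrightarrow> 0 < x"
proof -
  let ?P = "\<lambda>x. Suc j \<le> x"
  \<comment> \<open>A part is positive exactly when \<open>k\<close> is below the largest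
    multiplicity of its row, so extending the range of \<open>k\<close> to \<open>N\<close> only
    adds zeros.\<close>
  have lt: "(0 < (\<Sum>q\<in>T. nu p q - k)) \<longleftrightarrow> k < Max (nu p ` T)" for p k
  proof -
    have "0 < (\<Sum>q\<in>T. nu p q - k) \<longleftrightarrow> (\<exists>q\<in>T. k < nu p q)"
      using T by (simp add: sum_eq_0_iff not_le flip: neq0_conv)
    then show ?thesis using T by (simp add: Max_gr_iff)
  qed
  have "length (filter ?P (rev (sorted_list_of_multiset M))) = size (filter_mset ?P M)"
    by (metis length_rev mset_filter mset_sorted_list_of_multiset rev_filter size_mset)
  also have "\<dots> = (\<Sum>p\<in>S. size (filter_mset ?P (mset (map (\<lambda>k. \<Sum>q\<in>T. nu p q - k) [0..<Max (nu p ` T)]))))"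
    unfolding M by (rule size_filter_sum_mset[OF fin])
  also have "\<dots> = (\<Sum>p\<in>S. card {k\<in>{..<N}. j < excess nu T (p, k)})"
  proof (rule sum.cong[OF refl])
    fix p
    have MN: "Max (nu p ` T) \<le> N" using T N by simp
    have "size (filter_mset ?P (mset (map (\<lambda>k. \<Sum>q\<in>T. nu p q - k) [0..<Max (nu p ` T)])))
        = card {k. k < Max (nu p ` T) \<and> Suc j \<le> (\<Sum>q\<in>T. nu p q - k)}"
      unfolding mset_filter[symmetric] size_mset by (simp add: length_filter_conv_card cong: conj_cong)
    also have "{k. k < Max (nu p ` T) \<and> Suc j \<le> (\<Sum>q\<in>T. nu p q - k)} = {k\<in>{..<N}. j < excess nu T (p, k)}"
    proof -
      have "k < Max (nu p ` T) \<and> Suc j \<le> (\<Sum>q\<in>T. nu p q - k) \<longleftrightarrow> k < N \<and> j < (\<Sum>q\<in>T. nu p q - k)" for k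
        using lt[of p k] MN by linarith
      then show ?thesis by (simp add: excess_def)
    qed
    finally show "size (filter_mset ?P (mset (map (\<lambda>k. \<Sum>q\<in>T. nu p q - k) [0..<Max (nu p ` T)])))
      = card {k\<in>{..<N}. j < excess nu T (p, k)}" .
  qed
  also have "\<dots> = card (SIGMA p:S. {k\<in>{..<N}. j < excess nu T (p, k)})" using fin by simp
  also have "(SIGMA p:S. {k\<in>{..<N}. j < excess nu T (p, k)}) = {x \<in> S \<times> {..<N}. j < excess nu T x}" by auto
  finally show "length (filter ?P (rev (sorted_list_of_multiset M))) = exceed (excess nu T) (S \<times> {..<N}) j"
    unfolding exceed_def .
  assume "x \<in> set (rev (sorted_list_of_multiset M))"
  then have "x \<in># M" by simp
  then obtain p where "x \<in># mset (map (\<lambda>k. \<Sum>q\<in>T. nu p q - k) [0..<Max (nu p ` T)])"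
    unfolding M set_mset_sum[OF fin] by auto
  then obtain k where "x = (\<Sum>q\<in>T. nu p q - k)" "k < Max (nu p ` T)" by auto
  then show "0 < x" using lt[of p k] by simp
qed

lemma sorted_desc_rev_sorted: "sorted_wrt (\<ge>) (rev (sorted_list_of_multiset M))"
  using sorted_sorted_list_of_multiset[of M] by (simp add: sorted_wrt_rev)

text \<open>The equality case of the Gale--Ryser theorem: if the column sums are the conjugate of the
  row sums, every row consists of the largest columns. Indeed, the first \<open>s\<close> columns meet row
  \<open>x\<close> in at most \<open>min s (row sum)\<close> places, and the totals agree.\<close>

lemma conjugate_sums_nested:
  fixes E :: "'a \<Rightarrow> 'b \<Rightarrow> bool"
  assumes fin: "finite X" "finite Y"
    and a: "\<And>x. x \<in> X \<Longrightarrow> a x = card {y \<in> Y. E x y}" and c: "\<And>y. y \<in> Y \<Longrightarrow> c y = card {x \<in> X. E x y}"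
    and conj: "\<And>i j. i < exceed a X j \<longleftrightarrow> j < exceed c Y i"
    and x: "x \<in> X" "x' \<in> X"
  shows "{y \<in> Y. E x y} \<subseteq> {y \<in> Y. E x' y} \<or> {y \<in> Y. E x' y} \<subseteq> {y \<in> Y. E x y}"
proof -
  obtain ys0 where ys0: "set ys0 = Y" "distinct ys0" using finite_distinct_list[OF fin(2)] by blast
  define ys where "ys = rev (sort_key c ys0)"
  have ys: "set ys = Y" "distinct ys" unfolding ys_def using ys0 by auto
  have desc: "sorted_wrt (\<ge>) (map c ys)"
    unfolding ys_def using sorted_sort_key[of c ys0] by (simp add: rev_map[symmetric] sorted_wrt_rev)
  have len: "length ys = card Y" using ys distinct_card by metis
  have cj: "c (ys ! j) = exceed a X j" if j: "j < length ys" for j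
  proof (rule nat_eqI_less)
    fix i
    have "length (filter (\<lambda>x. Suc i \<le> x) (map c ys)) = exceed c Y i"
    proof -
      have "length (filter (\<lambda>x. Suc i \<le> x) (map c ys)) = length (filter (\<lambda>y. i < c y) ys)"
        by (simp add: filter_map comp_def Suc_le_eq)
      also have "\<dots> = card (set (filter (\<lambda>y. i < c y) ys))" using ys(2) by (metis distinct_card distinct_filter)
      also have "\<dots> = exceed c Y i" using ys(1) by (simp add: exceed_def)
      finally show ?thesis .
    qed
    then show "i < c (ys ! j) \<longleftrightarrow> i < exceed a X j"
      using nth_desc_ge_iff[OF desc, of j "Suc i"] j conj[of i j] by (simp add: Suc_le_eq)
  qed
  have row: "{y \<in> Y. E x y} = set (take (a x) ys)" if x: "x \<in> X" for x
  proof -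
    define s where "s = a x"
    have fY: "finite {y \<in> Y. E x y}" for x using fin(2) by simp
    have s: "s \<le> length ys" unfolding s_def len a[OF x] using fin(2) by (intro card_mono) auto
    have st: "set (take s ys) \<subseteq> Y" using ys(1) set_take_subset by fast
    have cst: "card (set (take s ys)) = s" using s ys(2) by (simp add: distinct_card)
    \<comment> \<open>Here \<open>s\<close> stays the sum of the one chosen row while the bound is
      taken over all rows.\<close>
    have le: "card {y \<in> set (take s ys). E x y} \<le> min s (a x)" if "x \<in> X" for x
    proof -
      have "card {y \<in> set (take s ys). E x y} \<le> card (set (take s ys))" by (intro card_mono) auto
      moreover have "card {y \<in> set (take s ys). E x y} \<le> card {y \<in> Y. E x y}"
        using st fY by (intro card_mono) auto
      ultimately show ?thesis using a[OF that] cst by simp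
    qed
    have min: "(\<Sum>x\<in>X. min s (a x)) = (\<Sum>j<s. exceed a X j)" for s
      by (induction s) (simp_all add: sum_min_diff[OF fin(1)])
    have "(\<Sum>x\<in>X. card {y \<in> set (take s ys). E x y}) = (\<Sum>y\<in>set (take s ys). card {x \<in> X. E x y})"
      using sum_multicount_gen[of X "set (take s ys)" E "\<lambda>y. card {x \<in> X. E x y}"] fin(1) by simp
    also have "\<dots> = (\<Sum>y\<in>set (take s ys). c y)" using st c by (intro sum.cong) auto
    also have "\<dots> = (\<Sum>j<s. c (ys ! j))"
    proof -
      have "(\<Sum>y\<in>set (take s ys). c y) = sum_list (map c (take s ys))"
        using ys(2) by (simp add: sum_list_distinct_conv_sum_set)
      also have "\<dots> = (\<Sum>j<s. map c (take s ys) ! j)" using s by (simp add: sum_list_sum_nth atLeast0LessThan)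
      also have "\<dots> = (\<Sum>j<s. c (ys ! j))" using s by (intro sum.cong) auto
      finally show ?thesis .
    qed
    also have "\<dots> = (\<Sum>j<s. exceed a X j)" using s cj by (intro sum.cong) auto
    also have "\<dots> = (\<Sum>x\<in>X. min s (a x))" by (simp add: min)
    finally have eq: "(\<Sum>x\<in>X. card {y \<in> set (take s ys). E x y}) = (\<Sum>x\<in>X. min s (a x))" .
    \<comment> \<open>Termwise bounds with equal totals are equalities. In the chosen row
      \<open>s\<close> is the row sum, so the row and the first \<open>s\<close> columns
      coincide.\<close>
    have "card {y \<in> set (take s ys). E x y} = min s (a x)"
      using sum_mono_inv[OF eq le x fin(1)] .
    then have "card {y \<in> set (take s ys). E x y} = card (set (take s ys))"
      "card {y \<in> set (take s ys). E x y} = card {y \<in> Y. E x y}" using cst a[OF x] by (auto simp: s_def)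
    moreover have "{y \<in> set (take s ys). E x y} \<subseteq> set (take s ys)" "{y \<in> set (take s ys). E x y} \<subseteq> {y \<in> Y. E x y}"
      using st by auto
    ultimately have "{y \<in> set (take s ys). E x y} = set (take s ys)" "{y \<in> set (take s ys). E x y} = {y \<in> Y. E x y}"
      using card_subset_eq[OF _ _] fY by (metis List.finite_set)+
    then show ?thesis unfolding s_def by simp
  qed
  show ?thesis unfolding row[OF x(1)] row[OF x(2)]
    using set_take_subset_set_take[of "a x" "a x'" ys] set_take_subset_set_take[of "a x'" "a x" ys]
    by (meson linear)
qed

text \<open>Row sums of the zero-one matrix: for each \<open>q\<close> the admissible
  \<open>h\<close> are those below \<open>nu p q - k\<close>, and \<open>N\<close> cuts none of them
  off.\<close>

lemma excess_eq_card:
  assumes "finite T" "\<And>p q. nu p q \<le> N"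
  shows "excess nu T (p, k) = card {y \<in> T \<times> {..<N}. k + snd y < nu p (fst y)}"
proof -
  have "h < N" if "k + h < nu p q" for h q using that assms(2)[of p q] by linarith
  then have "{y \<in> T \<times> {..<N}. k + snd y < nu p (fst y)} = (SIGMA q:T. {h. h < nu p q - k})"
    by (auto simp: less_diff_conv add.commute)
  then show ?thesis using assms(1) by (simp add: excess_def)
qed

lemma conjugate_imp_chain_rows:
  assumes nu: "supported_on S T nu" and N: "\<And>p q. nu p q \<le> N"
    and conj: "\<And>i j. i < exceed (excess nu T) (S \<times> {..<N}) j \<longleftrightarrow>
      j < exceed (excess (\<lambda>q p. nu p q) S) (T \<times> {..<N}) i"
  shows "chain_rows nu"
  unfolding chain_rows_def
proof (intro allI)
  fix p p' h h'
  have fin: "finite S" "finite T" using nu unfolding supported_on_def by auto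
  let ?E = "\<lambda>x y. snd x + snd y < nu (fst x) (fst y)"
  show "(\<forall>q. nu p q - h \<le> nu p' q - h') \<or> (\<forall>q. nu p' q - h' \<le> nu p q - h)"
  proof (cases "p \<in> S \<and> p' \<in> S \<and> h < N \<and> h' < N")
    case True
    have "{y \<in> T \<times> {..<N}. ?E (p, h) y} \<subseteq> {y \<in> T \<times> {..<N}. ?E (p', h') y} \<or>
        {y \<in> T \<times> {..<N}. ?E (p', h') y} \<subseteq> {y \<in> T \<times> {..<N}. ?E (p, h) y}"
    proof (rule conjugate_sums_nested[of "S \<times> {..<N}" "T \<times> {..<N}" "excess nu T" ?E "excess (\<lambda>q p. nu p q) S"])
      show "excess nu T x = card {y \<in> T \<times> {..<N}. ?E x y}" for x
        using excess_eq_card[of T nu N "fst x" "snd x"] fin N by simp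
      show "excess (\<lambda>q p. nu p q) S y = card {x \<in> S \<times> {..<N}. ?E x y}" for y
        using excess_eq_card[of S "\<lambda>q p. nu p q" N "fst y" "snd y"] fin N by (simp add: add.commute)
    qed (use fin conj True in auto)
    moreover have "\<forall>q. nu p q - h \<le> nu p' q - h'"
      if s: "{y \<in> T \<times> {..<N}. ?E (p, h) y} \<subseteq> {y \<in> T \<times> {..<N}. ?E (p', h') y}" for p p' h h'
    proof
      fix q
      show "nu p q - h \<le> nu p' q - h'"
      proof (rule ccontr)
        assume n: "\<not> nu p q - h \<le> nu p' q - h'"
        then have "0 < nu p q" by simp
        then have "q \<in> T" using nu unfolding supported_on_def by blast
        \<comment> \<open>The column (q, nu p' q - h') is the first one over \<open>q\<close>
          missing from row (p', h'), yet row (p, h) contains it.\<close>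
        moreover have "nu p' q - h' < N" using n N[of p q] by linarith
        moreover have "h + (nu p' q - h') < nu p q" using n by linarith
        ultimately have "(q, nu p' q - h') \<in> {y \<in> T \<times> {..<N}. ?E (p', h') y}" using s by force
        then have "?E (p', h') (q, nu p' q - h')" by blast
        then show False by simp
      qed
    qed
    ultimately show ?thesis by blast
  next
    case False
    have "nu p q - h = 0" if "p \<notin> S \<or> N \<le> h" for p q h
    proof (cases "p \<in> S")
      case True
      then show ?thesis using that N[of p q] by simp
    next
      case False
      then have "nu p q = 0" using nu unfolding supported_on_def by blast
      then show ?thesis by simp
    qed
    then have "(\<forall>q. nu p q - h = 0) \<or> (\<forall>q. nu p' q - h' = 0)" using False not_less by metis
    then show ?thesis by (metis le0)
  qed
qed

text \<open>Points outside the projections have multiplicity 0: they add only zero rows, comparable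
  to everything, and zero columns.\<close>

lemma chain_rows_iff_SZ:
  "chain_rows (\<lambda>p q. mu (p, q)) \<longleftrightarrow>
    (\<forall>u\<in>SZ mu. \<forall>v\<in>SZ mu. compwise_le (pi2 mu) u v \<or> compwise_le (pi2 mu) v u)" (is "_ \<longleftrightarrow> ?R")
proof
  assume "chain_rows (\<lambda>p q. mu (p, q))"
  then show ?R unfolding chain_rows_def SZ_def compwise_le_def by fast
next
  assume r: ?R
  have z2: "mu (p, q) = 0" if "q \<notin> pi2 mu" for p q using that unfolding pi2_def supp_def by force
  have z1: "mu (p, q) = 0" if "p \<notin> pi1 mu" for p q using that unfolding pi1_def supp_def by force
  have ext: "\<forall>q. u q \<le> v q" if "compwise_le (pi2 mu) u v" "u \<in> SZ mu" for u v
    using that z2 unfolding compwise_le_def SZ_def by fastforce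
  show "chain_rows (\<lambda>p q. mu (p, q))" unfolding chain_rows_def
  proof (intro allI)
    fix p p' h h'
    show "(\<forall>q. mu (p, q) - h \<le> mu (p', q) - h') \<or> (\<forall>q. mu (p', q) - h' \<le> mu (p, q) - h)"
    proof (cases "p \<in> pi1 mu \<and> p' \<in> pi1 mu")
      case True
      then have "(\<lambda>q. mu (p, q) - h) \<in> SZ mu" "(\<lambda>q. mu (p', q) - h') \<in> SZ mu" unfolding SZ_def by blast+
      then show ?thesis using r ext[of "\<lambda>q. mu (p, q) - h" "\<lambda>q. mu (p', q) - h'"]
          ext[of "\<lambda>q. mu (p', q) - h'" "\<lambda>q. mu (p, q) - h"] by blast
    qed (use z1 in auto)
  qed
qed

lemma alg_closed_infinite:
  assumes "\<forall>p :: 'k::field poly. 0 < degree p \<longrightarrow> (\<exists>x. poly p x = 0)"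
  shows "infinite (UNIV :: 'k set)"
proof
  assume fin: "finite (UNIV :: 'k set)"
  \<comment> \<open>Over a finite field this product vanishes everywhere, so adding 1 gives a
    nonconstant polynomial without roots.\<close>
  let ?p = "\<Prod>a\<in>(UNIV :: 'k set). [:- a, 1:]"
  have "degree ?p = card (UNIV :: 'k set)" by (subst degree_prod_eq_sum_degree) auto
  moreover have "0 < card (UNIV :: 'k set)" using fin by (simp add: card_gt_0_iff)
  ultimately have "0 < degree (?p + 1)" by (simp add: degree_add_eq_left)
  then obtain x where "poly (?p + 1) x = 0" using assms by blast
  moreover have "poly ?p x = 0" using fin by (auto simp: poly_prod)
  ultimately show False by simp
qed

theorem theorem4p8:
  fixes mu :: "'k::field option \<times> 'k option \<Rightarrow> nat"
  assumes alg_closed: "\<forall>p :: 'k poly. 0 < degree p \<longrightarrow> (\<exists>x. poly p x = 0)"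
    and fin: "finite (supp mu)"
    and nonempty: "supp mu \<noteq> {}"
  shows "(cohen_macaulay_quot (fat_ideal mu)
            \<longleftrightarrow> (\<exists>J :: (var2, 'k) mpoly set. bihom_ideal dg2 J \<and> artinian_quot J \<and>
                   (\<forall>i j. DeltaHZ mu (int i) (int j) = int (hilb dg2 J (i, j)))))
       \<and> (cohen_macaulay_quot (fat_ideal mu) \<longleftrightarrow> conj_part (alphaZ mu) = betaZ mu)
       \<and> (cohen_macaulay_quot (fat_ideal mu) \<longleftrightarrow>
            (\<forall>u\<in>SZ mu. \<forall>v\<in>SZ mu. compwise_le (pi2 mu) u v \<or> compwise_le (pi2 mu) v u))"
    (is "(?CM \<longleftrightarrow> ?Art) \<and> (_ \<longleftrightarrow> ?Conj) \<and> (_ \<longleftrightarrow> ?Chain)")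
proof -
  let ?nu = "\<lambda>p q. mu (p, q)"
  let ?S = "pi1 mu" and ?T = "pi2 mu"
  have finS: "finite ?S" "finite ?T" unfolding pi1_def pi2_def using fin by auto
  have ne: "?T \<noteq> {}" "?S \<noteq> {}" unfolding pi1_def pi2_def using nonempty by auto
  have nu: "supported_on ?S ?T ?nu"
    unfolding supported_on_def using finS by (force simp: pi1_def pi2_def supp_def)
  define N where "N = (\<Sum>P\<in>supp mu. mu P)"
  have N: "mu P \<le> N" for P
    using member_le_sum[of P "supp mu" mu] fin unfolding N_def by (cases "P \<in> supp mu") (auto simp: supp_def)
  obtain p q where pq: "0 < ?nu p q" using nonempty unfolding supp_def by auto
  have inf: "infinite (UNIV :: 'k option set)"
    using alg_closed_infinite[OF alg_closed] by simp
  \<comment> \<open>Lines of the two rulings that miss the support; their forms serve as L and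
    M.\<close>
  obtain r t where rt: "r \<notin> ?S" "t \<notin> ?T" using finS inf ex_new_if_finite by metis
  have r: "mu (r, q) = 0" for q using rt(1) unfolding pi1_def supp_def by force
  have t: "mu (p, t) = 0" for p using rt(2) unfolding pi2_def supp_def by force
  have CM: "?CM \<longleftrightarrow> nzd (lf False t) (adj (fat_ideal mu) (lf True r))"
    using cohen_macaulay_iff_regular[OF nu pq, of r t True] r t by (simp add: fat_ideal_eq)
  let ?R = "exceed (excess ?nu ?T) (?S \<times> {..<N})"
  let ?C = "exceed (excess (\<lambda>q p. mu (p, q)) ?S) (?T \<times> {..<N})"
  have al: "length (filter (\<lambda>x. Suc j \<le> x) (alphaZ mu)) = ?R j" for j
    unfolding alphaZ_def using N finS ne by (intro partition_filter_length(1)) auto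
  have be: "length (filter (\<lambda>x. Suc j \<le> x) (betaZ mu)) = ?C j" for j
    unfolding betaZ_def using N finS ne by (intro partition_filter_length(1)) auto
  have bepos: "0 < x" if "x \<in> set (betaZ mu)" for x
    using that N finS ne unfolding betaZ_def
    by (intro partition_filter_length(2)[of ?T "\<lambda>q p. mu (p, q)" N _ ?S]) auto
  have sorted: "sorted_wrt (\<ge>) (alphaZ mu)" "sorted_wrt (\<ge>) (betaZ mu)"
    unfolding alphaZ_def betaZ_def by (rule sorted_desc_rev_sorted)+
  have Conj: "?Conj \<longleftrightarrow> (\<forall>i j. i < ?R j \<longleftrightarrow> j < ?C i)"
    using conj_part_eq_iff[OF sorted bepos] unfolding al be .
  have 1: "?CM \<Longrightarrow> ?Art"
    unfolding CM by (rule regular_imp_artinian_difference[OF nu r t])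
  have 2: "?Art \<Longrightarrow> ?Conj"
    unfolding Conj using artinian_difference_imp_conjugate[OF nu N] unfolding bihom_ideal_def by blast
  have 3: "?Conj \<Longrightarrow> ?Chain"
    unfolding Conj chain_rows_iff_SZ[symmetric] using conjugate_imp_chain_rows[OF nu N] by blast
  have 4: "?Chain \<Longrightarrow> ?CM"
    unfolding CM chain_rows_iff_SZ[symmetric]
    using chain_rows_regular[OF nu, of r t True] r t by (simp add: fat_ideal_eq)
  show ?thesis using 1 2 3 4 by blast
qed

end
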